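(* Let $\theta_1,\theta_2,\theta_3\in(0,\pi/2)$ and on $\mathbb C^2\otimes\mathbb C^2\otimes\mathbb C^2$ (three parties, one qubit each) define $|A\rangle=\cos\theta_1|0\rangle+\sin\theta_1|1\rangle$, $|B\rangle=\cos\theta_2|0\rangle+\sin\theta_2|1\rangle$, $|C\rangle=\cos\theta_3|0\rangle+\sin\theta_3|1\rangle$, and let $|A^\perp\rangle,|B^\perp\rangle,|C^\perp\rangle$ be unit vectors orthogonal to $|A\rangle,|B\rangle,|C\rangle$ respectively. Let $$|S_1\rangle=|0\rangle|0\rangle|0\rangle,\ |S_2\rangle=|1\rangle|B\rangle|C\rangle,\ |S_3\rangle=|A\rangle|1\rangle|C^\perp\rangle,\ |S_4\rangle=|A^\perp\rangle|B^\perp\rangle|1\rangle,$$ and $S=\mathrm{span}\{|S_1\rangle,|S_2\rangle,|S_3\rangle,|S_4\rangle\}$. Then $S$ is locally indistinguishable, i.e. no orthonormal basis of $S$ is perfectly distinguishable by LOCC; however, $S$ has an orthonormal basis that is perfectly distinguishable by separable operations.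
   Context: "Perfectly distinguishable by LOCC": there is a finite-round protocol, in each round one of the three parties performing a local measurement and broadcasting the outcome, that identifies with probability 1 which state of the set was given. "Perfectly distinguishable by separable operations": there is a measurement $\{M_m\}$ with $\sum_m M_m^\dagger M_m=I$, each $M_m=A_m\otimes B_m\otimes C_m$ a product of local operators, and a map from outcomes to indices, such that for each state of the set the outcome identifies its index with probability 1. *)

theory Defs
  imports Complex_Main
begin

text \<open>Conventions. A qubit vector in C^2 is a function bool => complex
 (False = |0>, True = |1>). A three-qubit vector in C^2 (x) C^2 (x) C^2 is a
 function (bool * bool * bool) => complex. An operator on a finite-dimensional
 space with basis indexed by the finite type 'a is a matrix 'a => 'a => complex.\<close>

type_synonym qubit = "bool \<Rightarrow> complex"
type_synonym qstate = "bool \<times> bool \<times> bool \<Rightarrow> complex"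
type_synonym 'a op = "'a \<Rightarrow> 'a \<Rightarrow> complex"

definition cinner :: "('a::finite \<Rightarrow> complex) \<Rightarrow> ('a \<Rightarrow> complex) \<Rightarrow> complex" where
  "cinner u v = (\<Sum>x\<in>UNIV. cnj (u x) * v x)"

definition mat_apply :: "('a::finite) op \<Rightarrow> ('a \<Rightarrow> complex) \<Rightarrow> ('a \<Rightarrow> complex)" where
  "mat_apply M v = (\<lambda>x. \<Sum>y\<in>UNIV. M x y * v y)"

definition id_op :: "'a op" where
  "id_op x y = (if x = y then 1 else 0)"

definition complete_meas :: "nat set \<Rightarrow> (nat \<Rightarrow> ('a::finite) op) \<Rightarrow> bool" where
  "complete_meas Outs K \<longleftrightarrow> finite Outs \<and>
     (\<forall>y z. (\<Sum>k\<in>Outs. \<Sum>x\<in>UNIV. cnj (K k x y) * K k x z) = id_op y z)"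

definition tensor3 :: "bool op \<Rightarrow> bool op \<Rightarrow> bool op \<Rightarrow> (bool \<times> bool \<times> bool) op" where
  "tensor3 A B C = (\<lambda>(x1, x2, x3) (y1, y2, y3). A x1 y1 * B x2 y2 * C x3 y3)"

definition ket3 :: "qubit \<Rightarrow> qubit \<Rightarrow> qubit \<Rightarrow> qstate" where
  "ket3 a b c = (\<lambda>(x1, x2, x3). a x1 * b x2 * c x3)"

definition ket0 :: qubit where "ket0 = (\<lambda>b. if b then 0 else 1)"
definition ket1 :: qubit where "ket1 = (\<lambda>b. if b then 1 else 0)"

definition qb :: "real \<Rightarrow> qubit" where
  "qb \<theta> = (\<lambda>b. if b then complex_of_real (sin \<theta>) else complex_of_real (cos \<theta>))"

datatype party = PartyA | PartyB | PartyC

definition local_op :: "party \<Rightarrow> bool op \<Rightarrow> (bool \<times> bool \<times> bool) op" where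
  "local_op p K = (case p of PartyA \<Rightarrow> tensor3 K id_op id_op
                           | PartyB \<Rightarrow> tensor3 id_op K id_op
                           | PartyC \<Rightarrow> tensor3 id_op id_op K)"

text \<open>Perfect LOCC distinguishability of the family psi indexed by I.
  The family carries the (unnormalised) conditional post-measurement states
  along the current branch of the protocol. A leaf is reached when at most one
  index still has a nonzero conditional state (so the outcome history identifies
  the index with certainty). Otherwise some party performs a local measurement
  with finitely many outcomes, broadcasts the outcome, and the protocol continues
  on each branch. Inductiveness ensures finitely many rounds.\<close>
inductive locc_dist :: "('i \<Rightarrow> qstate) \<Rightarrow> 'i set \<Rightarrow> bool" where
  leaf: "(\<forall>i\<in>I. \<forall>j\<in>I. \<psi> i \<noteq> (\<lambda>_. 0) \<and> \<psi> j \<noteq> (\<lambda>_. 0) \<longrightarrow> i = j) \<Longrightarrow> locc_dist \<psi> I"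
| round: "complete_meas Outs K \<Longrightarrow>
          (\<forall>k\<in>Outs. locc_dist (\<lambda>i. mat_apply (local_op p (K k)) (\<psi> i)) I) \<Longrightarrow>
          locc_dist \<psi> I"

definition sep_dist :: "('i \<Rightarrow> qstate) \<Rightarrow> 'i set \<Rightarrow> bool" where
  "sep_dist \<psi> I \<longleftrightarrow> (\<exists>Outs A B C (f :: nat \<Rightarrow> 'i).
      complete_meas Outs (\<lambda>m. tensor3 (A m) (B m) (C m)) \<and>
      (\<forall>i\<in>I. \<forall>m\<in>Outs. f m \<noteq> i \<longrightarrow> mat_apply (tensor3 (A m) (B m) (C m)) (\<psi> i) = (\<lambda>_. 0)))"

definition cspan :: "qstate set \<Rightarrow> qstate set" where
  "cspan X = {(\<lambda>x. \<Sum>v\<in>X. c v * v x) | c. True}"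

definition is_onb_of :: "qstate set \<Rightarrow> qstate set \<Rightarrow> bool" where
  "is_onb_of S B \<longleftrightarrow> finite B \<and> (\<forall>b\<in>B. cinner b b = 1) \<and>
     (\<forall>b\<in>B. \<forall>b'\<in>B. b \<noteq> b' \<longrightarrow> cinner b b' = 0) \<and> cspan B = S"

end

theory Submission
  imports Defs
begin

text \<open>\<^emph>\<open>LOCC.\<close> Up to phases the four product vectors are real, and each party holds two orthonormal bases of
  \<open>\<complex>\<^sup>2\<close>, so its four projectors satisfy a linear relation with coefficients \<open>\<plusminus>1\<close>, unique up to scaling. The three
  sign patterns are pairwise different up to a global sign; hence no projective map sends the four vectors of one
  party to those of another, and the four products of the vectors of two parties are linearly independent.

  Follow a protocol along invertible operators up to the last node at which no operator has dropped rank. There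
  some party, say Alice, applies rank-one operators only, and two of the corresponding functionals \<open>l, l'\<close> are
  independent. After each of the outcomes \<open>l\<close> and \<open>l'\<close> either Bob or Charlie is the next to collapse. If Bob
  does so with functionals \<open>m, m'\<close>, then orthogonality in Charlie's qubit forces each of \<open>m, m'\<close> to annihilate two of
  the four states, unless \<open>l\<close> annihilates a state already, in which case that state is one of the product
  vectors. Since the states and the product vectors are orthonormal bases of the same space,
  \<open>\<bar>l(a\<^sub>j)\<bar>\<^sup>2 m(b\<^sub>j) cnj (m'(b\<^sub>j)) = z r\<^sub>j\<close> with Charlie's signs \<open>r\<close>. Thus \<open>l\<close> and \<open>l'\<close> each split the four states
  into two pairs, and comparing the two splittings (equal or crossing, by the same or by different parties) is
  contradictory in every case.

  \<^emph>\<open>Separable operations.\<close> \<open>S\<^sub>2, S\<^sub>3, S\<^sub>4\<close> extend to an orthonormal product basis of the whole space; its other five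
  vectors, being orthogonal to \<open>S\<^sub>2, S\<^sub>3, S\<^sub>4\<close>, announce \<open>S\<^sub>1\<close>.\<close>

section \<open>Four real vectors in the plane\<close>

text \<open>After a collapse the vectors left to the third party are orthogonal only for the inner
  product given by an unknown invertible operator, and the branches \<open>l\<close> and
  \<open>l'\<close> may come with different operators. The comparison therefore works with values of
  functionals at the four vectors. As these vectors are real, the conjugate of a value is a value of
  the conjugate functional; a product of two values is then a quadratic form, determined by three of
  the four vectors, and unique factorisation of binary quadratic forms matches functionals up to
  scalars. Three of the four cases end in a projective map that the signs forbid; for crossing
  blocks of the same party two unknown inner products have to be reconciled before that. For
  crossing blocks of different parties only moduli are compared: the ratios of \<open>m'\<close> to
  \<open>m\<close>, real up to a common factor, are nodes of a signed measure whose moments of order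
  0, 1, 2 vanish, and a positivity argument decides.\<close>

datatype ix = J1 | J2 | J3 | J4

lemma UNIV_ix: "UNIV = {J1, J2, J3, J4}"
  using ix.exhaust by auto

instance ix :: finite
  by standard (simp add: UNIV_ix)

lemma ix_exists_other: "\<exists>k :: ix. k \<noteq> j"
  by (metis ix.distinct(1))

text \<open>Bilinear, not sesquilinear: \<open>l\<close> is a row vector.\<close>

definition bra :: "qubit \<Rightarrow> qubit \<Rightarrow> complex" where
  "bra l v = l False * v False + l True * v True"

definition cross2 :: "qubit \<Rightarrow> qubit \<Rightarrow> complex" where
  "cross2 u v = u False * v True - u True * v False"

text \<open>\<open>r\<close> is 1 on one orthonormal basis of the qubit and -1 on the other, so the
  last clause is the difference of two resolutions of the identity. Reality lets conjugates pass
  from values to functionals; the product clause records an even number of minus signs, which later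
  fixes the sign of a product of ratios.\<close>

definition frame :: "(ix \<Rightarrow> real) \<Rightarrow> (ix \<Rightarrow> qubit) \<Rightarrow> bool" where
  "frame r v \<longleftrightarrow> (\<forall>j. r j = 1 \<or> r j = -1) \<and> (\<Prod>j\<in>UNIV. r j) = 1 \<and>
     (\<forall>j x. cnj (v j x) = v j x) \<and> (\<forall>j k. j \<noteq> k \<longrightarrow> cross2 (v j) (v k) \<noteq> 0) \<and>
     (\<forall>x y. (\<Sum>j\<in>UNIV. of_real (r j) * v j x * v j y) = 0)"

lemma card_ix: "card (UNIV :: ix set) = 4"
  by (simp add: UNIV_ix)

lemma distinct_ix_UNIV:
  assumes "distinct [j, k, l, m :: ix]"
  shows "UNIV = {j, k, l, m}"
proof -
  have "card {j, k, l, m} = card (UNIV :: ix set)"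
    using assms by (simp add: card_ix)
  then show ?thesis
    by (metis card_subset_eq finite subset_UNIV)
qed

lemma sum_ix:
  fixes f :: "ix \<Rightarrow> 'a::comm_monoid_add"
  assumes "distinct [j, k, l, m]"
  shows "sum f UNIV = f j + f k + f l + f m"
  unfolding distinct_ix_UNIV[OF assms] using assms by (simp add: add.assoc)

lemma prod_ix:
  fixes f :: "ix \<Rightarrow> 'a::comm_monoid_mult"
  assumes "distinct [j, k, l, m]"
  shows "prod f UNIV = f j * f k * f l * f m"
  unfolding distinct_ix_UNIV[OF assms] using assms by (simp add: mult.assoc)

lemma ix_complete3:
  assumes "distinct [j, k, l :: ix]"
  obtains m where "distinct [j, k, l, m]"
proof -
  have "card {j, k, l} < card (UNIV :: ix set)"
    using assms by (simp add: card_ix)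
  then obtain m where "m \<notin> {j, k, l}"
    by (metis UNIV_I less_irrefl subsetI subset_UNIV subset_antisym)
  then have "distinct [j, k, l, m]" using assms by auto
  then show thesis by (rule that)
qed

lemma ix_complete2:
  assumes "j \<noteq> (k :: ix)"
  obtains l m where "distinct [j, k, l, m]"
proof -
  have "card {j, k} < card (UNIV :: ix set)"
    using assms by (simp add: card_ix)
  then obtain l where "l \<notin> {j, k}"
    by (metis UNIV_I less_irrefl subsetI subset_UNIV subset_antisym)
  then have "distinct [j, k, l]" using assms by auto
  then show thesis using ix_complete3 that by blast
qed

lemma frameD:
  assumes "frame r v"
  shows "r j = 1 \<or> r j = -1" "(\<Prod>j\<in>UNIV. r j) = 1" "cnj (v j x) = v j x"
    "j \<noteq> k \<Longrightarrow> cross2 (v j) (v k) \<noteq> 0" "(\<Sum>j\<in>UNIV. of_real (r j) * v j x * v j y) = 0"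
  using assms unfolding frame_def by blast+

lemma frame_neq0: "frame r v \<Longrightarrow> r j \<noteq> 0"
  using frameD(1)[of r v j] by auto

lemma cross2_self [simp]: "cross2 u u = 0"
  by (simp add: cross2_def)

lemma cross2_swap: "cross2 u v = - cross2 v u"
  by (simp add: cross2_def)

text \<open>A relation between tensors can be tested by any pair of functionals; functionals that
  vanish at chosen vectors isolate single terms.\<close>

lemma bilinear_sum:
  fixes \<kappa> :: "ix \<Rightarrow> complex"
  assumes "\<And>x y. (\<Sum>j\<in>UNIV. \<kappa> j * v j x * w j y) = 0"
  shows "(\<Sum>j\<in>UNIV. \<kappa> j * cross2 (v j) p * cross2 (w j) q) = 0"
    and "(\<Sum>j\<in>UNIV. \<kappa> j * bra p (v j) * bra q (w j)) = 0"
proof -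
  have "(\<Sum>j\<in>UNIV. \<kappa> j * cross2 (v j) p * cross2 (w j) q) =
     p True * q True * (\<Sum>j\<in>UNIV. \<kappa> j * v j False * w j False)
     - p True * q False * (\<Sum>j\<in>UNIV. \<kappa> j * v j False * w j True)
     - p False * q True * (\<Sum>j\<in>UNIV. \<kappa> j * v j True * w j False)
     + p False * q False * (\<Sum>j\<in>UNIV. \<kappa> j * v j True * w j True)"
    unfolding sum_distrib_left sum_subtractf[symmetric] sum.distrib[symmetric]
    by (intro sum.cong) (auto simp: cross2_def algebra_simps)
  then show "(\<Sum>j\<in>UNIV. \<kappa> j * cross2 (v j) p * cross2 (w j) q) = 0"
    using assms by simp
  have "(\<Sum>j\<in>UNIV. \<kappa> j * bra p (v j) * bra q (w j)) =
     p False * q False * (\<Sum>j\<in>UNIV. \<kappa> j * v j False * w j False)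
     + p False * q True * (\<Sum>j\<in>UNIV. \<kappa> j * v j False * w j True)
     + p True * q False * (\<Sum>j\<in>UNIV. \<kappa> j * v j True * w j False)
     + p True * q True * (\<Sum>j\<in>UNIV. \<kappa> j * v j True * w j True)"
    unfolding sum_distrib_left sum_subtractf[symmetric] sum.distrib[symmetric]
    by (intro sum.cong) (auto simp: bra_def algebra_simps)
  then show "(\<Sum>j\<in>UNIV. \<kappa> j * bra p (v j) * bra q (w j)) = 0"
    using assms by simp
qed

text \<open>Symmetric tensors of a plane form a three-dimensional space, in which the squares of
  three pairwise independent vectors are a basis; the relations between four squares thus form a
  line.\<close>

lemma frame_relation_unique:
  assumes fr: "frame r v" and rel: "\<And>x y. (\<Sum>j\<in>UNIV. \<kappa> j * v j x * v j y) = 0"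
  obtains z where "\<And>j. \<kappa> j = z * of_real (r j)"
proof -
  define j0 :: ix where "j0 = J1"
  define z where "z = \<kappa> j0 / of_real (r j0)"
  define \<kappa>' where "\<kappa>' j = \<kappa> j - z * of_real (r j)" for j
  have 0: "\<kappa>' j0 = 0"
    using frame_neq0[OF fr] by (simp add: \<kappa>'_def z_def)
  have rel': "(\<Sum>j\<in>UNIV. \<kappa>' j * v j x * v j y) = 0" for x y
  proof -
    have "(\<Sum>j\<in>UNIV. \<kappa>' j * v j x * v j y) = (\<Sum>j\<in>UNIV. \<kappa> j * v j x * v j y)
       - z * (\<Sum>j\<in>UNIV. of_real (r j) * v j x * v j y)"
      unfolding sum_distrib_left sum_subtractf[symmetric]
      by (intro sum.cong) (auto simp: \<kappa>'_def algebra_simps)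
    then show ?thesis using rel frameD(5)[OF fr] by simp
  qed
  have "\<kappa>' k = 0" for k
  proof (cases "k = j0")
    case False
    then obtain l m where d: "distinct [j0, k, l, m]" by (metis ix_complete2)
    \<comment> \<open>The functionals with kernels spanned by \<open>v l\<close> and
      \<open>v m\<close> remove two terms and the subtraction has removed \<open>j0\<close>, so only
      the term at \<open>k\<close> is left.\<close>
    have "(\<Sum>j\<in>UNIV. \<kappa>' j * cross2 (v j) (v l) * cross2 (v j) (v m)) = 0"
      by (rule bilinear_sum) (rule rel')
    then have "\<kappa>' k * cross2 (v k) (v l) * cross2 (v k) (v m) = 0"
      unfolding sum_ix[OF d] by (simp add: 0)
    then show ?thesis using frameD(4)[OF fr] d by auto
  qed (simp add: 0)
  then have "\<kappa> j = z * of_real (r j)" for j by (simp add: \<kappa>'_def)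
  then show thesis using that by blast
qed

text \<open>A binary quadratic form has at most two zeros on the projective line unless it vanishes;
  the identity is Lagrange interpolation at \<open>a\<close>, \<open>b\<close>, \<open>c\<close>,
  cleared of denominators.\<close>

lemma quadratic_zero:
  fixes a b c :: qubit and q0 q1 q2 :: complex
  defines "q \<equiv> \<lambda>u :: qubit. q0 * u False * u False + q1 * u False * u True + q2 * u True * u True"
  assumes "cross2 a b \<noteq> 0" "cross2 b c \<noteq> 0" "cross2 c a \<noteq> 0" "q a = 0" "q b = 0" "q c = 0"
  shows "q u = 0"
proof -
  have "q u * cross2 a b * cross2 b c * cross2 c a =
    - (q a * cross2 u b * cross2 u c * cross2 b c + q b * cross2 u c * cross2 u a * cross2 c a
       + q c * cross2 u a * cross2 u b * cross2 a b)"
    unfolding q_def cross2_def by algebra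
  then show ?thesis using assms(2-) by simp
qed

lemma bra_product_eq:
  assumes "cross2 a b \<noteq> 0" "cross2 b c \<noteq> 0" "cross2 c a \<noteq> 0"
    and "\<And>w. w \<in> {a, b, c} \<Longrightarrow> bra f w * bra g w = \<kappa> * bra f' w * bra g' w"
  shows "bra f u * bra g u = \<kappa> * bra f' u * bra g' u"
proof -
  let ?q0 = "f False * g False - \<kappa> * f' False * g' False"
  let ?q1 = "f False * g True + f True * g False - \<kappa> * (f' False * g' True + f' True * g' False)"
  let ?q2 = "f True * g True - \<kappa> * f' True * g' True"
  have eq: "?q0 * w False * w False + ?q1 * w False * w True + ?q2 * w True * w True
     = bra f w * bra g w - \<kappa> * bra f' w * bra g' w" for w
    unfolding bra_def by algebra
  have "?q0 * u False * u False + ?q1 * u False * u True + ?q2 * u True * u True = 0"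
    by (rule quadratic_zero[OF assms(1-3)]) (unfold eq, use assms(4) in auto)
  then show ?thesis unfolding eq by simp
qed

text \<open>\<open>N\<close> sends each \<open>g j\<close> to a functional with kernel containing
  \<open>b j\<close>, as a projective map between the two quadruples would. Applied to the relation
  of \<open>g\<close> it yields a relation of \<open>b\<close> with coefficients \<open>rg j\<close>
  times squared moduli. By uniqueness these are proportional to \<open>rb j\<close>, so the sign
  patterns agree up to a global sign unless all moduli vanish.\<close>

lemma no_mobius:
  assumes b: "frame rb b" and g: "frame rg g" and ne: "rb \<noteq> rg" "rb \<noteq> (\<lambda>j. - rg j)"
    and N: "\<And>j. (\<Sum>x\<in>UNIV. \<Sum>y\<in>UNIV. N x y * b j x * g j y) = 0"
  shows "N x y = (0::complex)"
proof -
  define d where "d j x = N x False * g j False + N x True * g j True" for j x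
  have bd: "b j False * d j False + b j True * d j True = 0" for j
    using N[of j] by (simp add: d_def UNIV_bool algebra_simps)
  have bne: "b j False \<noteq> 0 \<or> b j True \<noteq> 0" for j
  proof -
    obtain k where "k \<noteq> j" using ix_exists_other by blast
    then show ?thesis using frameD(4)[OF b, of j k] by (auto simp: cross2_def)
  qed
  \<comment> \<open>Being annihilated by \<open>b j\<close>, the vector \<open>d j\<close> is a
    multiple of \<open>b j\<close> turned by a right angle.\<close>
  have "\<exists>\<nu>. d j False = \<nu> * b j True \<and> d j True = - \<nu> * b j False" for j
  proof (cases "b j True = 0")
    case True
    then have "b j False \<noteq> 0" "d j False = 0" using bne[of j] bd[of j] by auto
    then show ?thesis using True by (intro exI[of _ "- d j True / b j False"]) auto
  next
    case False
    have "b j True * d j True = - (b j False * d j False)"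
      using bd[of j] by (simp add: eq_neg_iff_add_eq_0 add.commute)
    then show ?thesis using False
      by (intro exI[of _ "d j False / b j True"]) (auto simp: field_simps)
  qed
  then obtain \<nu> where \<nu>: "\<And>j. d j False = \<nu> j * b j True" "\<And>j. d j True = - \<nu> j * b j False"
    by metis
  have rel: "(\<Sum>j\<in>UNIV. of_real (rg j) * d j x * cnj (d j y)) = 0" for x y
  proof -
    have "(\<Sum>j\<in>UNIV. of_real (rg j) * d j x * cnj (d j y))
       = (\<Sum>j\<in>UNIV. of_real (rg j) * bra (N x) (g j) * bra (\<lambda>s. cnj (N y s)) (g j))"
      by (intro sum.cong) (auto simp: d_def bra_def frameD(3)[OF g])
    also have "\<dots> = 0" by (rule bilinear_sum) (rule frameD(5)[OF g])
    finally show ?thesis .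
  qed
  define \<kappa> where "\<kappa> j = complex_of_real (rg j) * (\<nu> j * cnj (\<nu> j))" for j
  have rel': "(\<Sum>j\<in>UNIV. \<kappa> j * b j x * b j y) = 0" for x y
  proof -
    \<comment> \<open>Undoing the right angle exchanges the two coordinates and changes the sign off
      the diagonal.\<close>
    have "(\<Sum>j\<in>UNIV. \<kappa> j * b j x * b j y) =
      (if x = y then 1 else -1) * (\<Sum>j\<in>UNIV. of_real (rg j) * d j (\<not> x) * cnj (d j (\<not> y)))"
      unfolding sum_distrib_left
      by (intro sum.cong refl, cases x; cases y) (auto simp: \<kappa>_def \<nu> frameD(3)[OF b])
    then show ?thesis using rel by simp
  qed
  obtain z where z: "\<And>j. \<kappa> j = z * of_real (rb j)"
    using frame_relation_unique[OF b rel'] by blast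
  have zz: "complex_of_real (rb j * rg j * (cmod (\<nu> j))\<^sup>2) = z" for j
  proof -
    have "complex_of_real (rb j) * complex_of_real (rb j) = 1"
      using frameD(1)[OF b, of j] by auto
    then have "z = \<kappa> j * of_real (rb j)" using z[of j] by simp
    then show ?thesis unfolding \<kappa>_def of_real_mult complex_norm_square by (simp add: mult_ac)
  qed
  define R where "R = Re z"
  have R: "rb j * rg j * (cmod (\<nu> j))\<^sup>2 = R" for j
    using zz[of j] unfolding R_def by (metis Re_complex_of_real)
  have "R = 0"
  proof (rule ccontr)
    assume nz: "R \<noteq> 0"
    have s: "rb j * rg j = sgn R" for j
      using R[of j, symmetric] nz frameD(1)[OF b, of j] frameD(1)[OF g, of j]
      by (auto simp: sgn_mult sgn_if)
    show False
    proof (cases "R > 0")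
      case True
      then have "rb j = rg j" for j
        using s[of j] frameD(1)[OF b, of j] frameD(1)[OF g, of j] by auto
      then show False using ne by auto
    next
      case False
      then have "rb j = - rg j" for j
        using s[of j] nz frameD(1)[OF b, of j] frameD(1)[OF g, of j] by auto
      then show False using ne by auto
    qed
  qed
  then have "\<nu> j = 0" for j
    using R[of j] frameD(1)[OF b, of j] frameD(1)[OF g, of j] by auto
  then have d0: "d j x = 0" for j x using \<nu> by (cases x) auto
  have cr: "cross2 (g J1) (g J4) \<noteq> 0"
    by (rule frameD(4)[OF g]) simp
  have "N x False * cross2 (g J1) (g J4) =
      d J1 x * g J4 True - d J4 x * g J1 True"
    unfolding d_def cross2_def by algebra
  then have 1: "N x False = 0" using d0 cr by simp
  have "N x True * cross2 (g J1) (g J4) =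
      - d J1 x * g J4 False + d J4 x * g J1 False"
    unfolding d_def cross2_def by algebra
  then have "N x True = 0" using d0 cr by simp
  with 1 show ?thesis by (cases y) auto
qed

text \<open>As the sign patterns differ, there are two indices at which the products of the signs
  are opposite. Dependence would make two products of real cross products equal, while the two frame
  relations make their product negative.\<close>

lemma product_independent:
  assumes b: "frame rb b" and g: "frame rg g" and ne: "rb \<noteq> rg" "rb \<noteq> (\<lambda>j. - rg j)"
    and rel: "\<And>x y. (\<Sum>j\<in>UNIV. \<kappa> j * b j x * g j y) = 0"
  shows "\<kappa> j = (0::complex)"
proof -
  have "\<exists>k. rb k * rg k \<noteq> rb j * rg j"
  proof (rule ccontr)
    assume "\<not> ?thesis"
    then have eq: "rb k * rg k = rb j * rg j" for k by blast
    have "rb j * rg j = 1 \<or> rb j * rg j = -1"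
      using frameD(1)[OF b, of j] frameD(1)[OF g, of j] by auto
    then show False
    proof
      assume "rb j * rg j = 1"
      then have "rb k = rg k" for k
        using eq[of k] frameD(1)[OF b, of k] frameD(1)[OF g, of k] by auto
      then show False using ne by auto
    next
      assume "rb j * rg j = -1"
      then have "rb k = - rg k" for k
        using eq[of k] frameD(1)[OF b, of k] frameD(1)[OF g, of k] by auto
      then show False using ne by auto
    qed
  qed
  then obtain k where k: "rb k * rg k \<noteq> rb j * rg j" by blast
  then have "j \<noteq> k" by auto
  then obtain l m where d: "distinct [j, k, l, m]" by (metis ix_complete2)
  have neg: "rb k * rg k = - (rb j * rg j)"
    using k frameD(1)[OF b, of j] frameD(1)[OF g, of j] frameD(1)[OF b, of k] frameD(1)[OF g, of k]
    by auto
  have real: "\<exists>x. cross2 (v p) (v q) = complex_of_real x \<and> (p \<noteq> q \<longrightarrow> x \<noteq> 0)" if "frame r v" for r v p q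
  proof -
    have "cnj (cross2 (v p) (v q)) = cross2 (v p) (v q)"
      by (simp add: cross2_def frameD(3)[OF that])
    then have "cross2 (v p) (v q) = complex_of_real (Re (cross2 (v p) (v q)))"
      by (simp add: Reals_cnj_iff)
    then show ?thesis using frameD(4)[OF that, of p q] by (metis of_real_0)
  qed
  obtain bjl bjm bkl bkm where B: "cross2 (b j) (b l) = complex_of_real bjl"
     "cross2 (b j) (b m) = complex_of_real bjm" "cross2 (b k) (b l) = complex_of_real bkl"
     "cross2 (b k) (b m) = complex_of_real bkm" "bjl \<noteq> 0" "bjm \<noteq> 0" "bkl \<noteq> 0" "bkm \<noteq> 0"
    using real[OF b] d by (metis distinct_length_2_or_more)
  obtain gjl gjm gkl gkm where G: "cross2 (g j) (g l) = complex_of_real gjl"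
     "cross2 (g j) (g m) = complex_of_real gjm" "cross2 (g k) (g l) = complex_of_real gkl"
     "cross2 (g k) (g m) = complex_of_real gkm" "gjl \<noteq> 0" "gjm \<noteq> 0" "gkl \<noteq> 0" "gkm \<noteq> 0"
    using real[OF g] d by (metis distinct_length_2_or_more)
  have "(\<Sum>j\<in>UNIV. of_real (rb j) * cross2 (b j) (b l) * cross2 (b j) (b m)) = 0"
    by (rule bilinear_sum) (rule frameD(5)[OF b])
  then have "complex_of_real (rb j * bjl * bjm + rb k * bkl * bkm) = 0"
    unfolding sum_ix[OF d] by (simp add: B)
  then have b1: "rb j * bjl * bjm + rb k * bkl * bkm = 0" by (simp only: of_real_eq_0_iff)
  have "(\<Sum>j\<in>UNIV. of_real (rg j) * cross2 (g j) (g l) * cross2 (g j) (g m)) = 0"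
    by (rule bilinear_sum) (rule frameD(5)[OF g])
  then have "complex_of_real (rg j * gjl * gjm + rg k * gkl * gkm) = 0"
    unfolding sum_ix[OF d] by (simp add: G)
  then have g1: "rg j * gjl * gjm + rg k * gkl * gkm = 0" by (simp only: of_real_eq_0_iff)
  \<comment> \<open>Removing \<open>l\<close> through one factor and \<open>m\<close> through the
    other, in both ways, leaves two linear equations for \<open>\<kappa> j\<close> and
    \<open>\<kappa> k\<close>; a nonzero solution makes their determinant vanish.\<close>
  have "(\<Sum>j\<in>UNIV. \<kappa> j * cross2 (b j) (b l) * cross2 (g j) (g m)) = 0"
    by (rule bilinear_sum) (rule rel)
  then have k1: "\<kappa> j * bjl * gjm + \<kappa> k * bkl * gkm = 0"
    unfolding sum_ix[OF d] by (simp add: G B)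
  have "(\<Sum>j\<in>UNIV. \<kappa> j * cross2 (b j) (b m) * cross2 (g j) (g l)) = 0"
    by (rule bilinear_sum) (rule rel)
  then have k2: "\<kappa> j * bjm * gjl + \<kappa> k * bkm * gkl = 0"
    unfolding sum_ix[OF d] by (simp add: G B)
  define c where "c = - bkl * gkm / (bjl * gjm)"
  have kc: "\<kappa> j = of_real c * \<kappa> k"
    using k1 B G unfolding c_def by (simp add: field_simps add_eq_0_iff)
  have "\<kappa> k = 0"
  proof (rule ccontr)
    assume "\<kappa> k \<noteq> 0"
    then have "complex_of_real (c * bjm * gjl + bkm * gkl) = 0"
    proof -
      have "\<kappa> k * complex_of_real (c * bjm * gjl + bkm * gkl) = 0"
        using k2 unfolding kc by (simp add: algebra_simps)
      then show ?thesis using \<open>\<kappa> k \<noteq> 0\<close> by (simp only: mult_eq_0_iff simp_thms)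
    qed
    then have "c * bjm * gjl + bkm * gkl = 0" by (simp only: of_real_eq_0_iff)
    then have e2: "bkl * gkm * bjm * gjl = bkm * gkl * bjl * gjm"
      using B G unfolding c_def by (auto simp: field_simps)
    have e3: "(rb j * bjl * bjm) * (rg j * gjl * gjm) = (rb k * bkl * bkm) * (rg k * gkl * gkm)"
      using b1 g1 by algebra
    have "(bjl * bjm) * (gjl * gjm) = - ((bkl * bkm) * (gkl * gkm))"
    proof -
      have "(rb j * rg j) * ((bjl * bjm) * (gjl * gjm)) = (rb k * rg k) * ((bkl * bkm) * (gkl * gkm))"
        using e3 by (simp add: algebra_simps)
      then have "(rb j * rg j) * ((bjl * bjm) * (gjl * gjm) + (bkl * bkm) * (gkl * gkm)) = 0"
        unfolding neg by (simp add: algebra_simps)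
      then show ?thesis
        using frame_neq0[OF b, of j] frame_neq0[OF g, of j] by (simp add: eq_neg_iff_add_eq_0)
    qed
    \<comment> \<open>By \<open>e2\<close> one of the two factors may be replaced, and the square
      becomes the product of all eight real cross products, which is minus a square.\<close>
    then have "(bkl * gkm * bjm * gjl) * (bkl * gkm * bjm * gjl) = 
       - ((bkl * bkm) * (gkl * gkm)) * ((bkl * bkm) * (gkl * gkm))"
      using e2 by algebra
    then have "(bkl * gkm * bjm * gjl)\<^sup>2 \<le> 0"
      by (simp add: power2_eq_square)
    then show False using B G by simp
  qed
  then show ?thesis using kc by simp
qed

section \<open>Functionals, their kernels and their conjugates\<close>

definition rot :: "qubit \<Rightarrow> qubit" where
  "rot f = (\<lambda>b. if b then - f False else f True)"

definition cnjq :: "qubit \<Rightarrow> qubit" where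
  "cnjq f = (\<lambda>b. cnj (f b))"

definition det2 :: "bool op \<Rightarrow> complex" where
  "det2 K = K False False * K True True - K False True * K True False"

text \<open>Orthogonality of the functionals \<open>f\<close> and \<open>h\<close>, expressed through their kernels, which \<open>rot f\<close> and \<open>rot h\<close> span.\<close>

definition orth_ann :: "bool op \<Rightarrow> qubit \<Rightarrow> qubit \<Rightarrow> bool" where
  "orth_ann C f h \<longleftrightarrow> cinner (mat_apply C (rot f)) (mat_apply C (rot h)) = 0"

lemma bra_rot: "bra g (rot f) = cross2 g f"
  by (simp add: bra_def rot_def cross2_def)

lemma bra_cross2: "bra n u * bra n' v - bra n' u * bra n v = cross2 n n' * cross2 u v"
  unfolding bra_def cross2_def by algebra

lemma cross2_rot: "cross2 (rot f) (rot g) = cross2 f g"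
  by (simp add: cross2_def rot_def)

lemma cross2_cnjq: "cross2 (cnjq f) (cnjq g) = cnj (cross2 f g)"
  by (simp add: cross2_def cnjq_def)

lemma cnjq_cnjq [simp]: "cnjq (cnjq f) = f"
  by (simp add: cnjq_def)

lemma cross2_nonzero:
  assumes "cross2 f g \<noteq> 0"
  obtains x y where "f x \<noteq> 0" "g y \<noteq> 0"
  using assms unfolding cross2_def by (metis diff_self mult_zero_left mult_zero_right)

lemma cross2_eq_0D:
  assumes "cross2 f g = 0" and "f x \<noteq> 0"
  obtains c where "\<And>y. g y = c * f y"
proof
  fix y show "g y = (g x / f x) * f y"
    using assms by (cases x; cases y) (auto simp: cross2_def field_simps)
qed

lemma bra_scale: "(\<And>y. g y = c * f y) \<Longrightarrow> bra g u = c * bra f u"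
  by (simp add: bra_def algebra_simps)

lemma bra_cnjq: "frame r g \<Longrightarrow> bra (cnjq f) (g j) = cnj (bra f (g j))"
  by (simp add: bra_def cnjq_def frameD(3))

lemma cinner_bool: "cinner u v = cnj (u False) * v False + cnj (u True) * v (True :: bool)"
  by (simp add: cinner_def UNIV_bool)

lemma mat_apply_bool: "mat_apply K v = (\<lambda>x. K x False * v False + K x True * v (True :: bool))"
  by (simp add: mat_apply_def UNIV_bool add.commute)

lemma frame_bra_eq_0:
  assumes g: "frame r g" and "bra f (g j) = 0" "bra f (g k) = 0" "j \<noteq> k"
  shows "f x = 0"
proof -
  have "f False * cross2 (g j) (g k) = bra f (g j) * g k True - bra f (g k) * g j True"
       "f True * cross2 (g j) (g k) = bra f (g k) * g j False - bra f (g j) * g k False"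
    unfolding cross2_def bra_def by algebra+
  then show ?thesis using assms frameD(4)[OF g] by (cases x) auto
qed

text \<open>The form \<open>l\<close> tensor \<open>m\<close> minus \<open>c\<close> times
  \<open>l'\<close> tensor \<open>k\<close> vanishes at all pairs \<open>a j\<close>,
  \<open>b j\<close>, hence identically, and independent \<open>l\<close>, \<open>l'\<close> then
  leave no room for a nonzero \<open>m\<close>.\<close>

lemma no_mobius_bra:
  assumes "frame ra a" "frame rb b" "ra \<noteq> rb" "ra \<noteq> (\<lambda>j. - rb j)"
    and eq: "\<And>j. bra l (a j) * bra m (b j) = c * bra l' (a j) * bra k (b j)"
    and ll: "cross2 l l' \<noteq> 0"
  shows "m y = 0"
proof -
  have N: "l x * m y - c * l' x * k y = 0" for x y
    by (rule no_mobius[OF assms(1-4), where N = "\<lambda>x y. l x * m y - c * l' x * k y"])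
       (use eq in \<open>simp add: UNIV_bool bra_def algebra_simps\<close>)
  have "m y * cross2 l l' = (l False * m y - c * l' False * k y) * l' True
     - (l True * m y - c * l' True * k y) * l' False"
    unfolding cross2_def by algebra
  then show ?thesis using N ll by simp
qed

lemma frame_three:
  assumes "frame r g" "distinct [i, j, k]"
  shows "cross2 (g i) (g j) \<noteq> 0" "cross2 (g j) (g k) \<noteq> 0" "cross2 (g k) (g i) \<noteq> 0"
proof -
  have "i \<noteq> j" "j \<noteq> k" "k \<noteq> i" using assms(2) by auto
  then show "cross2 (g i) (g j) \<noteq> 0" "cross2 (g j) (g k) \<noteq> 0" "cross2 (g k) (g i) \<noteq> 0"
    using frameD(4)[OF assms(1)] by blast+
qed

text \<open>Three vectors determine a quadratic form, so one index may be left out, namely one at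
  which a functional to be cancelled vanishes.\<close>

lemma frame_bra_product_eq:
  assumes g: "frame r g"
    and eq: "\<And>j. j \<noteq> j0 \<Longrightarrow> bra f (g j) * bra h (g j) = \<kappa> * bra f' (g j) * bra h' (g j)"
  shows "bra f u * bra h u = \<kappa> * bra f' u * bra h' u"
proof -
  obtain i where "i \<noteq> j0" using ix_exists_other by blast
  then obtain j k where d: "distinct [j0, i, j, k]" by (metis ix_complete2)
  then have ds: "distinct [i, j, k]" and n: "i \<noteq> j0" "j \<noteq> j0" "k \<noteq> j0" by auto
  show ?thesis
    by (rule bra_product_eq[OF frame_three[OF g ds]])
       (use eq[OF n(1)] eq[OF n(2)] eq[OF n(3)] in blast)
qed

section \<open>Comparing two splittings\<close>

text \<open>Eliminating the common factors of the two states leaves an identity of quadratic forms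
  on the third qubit. Unique factorisation makes \<open>g1\<close> proportional to \<open>f1\<close>
  and \<open>g2\<close> to \<open>f2\<close>, with the same constant; the third qubit then cancels,
  and what remains is excluded by \<open>no_mobius_bra\<close>.\<close>

lemma same_kind_same_block:
  assumes a: "frame ra a" and b: "frame rb b" and g: "frame rg g"
    and ne: "ra \<noteq> rb" "ra \<noteq> (\<lambda>j. - rb j)"
    and nz: "\<And>j. bra l (a j) \<noteq> 0" "\<And>j. bra m (b j) \<noteq> 0" "\<And>j. bra l' (a j) \<noteq> 0" "\<And>j. bra k (b j) \<noteq> 0"
    and e1: "\<And>j. bra l (a j) * bra m (b j) * bra f1 (g j) = bra l' (a j) * bra k (b j) * bra g1 (g j)"
    and e2: "\<And>j. bra l (a j) * bra m (b j) * bra f2 (g j) = bra l' (a j) * bra k (b j) * bra g2 (g j)"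
    and ll: "cross2 l l' \<noteq> 0" and ff: "cross2 f1 f2 \<noteq> 0"
  shows False
proof -
  have q: "bra f1 (g j) * bra g2 (g j) = 1 * bra f2 (g j) * bra g1 (g j)" for j
  proof -
    have "(bra l (a j) * bra m (b j) * bra l' (a j) * bra k (b j)) *
        (bra f1 (g j) * bra g2 (g j)) =
       (bra l (a j) * bra m (b j) * bra l' (a j) * bra k (b j)) *
        (bra f2 (g j) * bra g1 (g j))"
      using e1[of j] e2[of j] by algebra
    then show ?thesis using nz by simp
  qed
  have Q: "bra f1 u * bra g2 u = 1 * bra f2 u * bra g1 u" for u
    by (rule frame_bra_product_eq[OF g]) (rule q)
  have "cross2 f2 f1 \<noteq> 0" using ff cross2_swap[of f1 f2] by simp
  then have 1: "cross2 g1 f1 = 0" and 2: "cross2 g2 f2 = 0"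
    using Q[of "rot f1"] Q[of "rot f2"] ff by (auto simp: bra_rot)
  obtain x1 where "f1 x1 \<noteq> 0" using cross2_nonzero[OF ff] by blast
  then obtain c1 where c1: "\<And>y. g1 y = c1 * f1 y"
    using cross2_eq_0D 1 cross2_swap[of g1 f1] by (metis neg_equal_0_iff_equal)
  obtain x2 where "f2 x2 \<noteq> 0" using cross2_nonzero[OF ff] by blast
  then obtain c2 where c2: "\<And>y. g2 y = c2 * f2 y"
    using cross2_eq_0D 2 cross2_swap[of g2 f2] by (metis neg_equal_0_iff_equal)
  have "c1 = c2"
  proof -
    define u where "u = (\<lambda>x. rot f1 x + rot f2 x)"
    have "bra f1 u = cross2 f1 f2" "bra f2 u = cross2 f2 f1"
      by (auto simp: u_def bra_def rot_def cross2_def algebra_simps)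
    then have "bra f1 u \<noteq> 0" "bra f2 u \<noteq> 0" using ff \<open>cross2 f2 f1 \<noteq> 0\<close> by auto
    then show ?thesis using Q[of u] by (simp add: bra_scale[OF c1] bra_scale[OF c2])
  qed
  have lm: "bra l (a j) * bra m (b j) = c1 * bra l' (a j) * bra k (b j)" for j
  proof -
    have "bra f1 (g j) \<noteq> 0 \<or> bra f2 (g j) \<noteq> 0"
    proof (rule ccontr)
      assume "\<not> ?thesis"
      then have z: "bra f1 (g j) = 0" "bra f2 (g j) = 0" by auto
      obtain j' where "j' \<noteq> j" using ix_exists_other by blast
      then show False
        using bra_cross2[of f1 "g j" f2 "g j'"] z ff frameD(4)[OF g, of j j'] by auto
    qed
    then show ?thesis
      using e1[of j] e2[of j] \<open>c1 = c2\<close> by (auto simp: bra_scale[OF c1] bra_scale[OF c2])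
  qed
  have "m y = 0" for y
    by (rule no_mobius_bra[OF a b ne lm ll])
  then show False using nz(2)[of "J1"] by (simp add: bra_def)
qed

text \<open>Here the leftover functionals belong to different parties, so the same elimination gives
  a bilinear form on the two qubits instead of a quadratic one, and \<open>no_mobius_bra\<close>
  applies at once.\<close>

lemma different_kind_same_block:
  assumes a: "frame ra a" and b: "frame rb b" and g: "frame rg g"
    and ne: "rg \<noteq> rb" "rg \<noteq> (\<lambda>j. - rb j)"
    and nz: "\<And>j. bra l (a j) \<noteq> 0" "\<And>j. bra m (b j) \<noteq> 0" "\<And>j. bra l' (a j) \<noteq> 0" "\<And>j. bra n (g j) \<noteq> 0"
    and e1: "\<And>j. bra l (a j) * bra m (b j) * bra f1 (g j) = bra l' (a j) * bra n (g j) * bra h1 (b j)"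
    and e2: "\<And>j. bra l (a j) * bra m (b j) * bra f2 (g j) = bra l' (a j) * bra n (g j) * bra h2 (b j)"
    and ff: "cross2 f1 f2 \<noteq> 0"
  shows False
proof -
  have q: "bra f1 (g j) * bra h2 (b j) = 1 * bra f2 (g j) * bra h1 (b j)" for j
  proof -
    have "(bra l (a j) * bra m (b j) * bra l' (a j) * bra n (g j)) *
        (bra f1 (g j) * bra h2 (b j)) =
       (bra l (a j) * bra m (b j) * bra l' (a j) * bra n (g j)) *
        (bra f2 (g j) * bra h1 (b j))"
      using e1[of j] e2[of j] by algebra
    then show ?thesis using nz by simp
  qed
  have "h2 y = 0" for y by (rule no_mobius_bra[OF g b ne q ff])
  then have "bra f2 (g j) = 0" for j using e2[of j] nz by (simp add: bra_def)
  then have "f2 y = 0" for y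
    using frame_bra_eq_0[OF g, of f2 "J1" "J4"] by simp
  then show False using ff by (simp add: cross2_def)
qed

section \<open>Orthogonality for the inner products of invertible operators\<close>

lemma orthogonal_independent:
  assumes "det2 C \<noteq> 0" "cinner (mat_apply C u) (mat_apply C v) = 0" "u x \<noteq> 0" "v y \<noteq> 0"
  shows "cross2 u v \<noteq> 0"
proof
  assume "cross2 u v = 0"
  then obtain c where c: "\<And>z. v z = c * u z" using cross2_eq_0D assms(3) by blast
  then have "c \<noteq> 0" using assms(4) by auto
  have "mat_apply C v = (\<lambda>z. c * mat_apply C u z)"
    by (auto simp: mat_apply_bool c algebra_simps)
  then have "c * cinner (mat_apply C u) (mat_apply C u) = 0"
    using assms(2) by (simp add: cinner_bool algebra_simps)
  then have "cinner (mat_apply C u) (mat_apply C u) = 0" using \<open>c \<noteq> 0\<close> by simp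
  then have "complex_of_real ((cmod (mat_apply C u False))\<^sup>2 + (cmod (mat_apply C u True))\<^sup>2) = 0"
    unfolding cinner_bool of_real_add complex_norm_square by (simp add: mult.commute)
  then have "(cmod (mat_apply C u False))\<^sup>2 + (cmod (mat_apply C u True))\<^sup>2 = 0"
    by (simp only: of_real_eq_0_iff)
  then have "mat_apply C u False = 0" "mat_apply C u True = 0"
    by (auto simp: sum_power2_eq_zero_iff)
  moreover have "det2 C * u False = C True True * mat_apply C u False - C False True * mat_apply C u True"
    "det2 C * u True = C False False * mat_apply C u True - C True False * mat_apply C u False"
    by (auto simp: det2_def mat_apply_bool algebra_simps)
  ultimately have "u z = 0" for z using assms(1) by (cases z) auto
  then show False using assms(3) by simp
qed

lemma cinner_pos:
  assumes "det2 C \<noteq> 0" "u x \<noteq> 0"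
  obtains r where "r > 0" "cinner (mat_apply C u) (mat_apply C u) = complex_of_real r"
proof
  let ?r = "(cmod (mat_apply C u False))\<^sup>2 + (cmod (mat_apply C u True))\<^sup>2"
  show eq: "cinner (mat_apply C u) (mat_apply C u) = complex_of_real ?r"
    unfolding cinner_bool of_real_add complex_norm_square by (simp add: mult.commute)
  have "cinner (mat_apply C u) (mat_apply C u) \<noteq> 0"
    using orthogonal_independent[of C u u x x] assms by auto
  then have "?r \<noteq> 0" unfolding eq by (simp only: of_real_eq_0_iff simp_thms)
  then show "?r > 0" by (metis add_nonneg_nonneg order_less_le zero_le_power2)
qed

text \<open>Orthogonality for \<open>D\<close> and for \<open>F\<close> alternates around the cycle
  \<open>a\<close>, \<open>p\<close>, \<open>q\<close>, \<open>b\<close>. In the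
  \<open>F\<close>-orthogonal basis \<open>a\<close>, \<open>b\<close> the two conditions for
  \<open>D\<close> determine \<open>p\<close> and \<open>q\<close> up to scale from
  \<open>y\<close>, the \<open>D\<close>-product of \<open>a\<close> and \<open>b\<close>; the last
  condition for \<open>F\<close> then forces \<open>y\<close> to vanish, which makes
  \<open>p\<close> parallel to \<open>b\<close>.\<close>

lemma orthogonal_quadruple:
  assumes D: "det2 D \<noteq> 0" and F: "det2 F \<noteq> 0"
    and ap: "cinner (mat_apply D a) (mat_apply D p) = 0"
    and bq: "cinner (mat_apply D b) (mat_apply D q) = 0"
    and ab: "cinner (mat_apply F a) (mat_apply F b) = 0"
    and pq: "cinner (mat_apply F p) (mat_apply F q) = 0"
    and nz: "a xa \<noteq> 0" "b xb \<noteq> 0" "p xp \<noteq> 0" "q xq \<noteq> 0"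
  shows "cross2 p b = 0"
proof -
  have c: "cross2 a b \<noteq> 0" by (rule orthogonal_independent[OF F ab nz(1,2)])
  define s where "s = cross2 p b / cross2 a b"
  define t where "t = cross2 a p / cross2 a b"
  define s' where "s' = cross2 q b / cross2 a b"
  define t' where "t' = cross2 a q / cross2 a b"
  have exp: "v z = (cross2 v b / cross2 a b) * a z + (cross2 a v / cross2 a b) * b z" for v z
    using c by (cases z) (simp add: field_simps, simp add: cross2_def algebra_simps)+
  have p: "p = (\<lambda>z. s * a z + t * b z)" unfolding s_def t_def using exp[of p] by blast
  have q: "q = (\<lambda>z. s' * a z + t' * b z)" unfolding s'_def t'_def using exp[of q] by blast
  have lin: "cinner (mat_apply M w) (mat_apply M (\<lambda>z. x * u z + y * v z)) =
     x * cinner (mat_apply M w) (mat_apply M u) + y * cinner (mat_apply M w) (mat_apply M v)"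
    for M :: "bool op" and w u v x y
    by (simp add: cinner_bool mat_apply_bool algebra_simps)
  have lin': "cinner (mat_apply M (\<lambda>z. x * u z + y * v z)) (mat_apply M w) =
     cnj x * cinner (mat_apply M u) (mat_apply M w) + cnj y * cinner (mat_apply M v) (mat_apply M w)"
    for M :: "bool op" and w u v x y
    by (simp add: cinner_bool mat_apply_bool algebra_simps)
  have herm: "cinner (mat_apply M u) (mat_apply M v) = cnj (cinner (mat_apply M v) (mat_apply M u))"
    for M :: "bool op" and u v
    by (simp add: cinner_bool algebra_simps)
  obtain x where x: "x > 0" "cinner (mat_apply D a) (mat_apply D a) = complex_of_real x"
    using cinner_pos[of D a xa] D nz(1) by blast
  obtain w where w: "w > 0" "cinner (mat_apply D b) (mat_apply D b) = complex_of_real w"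
    using cinner_pos[of D b xb] D nz(2) by blast
  obtain A where A: "A > 0" "cinner (mat_apply F a) (mat_apply F a) = complex_of_real A"
    using cinner_pos[of F a xa] F nz(1) by blast
  obtain B where B: "B > 0" "cinner (mat_apply F b) (mat_apply F b) = complex_of_real B"
    using cinner_pos[of F b xb] F nz(2) by blast
  define y where "y = cinner (mat_apply D a) (mat_apply D b)"
  have y': "cinner (mat_apply D b) (mat_apply D a) = cnj y" unfolding y_def by (rule herm)
  have ba: "cinner (mat_apply F b) (mat_apply F a) = 0" using herm[of F b a] ab by simp
  have 1: "s * x + t * y = 0" using ap unfolding p lin x y_def .
  have 2: "s' * cnj y + t' * w = 0" using bq unfolding q lin y' w .
  have 3: "cnj s * s' * A + cnj t * t' * B = 0"
    using pq unfolding p q lin lin' A B ab ba by (simp add: algebra_simps)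
  have "t \<noteq> 0"
  proof
    assume "t = 0"
    then have "s = 0" using 1 x by simp
    then show False using \<open>t = 0\<close> p nz(3) by simp
  qed
  have "s' \<noteq> 0"
  proof
    assume "s' = 0"
    then have "t' = 0" using 2 w by simp
    then show False using \<open>s' = 0\<close> q nz(4) by simp
  qed
  have s: "s = - t * y / x" using 1 x by (simp add: field_simps eq_neg_iff_add_eq_0)
  have t': "t' = - s' * cnj y / w" using 2 w by (simp add: field_simps eq_neg_iff_add_eq_0 add.commute)
  \<comment> \<open>Both terms of the condition carry the same complex factor with positive weights,
    so they cannot cancel.\<close>
  have "cnj t * s' * cnj y * complex_of_real (A / x + B / w) = 0"
  proof -
    have "cnj t * s' * cnj y * complex_of_real (A / x + B / w) = - (cnj s * s' * A + cnj t * t' * B)"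
      unfolding s t' by (simp add: algebra_simps)
    then show ?thesis using 3 by simp
  qed
  moreover have "complex_of_real (A / x + B / w) \<noteq> 0"
    using A B x w by (metis add_pos_pos divide_pos_pos less_irrefl of_real_eq_0_iff)
  ultimately have "y = 0" using \<open>t \<noteq> 0\<close> \<open>s' \<noteq> 0\<close> by auto
  then have "s = 0" using s by simp
  then show ?thesis unfolding s_def using c by simp
qed

text \<open>Taking moduli in \<open>e1\<close> removes \<open>f\<close> and \<open>h\<close>, and
  dividing by the two sign relations removes \<open>l\<close> and \<open>l'\<close>. The remaining
  identity between \<open>m\<close>, \<open>m'\<close>, \<open>k\<close>, \<open>k'\<close> makes
  \<open>k\<close> proportional to \<open>m\<close>, so the second qubit cancels from
  \<open>e1\<close> and \<open>no_mobius_bra\<close> applies to the first and third.\<close>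

lemma equal_moduli_contradiction:
  assumes a: "frame ra a" and b: "frame rb b" and g: "frame rg g"
    and ne: "ra \<noteq> rg" "ra \<noteq> (\<lambda>j. - rg j)"
    and nz: "\<And>j. bra l (a j) \<noteq> 0" "\<And>j. bra m (b j) \<noteq> 0" "\<And>j. bra l' (a j) \<noteq> 0" "\<And>j. bra k (b j) \<noteq> 0"
    and e1: "\<And>j. bra l (a j) * bra m (b j) * bra f (g j) = bra l' (a j) * bra k (b j) * bra h (g j)"
    and z: "\<And>j. bra l (a j) * cnj (bra l (a j)) * bra m (b j) * cnj (bra m' (b j)) = z * of_real (rg j)" "z \<noteq> 0"
    and z': "\<And>j. bra l' (a j) * cnj (bra l' (a j)) * bra k (b j) * cnj (bra k' (b j)) = z' * of_real (rg j)" "z' \<noteq> 0"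
    and ll: "cross2 l l' \<noteq> 0" and mm: "cross2 m m' \<noteq> 0" and fnz: "f x \<noteq> 0"
    and mod: "\<And>j. bra h (g j) * cnj (bra h (g j)) = c * (bra f (g j) * cnj (bra f (g j)))"
  shows False
proof -
  obtain j0 where j0: "\<And>j. j \<noteq> j0 \<Longrightarrow> bra f (g j) \<noteq> 0"
    using frame_bra_eq_0[OF g] fnz by metis
  obtain j1 :: ix where j1: "j1 \<noteq> j0" using ix_exists_other by blast
  have M: "bra l (a j) * cnj (bra l (a j)) * bra m (b j) * cnj (bra m (b j))
     = c * (bra l' (a j) * cnj (bra l' (a j)) * bra k (b j) * cnj (bra k (b j)))" if "j \<noteq> j0" for j
  proof -
    have "(bra l (a j) * bra m (b j) * bra f (g j)) * cnj (bra l (a j) * bra m (b j) * bra f (g j)) =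
      (bra l' (a j) * bra k (b j) * bra h (g j)) * cnj (bra l' (a j) * bra k (b j) * bra h (g j))"
      unfolding e1 ..
    then have "(bra f (g j) * cnj (bra f (g j))) * (bra l (a j) * cnj (bra l (a j)) * bra m (b j) * cnj (bra m (b j)))
      = (bra h (g j) * cnj (bra h (g j))) * (bra l' (a j) * cnj (bra l' (a j)) * bra k (b j) * cnj (bra k (b j)))"
      by (simp add: mult_ac)
    then have "(bra f (g j) * cnj (bra f (g j))) * (bra l (a j) * cnj (bra l (a j)) * bra m (b j) * cnj (bra m (b j)))
      = (bra f (g j) * cnj (bra f (g j))) * (c * (bra l' (a j) * cnj (bra l' (a j)) * bra k (b j) * cnj (bra k (b j))))"
      unfolding mod by (simp add: mult_ac)
    then show ?thesis using j0[OF that] by simp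
  qed
  have c: "c \<noteq> 0" using M[OF j1] nz(1,2)[of j1] by auto
  have kk: "bra m (b j) * bra k' (b j) = cnj (c * z' / z) * bra k (b j) * bra m' (b j)" if "j \<noteq> j0" for j
  proof -
    let ?L = "bra l (a j) * cnj (bra l (a j))" and ?L' = "bra l' (a j) * cnj (bra l' (a j))"
    let ?m = "bra m (b j)" and ?m' = "bra m' (b j)" and ?k = "bra k (b j)" and ?k' = "bra k' (b j)"
    have 1: "z' * (?L * ?m * cnj ?m') = z * (?L' * ?k * cnj ?k')"
      unfolding z z' by simp
    have 2: "?L * ?m * cnj ?m = c * (?L' * ?k * cnj ?k)" using M[OF that] .
    have "(?L' * ?k) * ?m * (z * (cnj ?m * cnj ?k') - c * z' * (cnj ?k * cnj ?m')) = 0"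
      using 1 2 by algebra
    then have "z * (cnj ?m * cnj ?k') = c * z' * (cnj ?k * cnj ?m')" using nz by simp
    then have "cnj ?m * cnj ?k' = (c * z' / z) * cnj ?k * cnj ?m'"
      using z(2) by (simp add: field_simps)
    then have "cnj (cnj ?m * cnj ?k') = cnj ((c * z' / z) * cnj ?k * cnj ?m')" by simp
    then show ?thesis by simp
  qed
  have Q: "bra m u * bra k' u = cnj (c * z' / z) * bra k u * bra m' u" for u
    by (rule frame_bra_product_eq[OF b]) (rule kk)
  have "cross2 m' m \<noteq> 0" using mm cross2_swap[of m m'] by simp
  then have "cross2 k m = 0" using Q[of "rot m"] c z(2) z'(2) by (auto simp: bra_rot)
  then have km: "cross2 m k = 0" using cross2_swap[of k m] by simp
  obtain x0 where "m x0 \<noteq> 0" using cross2_nonzero[OF mm] by blast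
  then obtain d where d: "\<And>y. k y = d * m y" using cross2_eq_0D[OF km] by blast
  have "bra l (a j) * bra f (g j) = d * bra l' (a j) * bra h (g j)" for j
    using e1[of j] nz(2)[of j] by (simp add: bra_scale[OF d] mult_ac)
  then have "f y = 0" for y by (rule no_mobius_bra[OF a g ne _ ll])
  then show False using fnz by simp
qed

lemma orth_ann_cong:
  assumes "orth_ann C f h" "\<And>x. f' x = c * f x" "\<And>x. h' x = d * h x"
  shows "orth_ann C f' h'"
proof -
  have "cinner (mat_apply C (rot f')) (mat_apply C (rot h')) =
     cnj c * d * cinner (mat_apply C (rot f)) (mat_apply C (rot h))"
    by (simp add: cinner_bool mat_apply_bool rot_def assms(2,3) algebra_simps)
  then show ?thesis using assms(1) by (simp add: orth_ann_def)
qed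

lemma orth_ann_cnjq:
  "orth_ann (\<lambda>x y. cnj (C x y)) (cnjq f) (cnjq h) \<longleftrightarrow> orth_ann C f h"
proof -
  have "cinner (mat_apply (\<lambda>x y. cnj (C x y)) (rot (cnjq f))) (mat_apply (\<lambda>x y. cnj (C x y)) (rot (cnjq h)))
    = cnj (cinner (mat_apply C (rot f)) (mat_apply C (rot h)))"
    by (simp add: cinner_bool mat_apply_bool rot_def cnjq_def)
  then show ?thesis by (simp add: orth_ann_def)
qed

lemma orth_ann_sym: "orth_ann C f h \<Longrightarrow> orth_ann C h f"
proof -
  have "cinner (mat_apply C (rot h)) (mat_apply C (rot f)) = cnj (cinner (mat_apply C (rot f)) (mat_apply C (rot h)))"
    by (simp add: cinner_bool mult.commute)
  then show "orth_ann C f h \<Longrightarrow> orth_ann C h f" by (simp add: orth_ann_def)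
qed

lemma orth_ann_quadruple:
  assumes "det2 D \<noteq> 0" "det2 F \<noteq> 0" "orth_ann D a p" "orth_ann D b q" "orth_ann F a b" "orth_ann F p q"
    "a xa \<noteq> 0" "b xb \<noteq> 0" "p xp \<noteq> 0" "q xq \<noteq> 0"
  shows "cross2 p b = 0"
proof -
  have nz: "rot f (\<not> x) \<noteq> 0" if "f x \<noteq> 0" for f x using that by (cases x) (auto simp: rot_def)
  have "cross2 (rot p) (rot b) = 0"
    by (rule orthogonal_quadruple[of D F "rot a" "rot p" "rot b" "rot q" "\<not> xa" "\<not> xb" "\<not> xp" "\<not> xq"])
       (use assms nz in \<open>auto simp: orth_ann_def\<close>)
  then show ?thesis by (simp add: cross2_rot)
qed

text \<open>One splitting pairs the states as 12 and 34, the other as 13 and 24. The equation of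
  state 1 times the conjugate of that of state 4 contains both sign relations, which leaves
  \<open>f1\<close> times the conjugate of \<open>f4\<close> proportional to \<open>h1\<close> times
  the conjugate of \<open>h4\<close>; similarly for 2 and 3. As moduli exclude \<open>h1\<close>
  parallel to \<open>f1\<close>, the factors match crosswise, and orthogonality for \<open>C\<close>
  becomes orthogonality of the \<open>h\<close> for a second inner product.\<close>

lemma same_kind_crossing_blocks:
  assumes a: "frame ra a" and b: "frame rb b" and g: "frame rg g"
    and ne: "ra \<noteq> rg" "ra \<noteq> (\<lambda>j. - rg j)"
    and nz: "\<And>j. bra l (a j) \<noteq> 0" "\<And>j. bra m (b j) \<noteq> 0" "\<And>j. bra l' (a j) \<noteq> 0" "\<And>j. bra k (b j) \<noteq> 0"
      "\<And>j. bra k' (b j) \<noteq> 0"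
    and e1: "\<And>j. bra l (a j) * bra m (b j) * bra f1 (g j) = bra l' (a j) * bra k (b j) * bra h1 (g j)"
    and e2: "\<And>j. bra l (a j) * bra m (b j) * bra f2 (g j) = bra l' (a j) * bra k' (b j) * bra h2 (g j)"
    and e3: "\<And>j. bra l (a j) * bra m' (b j) * bra f3 (g j) = bra l' (a j) * bra k (b j) * bra h3 (g j)"
    and e4: "\<And>j. bra l (a j) * bra m' (b j) * bra f4 (g j) = bra l' (a j) * bra k' (b j) * bra h4 (g j)"
    and z: "\<And>j. bra l (a j) * cnj (bra l (a j)) * bra m (b j) * cnj (bra m' (b j)) = z * of_real (rg j)" "z \<noteq> 0"
    and z': "\<And>j. bra l' (a j) * cnj (bra l' (a j)) * bra k (b j) * cnj (bra k' (b j)) = z' * of_real (rg j)" "z' \<noteq> 0"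
    and ll: "cross2 l l' \<noteq> 0" and mm: "cross2 m m' \<noteq> 0"
    and C: "det2 C \<noteq> 0" "cross2 f1 f2 \<noteq> 0" "orth_ann C f1 f2" "cross2 f3 f4 \<noteq> 0" "orth_ann C f3 f4"
    and D: "det2 D \<noteq> 0" "cross2 h1 h3 \<noteq> 0" "orth_ann D h1 h3" "cross2 h2 h4 \<noteq> 0" "orth_ann D h2 h4"
  shows False
proof -
  obtain x1 x2 where nf12: "f1 x1 \<noteq> 0" "f2 x2 \<noteq> 0" using cross2_nonzero[OF C(2)] by blast
  obtain x3 x4 where nf34: "f3 x3 \<noteq> 0" "f4 x4 \<noteq> 0" using cross2_nonzero[OF C(4)] by blast
  obtain y1 y3 where nh13: "h1 y1 \<noteq> 0" "h3 y3 \<noteq> 0" using cross2_nonzero[OF D(2)] by blast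
  obtain y2 y4 where nh24: "h2 y2 \<noteq> 0" "h4 y4 \<noteq> 0" using cross2_nonzero[OF D(4)] by blast
  have z'': "bra l' (a j) * cnj (bra l' (a j)) * bra k' (b j) * cnj (bra k (b j)) = cnj z' * of_real (rg j)" for j
    using arg_cong[OF z'(1)[of j], of cnj] by (simp add: mult_ac)
  have q1: "bra f1 (g j) * bra (cnjq f4) (g j) = z' / z * bra h1 (g j) * bra (cnjq h4) (g j)" for j
  proof -
    have "(bra l (a j) * bra m (b j) * bra f1 (g j)) * cnj (bra l (a j) * bra m' (b j) * bra f4 (g j)) =
      (bra l' (a j) * bra k (b j) * bra h1 (g j)) * cnj (bra l' (a j) * bra k' (b j) * bra h4 (g j))"
      unfolding e1 e4 ..
    then have "(bra l (a j) * cnj (bra l (a j)) * bra m (b j) * cnj (bra m' (b j))) * (bra f1 (g j) * cnj (bra f4 (g j)))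
      = (bra l' (a j) * cnj (bra l' (a j)) * bra k (b j) * cnj (bra k' (b j))) * (bra h1 (g j) * cnj (bra h4 (g j)))"
      by (simp add: mult_ac)
    then have "of_real (rg j) * (z * (bra f1 (g j) * cnj (bra f4 (g j)))) = of_real (rg j) * (z' * (bra h1 (g j) * cnj (bra h4 (g j))))"
      unfolding z z' by (simp only: mult_ac)
    then have "z * (bra f1 (g j) * cnj (bra f4 (g j))) = z' * (bra h1 (g j) * cnj (bra h4 (g j)))"
      using frame_neq0[OF g, of j] by simp
    then show ?thesis using z(2) by (simp add: bra_cnjq[OF g] field_simps)
  qed
  have q2: "bra f2 (g j) * bra (cnjq f3) (g j) = cnj z' / z * bra h2 (g j) * bra (cnjq h3) (g j)" for j
  proof -
    have "(bra l (a j) * bra m (b j) * bra f2 (g j)) * cnj (bra l (a j) * bra m' (b j) * bra f3 (g j)) =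
      (bra l' (a j) * bra k' (b j) * bra h2 (g j)) * cnj (bra l' (a j) * bra k (b j) * bra h3 (g j))"
      unfolding e2 e3 ..
    then have "(bra l (a j) * cnj (bra l (a j)) * bra m (b j) * cnj (bra m' (b j))) * (bra f2 (g j) * cnj (bra f3 (g j)))
      = (bra l' (a j) * cnj (bra l' (a j)) * bra k' (b j) * cnj (bra k (b j))) * (bra h2 (g j) * cnj (bra h3 (g j)))"
      by (simp add: mult_ac)
    then have "of_real (rg j) * (z * (bra f2 (g j) * cnj (bra f3 (g j)))) = of_real (rg j) * (cnj z' * (bra h2 (g j) * cnj (bra h3 (g j))))"
      unfolding z z'' by (simp only: mult_ac)
    then have "z * (bra f2 (g j) * cnj (bra f3 (g j))) = cnj z' * (bra h2 (g j) * cnj (bra h3 (g j)))"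
      using frame_neq0[OF g, of j] by simp
    then show ?thesis using z(2) by (simp add: bra_cnjq[OF g] field_simps)
  qed
  have Q1: "bra f1 u * bra (cnjq f4) u = z' / z * bra h1 u * bra (cnjq h4) u" for u
    by (rule frame_bra_product_eq[OF g]) (rule q1)
  have Q2: "bra f2 u * bra (cnjq f3) u = cnj z' / z * bra h2 u * bra (cnjq h3) u" for u
    by (rule frame_bra_product_eq[OF g]) (rule q2)
  \<comment> \<open>This covers \<open>h1\<close> proportional to \<open>f1\<close> and also to the
    conjugate of \<open>f1\<close>, as the vectors \<open>g j\<close> are real; both are met
    below.\<close>
  have A1: False if mod: "\<And>j. bra h1 (g j) * cnj (bra h1 (g j)) = c * (bra f1 (g j) * cnj (bra f1 (g j)))" for c
    by (rule equal_moduli_contradiction[OF a b g ne nz(1-4) e1 z z' ll mm nf12(1) mod])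
  have A2: False if mod: "\<And>j. bra h2 (g j) * cnj (bra h2 (g j)) = c * (bra f2 (g j) * cnj (bra f2 (g j)))" for c
    by (rule equal_moduli_contradiction[OF a b g ne nz(1-3) nz(5) e2 z z'' _ ll mm nf12(2) mod])
       (use z'(2) in simp)
  have h1f1: "cross2 f1 h1 \<noteq> 0"
  proof
    assume "cross2 f1 h1 = 0"
    then obtain c where c: "\<And>y. h1 y = c * f1 y" using cross2_eq_0D[of f1 h1 x1] nf12 by blast
    show False by (rule A1[of "c * cnj c"]) (simp add: bra_scale[OF c] mult_ac)
  qed
  have h2f2: "cross2 f2 h2 \<noteq> 0"
  proof
    assume "cross2 f2 h2 = 0"
    then obtain c where c: "\<And>y. h2 y = c * f2 y" using cross2_eq_0D[of f2 h2 x2] nf12 by blast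
    show False by (rule A2[of "c * cnj c"]) (simp add: bra_scale[OF c] mult_ac)
  qed
  \<comment> \<open>At the kernel of one factor the other side must vanish too, and its first factor
    does not.\<close>
  have c1: "cross2 (cnjq h4) f1 = 0" "cross2 (cnjq f4) h1 = 0"
    using Q1[of "rot f1"] Q1[of "rot h1"] h1f1 cross2_swap[of f1 h1] z(2) z'(2) by (auto simp: bra_rot)
  have c2: "cross2 (cnjq h3) f2 = 0" "cross2 (cnjq f3) h2 = 0"
    using Q2[of "rot f2"] Q2[of "rot h2"] h2f2 cross2_swap[of f2 h2] z(2) z'(2) by (auto simp: bra_rot)
  have nc: "cnjq f x \<noteq> 0" if "f x \<noteq> 0" for f x using that by (simp add: cnjq_def)
  have flip: "cross2 (cnjq u) v = 0 \<Longrightarrow> cross2 u (cnjq v) = 0" for u v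
    using cross2_cnjq[of "cnjq u" v] by simp
  obtain \<alpha> where \<alpha>: "\<And>y. cnjq f1 y = \<alpha> * h4 y"
    using cross2_eq_0D[OF flip[OF c1(1)] nh24(2)] by blast
  obtain \<beta> where \<beta>: "\<And>y. cnjq f2 y = \<beta> * h3 y"
    using cross2_eq_0D[OF flip[OF c2(1)] nh13(2)] by blast
  obtain \<gamma> where \<gamma>: "\<And>y. h1 y = \<gamma> * cnjq f4 y"
    using cross2_eq_0D[OF c1(2) nc[of f4, OF nf34(2)]] by blast
  obtain \<delta> where \<delta>: "\<And>y. h2 y = \<delta> * cnjq f3 y"
    using cross2_eq_0D[OF c2(2) nc[of f3, OF nf34(1)]] by blast
  have a0: "\<alpha> \<noteq> 0" "\<beta> \<noteq> 0" using \<alpha>[of x1] \<beta>[of x2] nc[of f1, OF nf12(1)] nc[of f2, OF nf12(2)] by auto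
  let ?F = "\<lambda>x y. cnj (C x y)"
  have F: "det2 ?F \<noteq> 0" using C(1) by (simp add: det2_def flip: complex_cnj_mult complex_cnj_diff)
  have o12: "orth_ann ?F (cnjq f2) (cnjq f1)" using orth_ann_sym[OF C(3)] by (simp add: orth_ann_cnjq)
  have i3: "h3 y = (1 / \<beta>) * cnjq f2 y" and i4: "h4 y = (1 / \<alpha>) * cnjq f1 y" for y
    using \<alpha>[of y] \<beta>[of y] a0 by auto
  have o34: "orth_ann ?F h3 h4" by (rule orth_ann_cong[OF o12 i3 i4])
  have "orth_ann ?F (cnjq f4) (cnjq f3)" using orth_ann_sym[OF C(5)] by (simp add: orth_ann_cnjq)
  then have o12': "orth_ann ?F h1 h2" by (rule orth_ann_cong[OF _ \<gamma> \<delta>])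
  \<comment> \<open>The cycle is \<open>h3\<close>, \<open>h1\<close>, \<open>h2\<close>,
    \<open>h4\<close>, alternately orthogonal for \<open>D\<close> and for the conjugate of
    \<open>C\<close>.\<close>
  have "cross2 h1 h4 = 0"
    by (rule orth_ann_quadruple[OF D(1) F orth_ann_sym[OF D(3)] orth_ann_sym[OF D(5)] o34 o12'
          nh13(2) nh24(2) nh13(1) nh24(1)])
  then have "cross2 h4 h1 = 0" using cross2_swap[of h4 h1] by simp
  then obtain \<epsilon> where \<epsilon>: "\<And>y. h1 y = \<epsilon> * h4 y" using cross2_eq_0D[of h4 h1 y4] nh24 by blast
  have h: "h1 y = (\<epsilon> / \<alpha>) * cnjq f1 y" for y using \<epsilon>[of y] i4[of y] by simp
  show False
    by (rule A1[of "(\<epsilon> / \<alpha>) * cnj (\<epsilon> / \<alpha>)"]) (simp add: bra_scale[OF h] bra_cnjq[OF g] mult_ac)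
qed

section \<open>Moments of a frame and crossing blocks of different parties\<close>

text \<open>The moments of order \<open>-1\<close> and \<open>3\<close> have opposite signs when the product of the nodes is positive;
  this is the sign that makes the crossing case for different parties impossible.\<close>

lemma vandermonde_moments:
  fixes r1 r2 r3 r4 u1 u2 u3 u4 :: real
  assumes S: "r1 + r2 + r3 + r4 = 0" "r1 * u1 + r2 * u2 + r3 * u3 + r4 * u4 = 0"
    "r1 * u1\<^sup>2 + r2 * u2\<^sup>2 + r3 * u3\<^sup>2 + r4 * u4\<^sup>2 = 0"
  defines "G \<equiv> r1 * u1^3 + r2 * u2^3 + r3 * u3^3 + r4 * u4^3"
  shows "r1 * (u2 * u3 * u4) + r2 * (u1 * u3 * u4) + r3 * (u1 * u2 * u4) + r4 * (u1 * u2 * u3) = - G"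
    and "G = r1 * (u1 - u2) * (u1 - u3) * (u1 - u4)"
  using S unfolding G_def by algebra+

text \<open>The frame relation is tested on \<open>p\<close>, \<open>q\<close> and their conjugates.
  Since \<open>q\<close> is \<open>w\<close> times a real multiple of \<open>p\<close> at each
  vector, the tests are moments of the signed weights \<open>r j * P j\<close> at the nodes
  \<open>t j\<close>.\<close>

lemma frame_moments:
  fixes p q :: qubit and t :: "ix \<Rightarrow> real"
  assumes v: "frame r v" and w: "w \<noteq> 0"
    and q: "\<And>j. bra q (v j) = w * of_real (t j) * bra p (v j)"
  defines "P \<equiv> \<lambda>j. (cmod (bra p (v j)))\<^sup>2"
  shows "(\<Sum>j\<in>UNIV. r j * P j) = 0" "(\<Sum>j\<in>UNIV. r j * P j * t j) = 0" "(\<Sum>j\<in>UNIV. r j * P j * (t j)\<^sup>2) = 0"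
proof -
  have P: "complex_of_real (P j) = bra p (v j) * cnj (bra p (v j))" for j
    unfolding P_def by (rule complex_norm_square)
  have B: "(\<Sum>j\<in>UNIV. of_real (r j) * bra e (v j) * bra e' (v j)) = 0" for e e'
    by (rule bilinear_sum) (rule frameD(5)[OF v])
  have "complex_of_real (\<Sum>j\<in>UNIV. r j * P j) = 0"
    using B[of p "cnjq p"] by (simp add: P bra_cnjq[OF v] mult.assoc)
  then show "(\<Sum>j\<in>UNIV. r j * P j) = 0" by (simp only: of_real_eq_0_iff)
  have "w * complex_of_real (\<Sum>j\<in>UNIV. r j * P j * t j) = 0"
    using B[of q "cnjq p"] by (simp add: P bra_cnjq[OF v] q sum_distrib_left mult_ac)
  then show "(\<Sum>j\<in>UNIV. r j * P j * t j) = 0" using w by (simp only: mult_eq_0_iff of_real_eq_0_iff simp_thms)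
  have "w * cnj w * complex_of_real (\<Sum>j\<in>UNIV. r j * P j * (t j)\<^sup>2) = 0"
    using B[of q "cnjq q"] by (simp add: P bra_cnjq[OF v] q sum_distrib_left mult_ac power2_eq_square)
  then show "(\<Sum>j\<in>UNIV. r j * P j * (t j)\<^sup>2) = 0"
    using w by (simp only: mult_eq_0_iff of_real_eq_0_iff complex_cnj_zero_iff simp_thms)
qed

text \<open>At the frame the squared modulus of \<open>f\<close> is \<open>P j\<close> times a real
  quadratic polynomial in \<open>t j\<close>. The weight \<open>t j\<close> shifts its terms to
  moments 1, 2, 3 and the inverse weight to moments -1, 0, 1; of these only the moments 3 and -1 can
  differ from zero.\<close>

lemma frame_weighted:
  fixes p q :: qubit and t :: "ix \<Rightarrow> real"
  assumes v: "frame r v" and w: "w \<noteq> 0"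
    and q: "\<And>j. bra q (v j) = w * of_real (t j) * bra p (v j)"
    and f: "\<And>u. bra f u = x * bra p u + y * bra q u" and t: "\<And>j. t j \<noteq> 0"
  defines "P \<equiv> \<lambda>j. (cmod (bra p (v j)))\<^sup>2"
  shows "(\<Sum>j\<in>UNIV. r j * t j * (cmod (bra f (v j)))\<^sup>2) = (cmod (y * w))\<^sup>2 * (\<Sum>j\<in>UNIV. r j * P j * t j ^ 3)"
    and "(\<Sum>j\<in>UNIV. r j / t j * (cmod (bra f (v j)))\<^sup>2) = (cmod x)\<^sup>2 * (\<Sum>j\<in>UNIV. r j * P j / t j)"
proof -
  define B where "B = 2 * Re (x * cnj (y * w))"
  have F: "(cmod (bra f (v j)))\<^sup>2 = P j * ((cmod x)\<^sup>2 + B * t j + (cmod (y * w))\<^sup>2 * (t j)\<^sup>2)" for j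
  proof -
    have "bra f (v j) = (x + y * w * of_real (t j)) * bra p (v j)"
      unfolding f q by (simp add: algebra_simps)
    then have "(cmod (bra f (v j)))\<^sup>2 = (cmod (x + y * w * of_real (t j)))\<^sup>2 * P j"
      by (simp add: norm_mult power_mult_distrib P_def)
    also have "(cmod (x + y * w * of_real (t j)))\<^sup>2 = (cmod x)\<^sup>2 + B * t j + (cmod (y * w))\<^sup>2 * (t j)\<^sup>2"
      unfolding cmod_power2 B_def by (simp add: algebra_simps power2_eq_square)
    finally show ?thesis by simp
  qed
  have M: "(\<Sum>j\<in>UNIV. r j * P j) = 0" "(\<Sum>j\<in>UNIV. r j * P j * t j) = 0" "(\<Sum>j\<in>UNIV. r j * P j * (t j)\<^sup>2) = 0"
    using frame_moments[OF v w q] by (simp_all add: P_def)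
  have "(\<Sum>j\<in>UNIV. r j * t j * (cmod (bra f (v j)))\<^sup>2) =
     (cmod x)\<^sup>2 * (\<Sum>j\<in>UNIV. r j * P j * t j) + B * (\<Sum>j\<in>UNIV. r j * P j * (t j)\<^sup>2)
     + (cmod (y * w))\<^sup>2 * (\<Sum>j\<in>UNIV. r j * P j * t j ^ 3)"
    unfolding F sum_distrib_left sum.distrib[symmetric]
    by (intro sum.cong) (auto simp: algebra_simps power2_eq_square power3_eq_cube)
  then show "(\<Sum>j\<in>UNIV. r j * t j * (cmod (bra f (v j)))\<^sup>2) = (cmod (y * w))\<^sup>2 * (\<Sum>j\<in>UNIV. r j * P j * t j ^ 3)"
    using M by simp
  have "(\<Sum>j\<in>UNIV. r j / t j * (cmod (bra f (v j)))\<^sup>2) =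
     (cmod x)\<^sup>2 * (\<Sum>j\<in>UNIV. r j * P j / t j) + B * (\<Sum>j\<in>UNIV. r j * P j)
     + (cmod (y * w))\<^sup>2 * (\<Sum>j\<in>UNIV. r j * P j * t j)"
    unfolding F sum_distrib_left sum.distrib[symmetric]
  proof (intro sum.cong refl)
    fix j
    show "r j / t j * (P j * ((cmod x)\<^sup>2 + B * t j + (cmod (y * w))\<^sup>2 * (t j)\<^sup>2)) =
      (cmod x)\<^sup>2 * (r j * P j / t j) + B * (r j * P j) + (cmod (y * w))\<^sup>2 * (r j * P j * t j)"
      using t[of j] by (simp add: field_simps power2_eq_square)
  qed
  then show "(\<Sum>j\<in>UNIV. r j / t j * (cmod (bra f (v j)))\<^sup>2) = (cmod x)\<^sup>2 * (\<Sum>j\<in>UNIV. r j * P j / t j)"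
    using M by simp
qed

text \<open>Independence of \<open>p\<close> and \<open>q\<close> makes the four nodes distinct, so
  nonzero weights that annihilate all polynomials of degree at most 2 cannot annihilate the
  cube.\<close>

lemma frame_third_moment:
  fixes p q :: qubit and t :: "ix \<Rightarrow> real"
  assumes v: "frame r v" and w: "w \<noteq> 0"
    and q: "\<And>j. bra q (v j) = w * of_real (t j) * bra p (v j)"
    and pnz: "\<And>j. bra p (v j) \<noteq> 0" and pq: "cross2 p q \<noteq> 0"
    and t: "\<And>j. t j \<noteq> 0" and tp: "(\<Prod>j\<in>UNIV. t j) > 0"
  defines "P \<equiv> \<lambda>j. (cmod (bra p (v j)))\<^sup>2"
  defines "G \<equiv> (\<Sum>j\<in>UNIV. r j * P j * t j ^ 3)"
  shows "G \<noteq> 0" and "(\<Sum>j\<in>UNIV. r j * P j / t j) = - G / (\<Prod>j\<in>UNIV. t j)"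
proof -
  let ?a = "J1" and ?b = "J2" and ?c = "J3" and ?d = "J4"
  have d: "distinct [?a, ?b, ?c, ?d]" by simp
  have M: "(\<Sum>j\<in>UNIV. r j * P j) = 0" "(\<Sum>j\<in>UNIV. r j * P j * t j) = 0" "(\<Sum>j\<in>UNIV. r j * P j * (t j)\<^sup>2) = 0"
    using frame_moments[OF v w q] by (simp_all add: P_def)
  note V = vandermonde_moments[OF M[unfolded sum_ix[OF d]]]
  have G: "G = r ?a * P ?a * t ?a ^ 3 + r ?b * P ?b * t ?b ^ 3 + r ?c * P ?c * t ?c ^ 3 + r ?d * P ?d * t ?d ^ 3"
    unfolding G_def sum_ix[OF d] ..
  have td: "t j \<noteq> t k" if "j \<noteq> k" for j k
  proof
    assume "t j = t k"
    then have "bra p (v j) * bra q (v k) - bra q (v j) * bra p (v k) = 0" by (simp add: q)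
    then show False unfolding bra_cross2 using pq frameD(4)[OF v that] by simp
  qed
  show "G \<noteq> 0" unfolding G V(2)
    using td[of ?a ?b] td[of ?a ?c] td[of ?a ?d] frame_neq0[OF v, of ?a] pnz[of ?a] by (simp add: P_def)
  have "(\<Sum>j\<in>UNIV. r j * P j / t j) * (\<Prod>j\<in>UNIV. t j) = - G"
    unfolding G V(1)[symmetric] sum_ix[OF d] prod_ix[OF d]
    using t[of ?a] t[of ?b] t[of ?c] t[of ?d] by (simp add: field_simps)
  then show "(\<Sum>j\<in>UNIV. r j * P j / t j) = - G / (\<Prod>j\<in>UNIV. t j)"
    using t by (subst nonzero_eq_divide_eq) auto
qed

lemma bra_decompose:
  assumes "cross2 p q \<noteq> 0"
  obtains x y where "\<And>u. bra f u = x * bra p u + y * bra q u" "\<And>z. f z = x * p z + y * q z"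
proof
  have e: "f z = cross2 f q / cross2 p q * p z + cross2 p f / cross2 p q * q z" for z
    using assms by (cases z) (simp add: field_simps, simp add: cross2_def algebra_simps)+
  then show "f z = cross2 f q / cross2 p q * p z + cross2 p f / cross2 p q * q z" for z .
  show "bra f u = cross2 f q / cross2 p q * bra p u + cross2 p f / cross2 p q * bra q u" for u
    unfolding bra_def e[of False] e[of True] by (simp add: algebra_simps)
qed

text \<open>The sign relation fixes the phase of the ratio of \<open>m'\<close> to \<open>m\<close>
  up to sign; with one \<open>z\<close> for all four vectors the ratios lie on one real
  line.\<close>

lemma ratio_from_relation:
  assumes r: "l * cnj l * m * cnj m' = z * of_real r" and nz: "l \<noteq> 0" "m \<noteq> 0"
  shows "m' = cnj z * of_real (r / ((cmod l)\<^sup>2 * (cmod m)\<^sup>2)) * m"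
proof -
  have "cnj (l * cnj l * m * cnj m') = cnj (z * of_real r)"
    unfolding r ..
  then have "(l * cnj l) * (m * cnj m) * m' = cnj z * of_real r * m"
    by (simp add: mult_ac)
  then have e: "complex_of_real ((cmod l)\<^sup>2 * (cmod m)\<^sup>2) * m' = cnj z * of_real r * m"
    unfolding of_real_mult complex_norm_square .
  have "(cmod l)\<^sup>2 * (cmod m)\<^sup>2 \<noteq> 0" using nz by simp
  then have n: "complex_of_real ((cmod l)\<^sup>2 * (cmod m)\<^sup>2) \<noteq> 0"
    unfolding of_real_eq_0_iff .
  have "m' = cnj z * of_real r * m / complex_of_real ((cmod l)\<^sup>2 * (cmod m)\<^sup>2)"
    using e n by (metis nonzero_mult_div_cancel_left)
  then show ?thesis by simp
qed

text \<open>Squared moduli of \<open>e1\<close> and \<open>e2\<close>, summed with suitable signed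
  weights, give two equations between the third moments \<open>G3\<close> and \<open>B3\<close>. The
  first is compatible only with equal signs and the second only with opposite signs, unless its
  coefficients vanish. So one of the two is degenerate; its functionals are then multiples of
  \<open>m\<close> and of \<open>n\<close> or \<open>n'\<close>, which cancel and leave
  \<open>l\<close> proportional to \<open>l'\<close>.\<close>

lemma different_kind_crossing_blocks:
  assumes a: "frame ra a" and b: "frame rb b" and g: "frame rg g"
    and nz: "\<And>j. bra l (a j) \<noteq> 0" "\<And>j. bra m (b j) \<noteq> 0" "\<And>j. bra l' (a j) \<noteq> 0" "\<And>j. bra n (g j) \<noteq> 0"
      "\<And>j. bra n' (g j) \<noteq> 0"
    and e1: "\<And>j. bra l (a j) * bra m (b j) * bra f1 (g j) = bra l' (a j) * bra n (g j) * bra h1 (b j)"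
    and e2: "\<And>j. bra l (a j) * bra m (b j) * bra f2 (g j) = bra l' (a j) * bra n' (g j) * bra h2 (b j)"
    and z: "\<And>j. bra l (a j) * cnj (bra l (a j)) * bra m (b j) * cnj (bra m' (b j)) = z * of_real (rg j)" "z \<noteq> 0"
    and z': "\<And>j. bra l' (a j) * cnj (bra l' (a j)) * bra n (g j) * cnj (bra n' (g j)) = z' * of_real (rb j)" "z' \<noteq> 0"
    and ll: "cross2 l l' \<noteq> 0" and mm: "cross2 m m' \<noteq> 0" and nn: "cross2 n n' \<noteq> 0"
    and ff: "cross2 f1 f2 \<noteq> 0"
  shows False
proof -
  define L where "L j = (cmod (bra l (a j)))\<^sup>2" for j
  define L' where "L' j = (cmod (bra l' (a j)))\<^sup>2" for j
  define M where "M j = (cmod (bra m (b j)))\<^sup>2" for j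
  define N where "N j = (cmod (bra n (g j)))\<^sup>2" for j
  have pos: "L j > 0" "L' j > 0" "M j > 0" "N j > 0" for j
    using nz by (auto simp: L_def L'_def M_def N_def)
  define \<tau> where "\<tau> j = rg j / (L j * M j)" for j
  define \<upsilon> where "\<upsilon> j = rb j / (L' j * N j)" for j
  have t: "bra m' (b j) = cnj z * of_real (\<tau> j) * bra m (b j)" for j
    using ratio_from_relation[OF z(1)[of j] nz(1)[of j] nz(2)[of j]] by (simp add: \<tau>_def L_def M_def)
  have u: "bra n' (g j) = cnj z' * of_real (\<upsilon> j) * bra n (g j)" for j
    using ratio_from_relation[OF z'(1)[of j] nz(3)[of j] nz(4)[of j]] by (simp add: \<upsilon>_def L'_def N_def)
  have t0: "\<tau> j \<noteq> 0" and u0: "\<upsilon> j \<noteq> 0" for j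
    using pos[of j] frame_neq0[OF g, of j] frame_neq0[OF b, of j] by (auto simp: \<tau>_def \<upsilon>_def)
  \<comment> \<open>The nodes are signs divided by positive numbers, and the signs of a frame have
    product 1.\<close>
  have tp: "(\<Prod>j\<in>UNIV. \<tau> j) > 0" and up: "(\<Prod>j\<in>UNIV. \<upsilon> j) > 0"
    unfolding \<tau>_def \<upsilon>_def prod_dividef frameD(2)[OF g] frameD(2)[OF b]
    using pos by (auto intro!: divide_pos_pos prod_pos)
  have w: "cnj z \<noteq> 0" "cnj z' \<noteq> 0" using z(2) z'(2) by auto
  define B3 where "B3 = (\<Sum>j\<in>UNIV. rb j * M j * \<tau> j ^ 3)"
  define G3 where "G3 = (\<Sum>j\<in>UNIV. rg j * N j * \<upsilon> j ^ 3)"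
  have B: "B3 \<noteq> 0"
    unfolding B3_def M_def by (rule frame_third_moment[OF b w(1) t nz(2) mm t0 tp])
  have G: "G3 \<noteq> 0" "(\<Sum>j\<in>UNIV. rg j * N j / \<upsilon> j) = - G3 / (\<Prod>j\<in>UNIV. \<upsilon> j)"
    unfolding G3_def N_def by (rule frame_third_moment[OF g w(2) u nz(4) nn u0 up])+
  obtain x1 y1 where f1: "\<And>u. bra f1 u = x1 * bra n u + y1 * bra n' u" "\<And>s. f1 s = x1 * n s + y1 * n' s"
    using bra_decompose[OF nn] by blast
  obtain x2 y2 where f2: "\<And>u. bra f2 u = x2 * bra n u + y2 * bra n' u" "\<And>s. f2 s = x2 * n s + y2 * n' s"
    using bra_decompose[OF nn] by blast
  obtain X1 Y1 where h1: "\<And>u. bra h1 u = X1 * bra m u + Y1 * bra m' u" "\<And>s. h1 s = X1 * m s + Y1 * m' s"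
    using bra_decompose[OF mm] by blast
  obtain X2 Y2 where h2: "\<And>u. bra h2 u = X2 * bra m u + Y2 * bra m' u" "\<And>s. h2 s = X2 * m s + Y2 * m' s"
    using bra_decompose[OF mm] by blast
  \<comment> \<open>The modulus equation of \<open>e1\<close>, divided by
    \<open>L j * M j * L' j * N j\<close> and multiplied by both signs.\<close>
  have one: "rg j * \<upsilon> j * (cmod (bra f1 (g j)))\<^sup>2 = rb j * \<tau> j * (cmod (bra h1 (b j)))\<^sup>2" for j
  proof -
    have "(cmod (bra l (a j) * bra m (b j) * bra f1 (g j)))\<^sup>2 = (cmod (bra l' (a j) * bra n (g j) * bra h1 (b j)))\<^sup>2"
      unfolding e1 ..
    then have "L j * M j * (cmod (bra f1 (g j)))\<^sup>2 = L' j * N j * (cmod (bra h1 (b j)))\<^sup>2"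
      by (simp add: norm_mult power_mult_distrib L_def M_def L'_def N_def)
    then show ?thesis using pos[of j] by (simp add: \<tau>_def \<upsilon>_def field_simps)
  qed
  \<comment> \<open>In \<open>e2\<close> the functional \<open>n'\<close> stands for
    \<open>n\<close> and brings in the square of \<open>\<upsilon> j\<close>, which turns the weight
    \<open>\<upsilon> j\<close> into its inverse.\<close>
  have two: "rg j / \<upsilon> j * (cmod (bra f2 (g j)))\<^sup>2 = (cmod z')\<^sup>2 * (rb j * \<tau> j * (cmod (bra h2 (b j)))\<^sup>2)" for j
  proof -
    have "(cmod (bra l (a j) * bra m (b j) * bra f2 (g j)))\<^sup>2 = (cmod (bra l' (a j) * bra n' (g j) * bra h2 (b j)))\<^sup>2"
      unfolding e2 ..
    then have "L j * M j * (cmod (bra f2 (g j)))\<^sup>2 = L' j * ((cmod z')\<^sup>2 * (\<upsilon> j)\<^sup>2 * N j) * (cmod (bra h2 (b j)))\<^sup>2"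
      by (simp add: norm_mult power_mult_distrib L_def M_def L'_def N_def u)
    then have "(cmod (bra f2 (g j)))\<^sup>2 = L' j * ((cmod z')\<^sup>2 * (\<upsilon> j)\<^sup>2 * N j) * (cmod (bra h2 (b j)))\<^sup>2 / (L j * M j)"
      using pos[of j] by (simp add: field_simps)
    then have "rg j / \<upsilon> j * (cmod (bra f2 (g j)))\<^sup>2 =
        (cmod z')\<^sup>2 * ((L' j * N j * \<upsilon> j) * (rg j / (L j * M j)) * (cmod (bra h2 (b j)))\<^sup>2)"
      using u0[of j] by (simp add: field_simps power2_eq_square)
    moreover have "L' j * N j * \<upsilon> j = rb j" using pos[of j] by (simp add: \<upsilon>_def)
    ultimately show ?thesis by (simp add: \<tau>_def)
  qed
  have S1: "(cmod (y1 * cnj z'))\<^sup>2 * G3 = (cmod (Y1 * cnj z))\<^sup>2 * B3"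
    using frame_weighted(1)[OF g w(2) u f1(1) u0] frame_weighted(1)[OF b w(1) t h1(1) t0]
    unfolding G3_def B3_def N_def M_def one by simp
  have S2: "(cmod x2)\<^sup>2 * (- G3 / (\<Prod>j\<in>UNIV. \<upsilon> j)) = (cmod z')\<^sup>2 * ((cmod (Y2 * cnj z))\<^sup>2 * B3)"
    using frame_weighted(2)[OF g w(2) u f2(1) u0] frame_weighted(1)[OF b w(1) t h2(1) t0]
    unfolding G(2)[symmetric] B3_def N_def M_def two sum_distrib_left[symmetric] by simp
  obtain s1 s2 where fnz: "f1 s1 \<noteq> 0" "f2 s2 \<noteq> 0" using cross2_nonzero[OF ff] by blast
  have fin: False if "\<And>j. c * bra l (a j) = d * bra l' (a j)" "c \<noteq> 0" for c d
  proof -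
    define e where "e s = c * l s - d * l' s" for s
    have "bra e (a j) = 0" for j
      using that(1)[of j] by (simp add: e_def bra_def algebra_simps)
    then have "e s = 0" for s using frame_bra_eq_0[OF a, of e "J1" "J4"] by simp
    then have "c * l s = d * l' s" for s by (simp add: e_def)
    then have eq: "c * l s = d * l' s" for s .
    have "c * cross2 l l' = (c * l False) * l' True - (c * l True) * l' False"
      by (simp add: cross2_def algebra_simps)
    also have "\<dots> = 0" unfolding eq by simp
    finally have "c * cross2 l l' = 0" .
    then show False using that(2) ll by simp
  qed
  show False
  proof (cases "G3 * B3 > 0")
    case True
    have "(cmod x2)\<^sup>2 * (G3 * B3) / (\<Prod>j\<in>UNIV. \<upsilon> j) + (cmod z')\<^sup>2 * ((cmod (Y2 * cnj z))\<^sup>2 * (B3 * B3)) = 0"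
      using arg_cong[OF S2, of "\<lambda>x. x * B3"] by (simp add: algebra_simps)
    moreover have "(cmod x2)\<^sup>2 * (G3 * B3) / (\<Prod>j\<in>UNIV. \<upsilon> j) \<ge> 0" using True up by simp
    moreover have "(cmod z')\<^sup>2 * ((cmod (Y2 * cnj z))\<^sup>2 * (B3 * B3)) \<ge> 0" by simp
    ultimately have "(cmod x2)\<^sup>2 * (G3 * B3) / (\<Prod>j\<in>UNIV. \<upsilon> j) = 0"
       "(cmod z')\<^sup>2 * ((cmod (Y2 * cnj z))\<^sup>2 * (B3 * B3)) = 0" by linarith+
    then have 0: "x2 = 0" "Y2 = 0" using True up B z(2) z'(2) u0 by auto
    have "y2 * bra l (a j) = X2 * bra l' (a j)" for j
      using e2[of j] nz(2)[of j] nz(5)[of j] by (simp add: f2 h2 0 mult_ac)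
    moreover have "y2 \<noteq> 0" using fnz(2) f2(2)[of s2] 0 by auto
    ultimately show False by (rule fin)
  next
    case False
    then have neg: "G3 * B3 < 0" using G(1) B by (simp add: not_less order_less_le)
    have "(cmod (y1 * cnj z'))\<^sup>2 * (- (G3 * B3)) + (cmod (Y1 * cnj z))\<^sup>2 * (B3 * B3) = 0"
      using S1 by algebra
    moreover have "(cmod (y1 * cnj z'))\<^sup>2 * (- (G3 * B3)) \<ge> 0" using neg by (intro mult_nonneg_nonneg) auto
    moreover have "(cmod (Y1 * cnj z))\<^sup>2 * (B3 * B3) \<ge> 0" by simp
    ultimately have "(cmod (y1 * cnj z'))\<^sup>2 * (- (G3 * B3)) = 0" "(cmod (Y1 * cnj z))\<^sup>2 * (B3 * B3) = 0" by linarith+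
    then have 0: "y1 = 0" "Y1 = 0" using neg B z(2) z'(2) by auto
    have "x1 * bra l (a j) = X1 * bra l' (a j)" for j
      using e1[of j] nz(2)[of j] nz(4)[of j] by (simp add: f1 h1 0 mult_ac)
    moreover have "x1 \<noteq> 0" using fnz(1) f1(2)[of s1] 0 by auto
    ultimately show False by (rule fin)
  qed
qed

section \<open>Collapsing functionals\<close>

definition unitary_coeffs :: "('i \<Rightarrow> ix \<Rightarrow> complex) \<Rightarrow> 'i set \<Rightarrow> bool" where
  "unitary_coeffs V I \<longleftrightarrow> finite I \<and>
     (\<forall>i\<in>I. \<forall>k\<in>I. (\<Sum>j\<in>UNIV. V i j * cnj (V k j)) = (if i = k then 1 else 0)) \<and>
     (\<forall>j k. (\<Sum>i\<in>I. V i j * cnj (V i k)) = (if j = k then 1 else 0))"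

text \<open>The vector left to the third party when the functionals \<open>l\<close> and \<open>m\<close> are applied to state \<open>i\<close>, where \<open>V i j\<close> is
  the coefficient of state \<open>i\<close> at the \<open>j\<close>-th product vector.\<close>

definition cvec :: "('i \<Rightarrow> ix \<Rightarrow> complex) \<Rightarrow> (ix \<Rightarrow> qubit) \<Rightarrow> (ix \<Rightarrow> qubit) \<Rightarrow> (ix \<Rightarrow> qubit) \<Rightarrow> qubit \<Rightarrow> qubit \<Rightarrow> 'i \<Rightarrow> qubit" where
  "cvec V a b g l m i = (\<lambda>x. \<Sum>j\<in>UNIV. V i j * bra l (a j) * bra m (b j) * g j x)"

text \<open>All that is kept of a branch in which the first party has applied \<open>l\<close>:
  \<open>m\<close> and \<open>m'\<close> are two functionals of the party that collapses next, and
  \<open>C\<close> is the invertible operator accumulated by the remaining one. Exchanging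
  \<open>b\<close> and \<open>g\<close> exchanges these two parties.\<close>

definition collapses :: "('i \<Rightarrow> ix \<Rightarrow> complex) \<Rightarrow> 'i set \<Rightarrow> (ix \<Rightarrow> qubit) \<Rightarrow> (ix \<Rightarrow> qubit) \<Rightarrow> (ix \<Rightarrow> qubit) \<Rightarrow> qubit \<Rightarrow> bool" where
  "collapses V I a b g l \<longleftrightarrow> (\<exists>m m' C. cross2 m m' \<noteq> 0 \<and> det2 C \<noteq> 0 \<and>
     (\<forall>k\<in>{m, m'}. \<forall>i\<in>I. \<forall>i'\<in>I. i \<noteq> i' \<longrightarrow>
        cinner (mat_apply C (cvec V a b g l k i)) (mat_apply C (cvec V a b g l k i')) = 0))"

lemma unitary_coeffsD:
  assumes "unitary_coeffs V I"
  shows "finite I" "(\<Sum>i\<in>I. V i j * cnj (V i k)) = (if j = k then 1 else 0)"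
  using assms unfolding unitary_coeffs_def by blast+

text \<open>The sum of all squared moduli counts the rows in one order of summation and the columns
  in the other.\<close>

lemma card_unitary_coeffs:
  assumes "unitary_coeffs V I"
  shows "card I = 4"
proof -
  have "complex_of_nat (card I) = (\<Sum>i\<in>I. \<Sum>j\<in>UNIV. V i j * cnj (V i j))"
    using assms by (simp add: unitary_coeffs_def)
  also have "\<dots> = (\<Sum>j\<in>UNIV. \<Sum>i\<in>I. V i j * cnj (V i j))"
    by (rule sum.swap)
  also have "\<dots> = complex_of_nat 4"
    by (simp add: unitary_coeffsD(2)[OF assms] card_ix)
  finally show ?thesis by (simp only: of_nat_eq_iff)
qed

lemma unitary_parseval:
  assumes "unitary_coeffs V I"
  shows "(\<Sum>i\<in>I. (\<Sum>j\<in>UNIV. V i j * p j) * cnj (\<Sum>k\<in>UNIV. V i k * q k)) = (\<Sum>j\<in>UNIV. p j * cnj (q j))"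
proof -
  have "(\<Sum>i\<in>I. (\<Sum>j\<in>UNIV. V i j * p j) * cnj (\<Sum>k\<in>UNIV. V i k * q k)) =
    (\<Sum>i\<in>I. \<Sum>j\<in>UNIV. \<Sum>k\<in>UNIV. p j * cnj (q k) * (V i j * cnj (V i k)))"
    unfolding cnj_sum sum_product by (intro sum.cong refl) (simp add: mult_ac)
  also have "\<dots> = (\<Sum>j\<in>UNIV. \<Sum>k\<in>UNIV. \<Sum>i\<in>I. p j * cnj (q k) * (V i j * cnj (V i k)))"
    by (subst sum.swap, rule sum.cong[OF refl], rule sum.swap)
  also have "\<dots> = (\<Sum>j\<in>UNIV. \<Sum>k\<in>UNIV. p j * cnj (q k) * (if j = k then 1 else 0))"
    by (simp add: unitary_coeffsD(2)[OF assms] flip: sum_distrib_left)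
  also have "\<dots> = (\<Sum>j\<in>UNIV. p j * cnj (q j))"
    by (simp add: if_distrib cong: if_cong)
  finally show ?thesis .
qed

lemma unitary_expand:
  assumes "unitary_coeffs V I"
  shows "(\<Sum>i\<in>I. cnj (V i j) * (\<Sum>k\<in>UNIV. V i k * p k)) = p j"
proof -
  have "(\<Sum>i\<in>I. cnj (V i j) * (\<Sum>k\<in>UNIV. V i k * p k)) =
     (\<Sum>i\<in>I. \<Sum>k\<in>UNIV. p k * (V i k * cnj (V i j)))"
    unfolding sum_distrib_left by (intro sum.cong refl) (simp add: mult_ac)
  also have "\<dots> = (\<Sum>k\<in>UNIV. \<Sum>i\<in>I. p k * (V i k * cnj (V i j)))" by (rule sum.swap)
  also have "\<dots> = (\<Sum>k\<in>UNIV. p k * (if k = j then 1 else 0))"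
    by (simp add: unitary_coeffsD(2)[OF assms] flip: sum_distrib_left)
  also have "\<dots> = p j" by (simp add: if_distrib cong: if_cong)
  finally show ?thesis .
qed

lemma unitary_row_nonzero:
  assumes "unitary_coeffs V I" "i \<in> I"
  obtains j where "V i j \<noteq> 0"
proof -
  have "(\<Sum>j\<in>UNIV. V i j * cnj (V i j)) = 1" using assms by (simp add: unitary_coeffs_def)
  then show thesis using that by (metis (no_types, lifting) mult_zero_left sum.neutral zero_neq_one)
qed

lemma unitary_row_orth:
  assumes "unitary_coeffs V I" "i \<in> I" "k \<in> I" "i \<noteq> k" "V k j0 \<noteq> 0" "\<And>j. j \<noteq> j0 \<Longrightarrow> V k j = 0"
  shows "V i j0 = 0"
proof -
  have "0 = (\<Sum>j\<in>UNIV. V i j * cnj (V k j))" using assms(1-4) by (simp add: unitary_coeffs_def)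
  also have "\<dots> = (\<Sum>j\<in>UNIV. if j = j0 then V i j0 * cnj (V k j0) else 0)"
    by (intro sum.cong refl) (use assms(6) in auto)
  also have "\<dots> = V i j0 * cnj (V k j0)" by simp
  finally show ?thesis using assms(5) by simp
qed

lemma orthogonal_parallel:
  assumes C: "det2 C \<noteq> 0" and u: "cinner (mat_apply C u) (mat_apply C w) = 0"
    and v: "cinner (mat_apply C v) (mat_apply C w) = 0" and w: "w x \<noteq> 0"
  shows "cross2 u v = 0"
proof -
  let ?u = "mat_apply C u" and ?v = "mat_apply C v" and ?w = "mat_apply C w"
  have "?w False \<noteq> 0 \<or> ?w True \<noteq> 0"
  proof (rule ccontr)
    assume "\<not> ?thesis"
    then have "cinner ?w ?w = 0" by (simp add: cinner_bool)
    then have "cross2 w w \<noteq> 0" using orthogonal_independent[of C w w x x] C w by blast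
    then show False by simp
  qed
  moreover have "cnj (cross2 ?u ?v) * ?w False = cnj (?v True) * cinner ?u ?w - cnj (?u True) * cinner ?v ?w"
    "cnj (cross2 ?u ?v) * ?w True = cnj (?u False) * cinner ?v ?w - cnj (?v False) * cinner ?u ?w"
    by (auto simp: cross2_def cinner_bool algebra_simps)
  ultimately have "cross2 ?u ?v = 0" using u v by auto
  moreover have "cross2 ?u ?v = det2 C * cross2 u v"
    by (simp add: cross2_def det2_def mat_apply_bool algebra_simps)
  ultimately show ?thesis using C by simp
qed

lemma three_orthogonal:
  assumes "det2 C \<noteq> 0" "cinner (mat_apply C u) (mat_apply C v) = 0"
    "cinner (mat_apply C u) (mat_apply C w) = 0" "cinner (mat_apply C v) (mat_apply C w) = 0"
  shows "u = (\<lambda>_. 0) \<or> v = (\<lambda>_. 0) \<or> w = (\<lambda>_. 0)"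
proof (rule ccontr)
  assume "\<not> ?thesis"
  then obtain x y z where n: "u x \<noteq> 0" "v y \<noteq> 0" "w z \<noteq> 0" by (metis ext)
  have "cross2 u v = 0" using orthogonal_parallel[of C u w v z] assms n by blast
  then show False using orthogonal_independent[of C u v x y] assms n by blast
qed

text \<open>Independent \<open>m\<close> and \<open>m'\<close> recover both coordinates of
  \<open>b j\<close>, so a state lost under both gives a vanishing combination of the products of
  \<open>b j\<close> and \<open>g j\<close>.\<close>

lemma cvec_both_zero:
  assumes b: "frame rb b" and g: "frame rg g" and ne: "rb \<noteq> rg" "rb \<noteq> (\<lambda>j. - rg j)"
    and mm: "cross2 m m' \<noteq> 0" and 0: "cvec V a b g l m i = (\<lambda>_. 0)" "cvec V a b g l m' i = (\<lambda>_. 0)"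
  shows "V i j * bra l (a j) = 0"
proof (rule product_independent[OF b g ne])
  fix x y
  have 1: "cross2 m m' * v False = m' True * bra m v - m True * bra m' v"
       "cross2 m m' * v True = m False * bra m' v - m' False * bra m v" for v
    unfolding cross2_def bra_def by algebra+
  define A where "A = (\<Sum>j\<in>UNIV. V i j * bra l (a j) * bra m (b j) * g j y)"
  define B where "B = (\<Sum>j\<in>UNIV. V i j * bra l (a j) * bra m' (b j) * g j y)"
  have AB: "A = 0" "B = 0" using fun_cong[OF 0(1), of y] fun_cong[OF 0(2), of y]
    by (simp_all add: A_def B_def cvec_def)
  have "cross2 m m' * (\<Sum>j\<in>UNIV. V i j * bra l (a j) * b j x * g j y) =
     (\<Sum>j\<in>UNIV. V i j * bra l (a j) * (cross2 m m' * b j x) * g j y)"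
    unfolding sum_distrib_left by (intro sum.cong refl) (simp add: mult_ac)
  also have "\<dots> = (if x then m False * B - m' False * A else m' True * A - m True * B)"
    unfolding A_def B_def
    by (cases x) (simp_all add: 1 sum_distrib_left right_diff_distrib left_diff_distrib sum_subtractf mult_ac)
  finally have "cross2 m m' * (\<Sum>j\<in>UNIV. V i j * bra l (a j) * b j x * g j y) = 0" using AB by simp
  then show "(\<Sum>j\<in>UNIV. V i j * bra l (a j) * b j x * g j y) = 0" using mm by simp
qed

lemma cvec_two_terms:
  assumes d: "distinct [j1, j2, k, k']" and "V i j1 = 0" "V i j2 = 0" and g: "frame rg g"
    and 0: "cvec V a b g l m i = (\<lambda>_. 0)"
  shows "V i k * bra l (a k) * bra m (b k) = 0" "V i k' * bra l (a k') * bra m (b k') = 0"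
proof -
  have e: "V i k * bra l (a k) * bra m (b k) * g k x + V i k' * bra l (a k') * bra m (b k') * g k' x = 0" for x
    using fun_cong[OF 0, of x] assms(2,3) by (simp add: cvec_def sum_ix[OF d])
  have c: "cross2 (g k) (g k') \<noteq> 0" using frameD(4)[OF g, of k k'] d by simp
  let ?A = "V i k * bra l (a k) * bra m (b k)" and ?B = "V i k' * bra l (a k') * bra m (b k')"
  have "?A * cross2 (g k) (g k') = (?A * g k False + ?B * g k' False) * g k' True - (?A * g k True + ?B * g k' True) * g k' False"
    "?B * cross2 (g k) (g k') = (?A * g k True + ?B * g k' True) * g k False - (?A * g k False + ?B * g k' False) * g k True"
    unfolding cross2_def by algebra+
  then show "?A = 0" "?B = 0" unfolding e using c by auto
qed

section \<open>From a collapse to a splitting of the four states\<close>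

text \<open>Three vectors of one qubit cannot be nonzero and pairwise orthogonal after
  \<open>C\<close>, so \<open>m\<close> and \<open>m'\<close> each annihilate one of the three
  vectors \<open>b j\<close>, and not the same one. The third \<open>g j\<close> is then orthogonal
  to each of the two others, which are therefore parallel, against the frame property.\<close>

lemma monomial_rows_contradiction:
  assumes b: "frame rb b" and g: "frame rg g"
    and col: "collapses V I a b g l"
    and i: "distinct [i1, i2, i3]" "i1 \<in> I" "i2 \<in> I" "i3 \<in> I"
    and j: "distinct [j1, j2, j3]"
    and m1: "V i1 j1 \<noteq> 0" "\<And>j. j \<noteq> j1 \<Longrightarrow> V i1 j = 0"
    and m2: "V i2 j2 \<noteq> 0" "\<And>j. j \<noteq> j2 \<Longrightarrow> V i2 j = 0"
    and m3: "V i3 j3 \<noteq> 0" "\<And>j. j \<noteq> j3 \<Longrightarrow> V i3 j = 0"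
    and l: "bra l (a j1) \<noteq> 0" "bra l (a j2) \<noteq> 0" "bra l (a j3) \<noteq> 0"
  shows False
proof -
  obtain m m' C where mm: "cross2 m m' \<noteq> 0" and C: "det2 C \<noteq> 0"
    and orth: "\<And>k i i'. k \<in> {m, m'} \<Longrightarrow> i \<in> I \<Longrightarrow> i' \<in> I \<Longrightarrow> i \<noteq> i' \<Longrightarrow>
        cinner (mat_apply C (cvec V a b g l k i)) (mat_apply C (cvec V a b g l k i')) = 0"
    using col unfolding collapses_def by blast
  have gnz: "\<exists>x. g j x \<noteq> 0" for j
  proof -
    obtain k where "k \<noteq> j" using ix_exists_other by blast
    then show ?thesis using cross2_nonzero[OF frameD(4)[OF g, of j k]] by blast
  qed
  have cv: "cvec V a b g l k i = (\<lambda>x. V i j * bra l (a j) * bra k (b j) * g j x)"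
    if "\<And>j'. j' \<noteq> j \<Longrightarrow> V i j' = 0" for i j k
  proof
    fix x
    have "cvec V a b g l k i x = (\<Sum>j'\<in>UNIV. if j' = j then V i j * bra l (a j) * bra k (b j) * g j x else 0)"
      unfolding cvec_def by (intro sum.cong refl) (use that in auto)
    then show "cvec V a b g l k i x = V i j * bra l (a j) * bra k (b j) * g j x" by simp
  qed
  define S where "S = {(i1, j1), (i2, j2), (i3, j3)}"
  have S: "i \<in> I" "V i j \<noteq> 0" "bra l (a j) \<noteq> 0" "\<And>k. cvec V a b g l k i = (\<lambda>x. V i j * bra l (a j) * bra k (b j) * g j x)"
    if "(i, j) \<in> S" for i j
    using that i m1 m2 m3 l cv[OF m1(2)] cv[OF m2(2)] cv[OF m3(2)] unfolding S_def by auto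
  have orthS: "cinner (mat_apply C (g j)) (mat_apply C (g j')) = 0"
    if "(i, j) \<in> S" "(i', j') \<in> S" "i \<noteq> i'" "bra k (b j) \<noteq> 0" "bra k (b j') \<noteq> 0" "k \<in> {m, m'}" for i j i' j' k
  proof -
    have "cinner (mat_apply C (cvec V a b g l k i)) (mat_apply C (cvec V a b g l k i')) = 0"
      using orth[OF that(6) S(1)[OF that(1)] S(1)[OF that(2)] that(3)] .
    moreover have "cinner (mat_apply C (cvec V a b g l k i)) (mat_apply C (cvec V a b g l k i')) =
       cnj (V i j * bra l (a j) * bra k (b j)) * (V i' j' * bra l (a j') * bra k (b j')) *
        cinner (mat_apply C (g j)) (mat_apply C (g j'))"
      unfolding S(4)[OF that(1)] S(4)[OF that(2)] by (simp add: cinner_bool mat_apply_bool algebra_simps)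
    ultimately show ?thesis using that S(2,3)[OF that(1)] S(2,3)[OF that(2)] by auto
  qed
  have zero: "\<exists>i j. (i, j) \<in> S \<and> bra k (b j) = 0" if "k \<in> {m, m'}" for k
  proof (rule ccontr)
    assume "\<not> ?thesis"
    then have n: "bra k (b j1) \<noteq> 0" "bra k (b j2) \<noteq> 0" "bra k (b j3) \<noteq> 0" by (auto simp: S_def)
    have "cinner (mat_apply C (g j1)) (mat_apply C (g j2)) = 0"
      by (rule orthS[of i1 j1 i2 j2 k]) (use i n that in \<open>auto simp: S_def\<close>)
    moreover have "cinner (mat_apply C (g j1)) (mat_apply C (g j3)) = 0"
      by (rule orthS[of i1 j1 i3 j3 k]) (use i n that in \<open>auto simp: S_def\<close>)
    moreover have "cinner (mat_apply C (g j2)) (mat_apply C (g j3)) = 0"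
      by (rule orthS[of i2 j2 i3 j3 k]) (use i n that in \<open>auto simp: S_def\<close>)
    ultimately have "g j1 = (\<lambda>_. 0) \<or> g j2 = (\<lambda>_. 0) \<or> g j3 = (\<lambda>_. 0)"
      using three_orthogonal[OF C] by blast
    then show False using gnz[of j1] gnz[of j2] gnz[of j3] by auto
  qed
  obtain p jp where p: "(p, jp) \<in> S" "bra m (b jp) = 0" using zero[of m] by blast
  obtain q jq where q: "(q, jq) \<in> S" "bra m' (b jq) = 0" using zero[of m'] by blast
  have mnz: "bra m (b j) \<noteq> 0" if "j \<noteq> jp" for j
  proof
    assume "bra m (b j) = 0"
    then have "m x = 0" for x using frame_bra_eq_0[OF b _ p(2) that] by blast
    then show False using mm by (simp add: cross2_def)
  qed
  have m'nz: "bra m' (b j) \<noteq> 0" if "j \<noteq> jq" for j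
  proof
    assume "bra m' (b j) = 0"
    then have "m' x = 0" for x using frame_bra_eq_0[OF b _ q(2) that] by blast
    then show False using mm by (simp add: cross2_def)
  qed
  have jpq: "jp \<noteq> jq"
  proof
    assume e: "jp = jq"
    obtain k where k: "k \<noteq> jp" using ix_exists_other by blast
    have "cross2 m m' * cross2 (b jp) (b k) = 0"
      using bra_cross2[of m "b jp" m' "b k"] p(2) q(2) e by simp
    then show False using mm frameD(4)[OF b, of jp k] k by auto
  qed
  obtain s js where s: "(s, js) \<in> S" "js \<noteq> jp" "js \<noteq> jq" "s \<noteq> p" "s \<noteq> q"
    using p(1) q(1) jpq i(1) j unfolding S_def by (auto dest: sym)
  have "cinner (mat_apply C (g jq)) (mat_apply C (g js)) = 0"
    by (rule orthS[OF q(1) s(1), of m]) (use s jpq mnz in auto)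
  moreover have "cinner (mat_apply C (g jp)) (mat_apply C (g js)) = 0"
    by (rule orthS[OF p(1) s(1), of m']) (use s jpq m'nz in auto)
  moreover obtain x where "g js x \<noteq> 0" using gnz by blast
  ultimately have "cross2 (g jp) (g jq) = 0"
    using orthogonal_parallel[of C "g jp" "g js" "g jq" x] C by blast
  then show False using frameD(4)[OF g jpq] by simp
qed

text \<open>When this comes from a collapse, \<open>X\<close> holds the states that
  \<open>m'\<close> annihilates and \<open>I - X\<close> those that \<open>m\<close> annihilates.
  \<open>F\<close> and \<open>F'\<close> are the basis dual to the two surviving vectors of the
  third qubit.\<close>

definition split_blocks :: "('i \<Rightarrow> ix \<Rightarrow> complex) \<Rightarrow> 'i set \<Rightarrow> (ix \<Rightarrow> qubit) \<Rightarrow> (ix \<Rightarrow> qubit) \<Rightarrow>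
    (ix \<Rightarrow> qubit) \<Rightarrow> (ix \<Rightarrow> real) \<Rightarrow> qubit \<Rightarrow> qubit \<Rightarrow> qubit \<Rightarrow> bool op \<Rightarrow> 'i set \<Rightarrow> bool" where
  "split_blocks V I a b g rg l m m' C X \<longleftrightarrow> cross2 m m' \<noteq> 0 \<and> det2 C \<noteq> 0 \<and> X \<subseteq> I \<and> card X = 2 \<and>
     (\<forall>j. bra l (a j) \<noteq> 0 \<and> bra m (b j) \<noteq> 0 \<and> bra m' (b j) \<noteq> 0) \<and>
     (\<exists>z. z \<noteq> 0 \<and> (\<forall>j. bra l (a j) * cnj (bra l (a j)) * bra m (b j) * cnj (bra m' (b j)) = z * of_real (rg j))) \<and>
     (\<forall>i\<in>X. \<forall>i'\<in>X. i \<noteq> i' \<longrightarrow> (\<exists>F F'. cross2 F F' \<noteq> 0 \<and> orth_ann C F F' \<and>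
        (\<forall>j. cnj (V i j) = bra l (a j) * bra m (b j) * bra F (g j)) \<and>
        (\<forall>j. cnj (V i' j) = bra l (a j) * bra m (b j) * bra F' (g j)))) \<and>
     (\<forall>i\<in>I - X. \<forall>i'\<in>I - X. i \<noteq> i' \<longrightarrow> (\<exists>F F'. cross2 F F' \<noteq> 0 \<and> orth_ann C F F' \<and>
        (\<forall>j. cnj (V i j) = bra l (a j) * bra m' (b j) * bra F (g j)) \<and>
        (\<forall>j. cnj (V i' j) = bra l (a j) * bra m' (b j) * bra F' (g j))))"

text \<open>Expand a product vector in the states and apply \<open>l\<close> and \<open>m\<close>:
  only \<open>i\<close> and \<open>i'\<close> survive, with conjugated entries of \<open>V\<close>
  as coefficients, and the dual basis reads these off. Each dual functional has the other vector in
  its kernel, which turns orthogonality of the vectors into \<open>orth_ann\<close>.\<close>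

lemma block_functionals:
  assumes V: "unitary_coeffs V I" and i: "i \<in> I" "i' \<in> I" "i \<noteq> i'" and C: "det2 C \<noteq> 0"
    and rest: "\<And>k. k \<in> I \<Longrightarrow> k \<noteq> i \<Longrightarrow> k \<noteq> i' \<Longrightarrow> cvec V a b g l m k = (\<lambda>_. 0)"
    and nz: "cvec V a b g l m i \<noteq> (\<lambda>_. 0)" "cvec V a b g l m i' \<noteq> (\<lambda>_. 0)"
    and orth: "cinner (mat_apply C (cvec V a b g l m i')) (mat_apply C (cvec V a b g l m i)) = 0"
  shows "\<exists>F F'. cross2 F F' \<noteq> 0 \<and> orth_ann C F F' \<and>
        (\<forall>j. cnj (V i j) = bra l (a j) * bra m (b j) * bra F (g j)) \<and>
        (\<forall>j. cnj (V i' j) = bra l (a j) * bra m (b j) * bra F' (g j))"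
proof -
  define c where "c = cvec V a b g l m i"
  define c' where "c' = cvec V a b g l m i'"
  obtain x y where xy: "c x \<noteq> 0" "c' y \<noteq> 0" using nz unfolding c_def c'_def by (metis ext)
  have cc: "cross2 c' c \<noteq> 0"
    using orthogonal_independent[of C c' c y x] C orth xy unfolding c_def c'_def by blast
  then have cc': "cross2 c c' \<noteq> 0" using cross2_swap[of c c'] by simp
  have ex: "bra l (a j) * bra m (b j) * g j x = cnj (V i j) * c x + cnj (V i' j) * c' x" for j x
  proof -
    have "bra l (a j) * bra m (b j) * g j x = (\<Sum>k\<in>I. cnj (V k j) * cvec V a b g l m k x)"
      using unitary_expand[OF V, of j "\<lambda>j. bra l (a j) * bra m (b j) * g j x"]
      by (simp add: cvec_def mult.assoc)
    also have "\<dots> = (\<Sum>k\<in>{i, i'}. cnj (V k j) * cvec V a b g l m k x)"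
      using unitary_coeffsD(1)[OF V] i rest by (intro sum.mono_neutral_right) auto
    also have "\<dots> = cnj (V i j) * c x + cnj (V i' j) * c' x"
      using i(3) by (simp add: c_def c'_def)
    finally show ?thesis .
  qed
  define F where "F x = rot c' x / cross2 c c'" for x
  define F' where "F' x = rot c x / cross2 c' c" for x
  have bF: "bra F v = cross2 v c' / cross2 c c'" "bra F' v = cross2 v c / cross2 c' c" for v
    by (simp_all add: F_def F'_def bra_def rot_def cross2_def[of v] diff_divide_distrib mult_ac)
  have "cross2 F F' = cross2 (rot c') (rot c) / (cross2 c c' * cross2 c' c)"
    by (simp add: cross2_def[of F F'] cross2_def[of "rot c'" "rot c"] F_def F'_def diff_divide_distrib)
  then have "cross2 F F' = cross2 c' c / (cross2 c c' * cross2 c' c)" unfolding cross2_rot .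
  then have 1: "cross2 F F' \<noteq> 0" using cc cc' by simp
  have o: "orth_ann C (rot c') (rot c)"
  proof -
    have "rot (rot f) = (\<lambda>x. - f x)" for f by (auto simp: rot_def)
    moreover have "mat_apply C (\<lambda>x. - f x) = (\<lambda>x. - mat_apply C f x)" for f
      by (auto simp: mat_apply_bool)
    ultimately show ?thesis using orth unfolding orth_ann_def c_def c'_def by (simp add: cinner_bool)
  qed
  have 2: "orth_ann C F F'"
    by (rule orth_ann_cong[OF o, of _ "1 / cross2 c c'" _ "1 / cross2 c' c"]) (auto simp: F_def F'_def)
  have "cnj (V i j) * cross2 c c' = bra l (a j) * bra m (b j) * cross2 (g j) c'" for j
  proof -
    have "bra l (a j) * bra m (b j) * cross2 (g j) c' =
      (bra l (a j) * bra m (b j) * g j False) * c' True - (bra l (a j) * bra m (b j) * g j True) * c' False"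
      by (simp add: cross2_def algebra_simps)
    then show ?thesis unfolding ex by (simp add: cross2_def algebra_simps)
  qed
  then have 3: "cnj (V i j) = bra l (a j) * bra m (b j) * bra F (g j)" for j
    using cc' by (simp add: bF field_simps)
  have "cnj (V i' j) * cross2 c' c = bra l (a j) * bra m (b j) * cross2 (g j) c" for j
  proof -
    have "bra l (a j) * bra m (b j) * cross2 (g j) c =
      (bra l (a j) * bra m (b j) * g j False) * c True - (bra l (a j) * bra m (b j) * g j True) * c False"
      by (simp add: cross2_def algebra_simps)
    then show ?thesis unfolding ex by (simp add: cross2_def algebra_simps)
  qed
  then have 4: "cnj (V i' j) = bra l (a j) * bra m (b j) * bra F' (g j)" for j
    using cc by (simp add: bF field_simps)
  show ?thesis using 1 2 3 4 by blast
qed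

text \<open>A qubit has room for two nonzero orthogonal vectors, so \<open>m\<close> and
  \<open>m'\<close> each annihilate at least two states; as no state is lost under both, they
  annihilate complementary pairs. Hence every product of a vector left by \<open>m\<close> with one
  left by \<open>m'\<close> for the same state vanishes, and by Parseval this is a relation between
  the squares of the \<open>g j\<close>.\<close>

lemma collapses_split:
  assumes V: "unitary_coeffs V I" and a: "frame ra a" and b: "frame rb b" and g: "frame rg g"
    and ne: "rb \<noteq> rg" "rb \<noteq> (\<lambda>j. - rg j)"
    and col: "collapses V I a b g l" and l: "l x0 \<noteq> 0"
    and nZ: "\<And>i. i \<in> I \<Longrightarrow> \<exists>j. V i j * bra l (a j) \<noteq> 0"
  obtains m m' C X where "split_blocks V I a b g rg l m m' C X"
proof -
  obtain m m' C where mm: "cross2 m m' \<noteq> 0" and C: "det2 C \<noteq> 0"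
    and orth: "\<And>k i i'. k \<in> {m, m'} \<Longrightarrow> i \<in> I \<Longrightarrow> i' \<in> I \<Longrightarrow> i \<noteq> i' \<Longrightarrow>
        cinner (mat_apply C (cvec V a b g l k i)) (mat_apply C (cvec V a b g l k i')) = 0"
    using col unfolding collapses_def by blast
  define Z where "Z k = {i \<in> I. cvec V a b g l k i = (\<lambda>_. 0)}" for k
  have fin: "finite I" using unitary_coeffsD(1)[OF V] .
  have cI: "card I = 4" using card_unitary_coeffs[OF V] .
  have small: "card (I - Z k) \<le> 2" if "k \<in> {m, m'}" for k
  proof (rule ccontr)
    assume "\<not> ?thesis"
    then have "3 \<le> card (I - Z k)" by simp
    then obtain T where T: "T \<subseteq> I - Z k" "card T = 3" by (meson obtain_subset_with_card_n)
    then obtain p q s where pqs: "T = {p, q, s}" "p \<noteq> q" "q \<noteq> s" "p \<noteq> s" by (metis card_3_iff)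
    have "p \<in> I" "q \<in> I" "s \<in> I" using T pqs by auto
    then have "cvec V a b g l k p = (\<lambda>_. 0) \<or> cvec V a b g l k q = (\<lambda>_. 0) \<or> cvec V a b g l k s = (\<lambda>_. 0)"
      using orth[OF that] pqs by (intro three_orthogonal[OF C]) auto
    then show False using T pqs by (auto simp: Z_def)
  qed
  have disj: "Z m \<inter> Z m' = {}"
  proof (rule ccontr)
    assume "\<not> ?thesis"
    then obtain i where "i \<in> I" "cvec V a b g l m i = (\<lambda>_. 0)" "cvec V a b g l m' i = (\<lambda>_. 0)"
      by (auto simp: Z_def)
    then show False using cvec_both_zero[OF b g ne mm, of V a l i] nZ[of i] by blast
  qed
  have ZI: "Z k \<subseteq> I" for k by (auto simp: Z_def)
  then have finZ: "finite (Z k)" for k using fin by (meson finite_subset)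
  have "card (Z k) \<ge> 2" if "k \<in> {m, m'}" for k
    using small[OF that] card_Diff_subset[OF finZ ZI, of k] cI by linarith
  then have ge: "card (Z m) \<ge> 2" "card (Z m') \<ge> 2" by auto
  have "card (Z m \<union> Z m') = card (Z m) + card (Z m')" using finZ disj by (simp add: card_Un_disjoint)
  moreover have "card (Z m \<union> Z m') \<le> 4" using ZI fin cI by (metis card_mono le_sup_iff)
  ultimately have cz: "card (Z m) = 2" "card (Z m') = 2" "card (Z m \<union> Z m') = 4" using ge by linarith+
  have un: "Z m \<union> Z m' = I"
    using cz(3) cI ZI fin by (intro card_subset_eq) auto
  have rel: "(\<Sum>j\<in>UNIV. (bra l (a j) * cnj (bra l (a j)) * bra m (b j) * cnj (bra m' (b j))) * g j x * g j y) = 0" for x y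
  proof -
    have "(\<Sum>j\<in>UNIV. (bra l (a j) * cnj (bra l (a j)) * bra m (b j) * cnj (bra m' (b j))) * g j x * g j y) =
      (\<Sum>j\<in>UNIV. (bra l (a j) * bra m (b j) * g j x) * cnj (bra l (a j) * bra m' (b j) * g j y))"
      by (intro sum.cong refl) (simp add: frameD(3)[OF g] mult_ac)
    also have "\<dots> = (\<Sum>i\<in>I. cvec V a b g l m i x * cnj (cvec V a b g l m' i y))"
      by (subst unitary_parseval[OF V, symmetric]) (simp add: cvec_def mult.assoc)
    also have "\<dots> = 0"
    proof (intro sum.neutral ballI)
      fix i assume "i \<in> I"
      then have "i \<in> Z m \<or> i \<in> Z m'" using un by blast
      then show "cvec V a b g l m i x * cnj (cvec V a b g l m' i y) = 0" by (auto simp: Z_def)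
    qed
    finally show ?thesis .
  qed
  obtain z where z: "\<And>j. bra l (a j) * cnj (bra l (a j)) * bra m (b j) * cnj (bra m' (b j)) = z * of_real (rg j)"
    using frame_relation_unique[OF g rel] by blast
  have one: "\<exists>j0. \<forall>j. j \<noteq> j0 \<longrightarrow> bra f (v j) \<noteq> 0" if "frame r v" "f x \<noteq> 0" for f v r and x :: bool
    using frame_bra_eq_0[OF that(1)] that(2) by metis
  obtain x1 x2 where mx: "m x1 \<noteq> 0" "m' x2 \<noteq> 0" using cross2_nonzero[OF mm] by blast
  obtain j1 j2 j3 where j: "\<And>j. j \<noteq> j1 \<Longrightarrow> bra l (a j) \<noteq> 0" "\<And>j. j \<noteq> j2 \<Longrightarrow> bra m (b j) \<noteq> 0"
     "\<And>j. j \<noteq> j3 \<Longrightarrow> bra m' (b j) \<noteq> 0"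
    using one[OF a, of l x0] one[OF b, of m x1] one[OF b, of m' x2] l mx by metis
  \<comment> \<open>\<open>l\<close>, \<open>m\<close> and \<open>m'\<close> vanish at one index
    each at most, so at a fourth index none does and \<open>z\<close> is nonzero; the relation then
    shows that none of them vanishes anywhere.\<close>
  have "card {j1, j2, j3} < card (UNIV :: ix set)" unfolding card_ix
    by (rule le_less_trans[of _ 3]) (auto simp: card_insert_if)
  then obtain j4 where "j4 \<notin> {j1, j2, j3}" by (metis UNIV_I less_irrefl subsetI subset_UNIV subset_antisym)
  then have "bra l (a j4) * cnj (bra l (a j4)) * bra m (b j4) * cnj (bra m' (b j4)) \<noteq> 0"
    using j(1)[of j4] j(2)[of j4] j(3)[of j4] by simp
  then have z0: "z \<noteq> 0" using z[of j4] by auto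
  have nz: "bra l (a j) \<noteq> 0 \<and> bra m (b j) \<noteq> 0 \<and> bra m' (b j) \<noteq> 0" for j
  proof -
    have "bra l (a j) * cnj (bra l (a j)) * bra m (b j) * cnj (bra m' (b j)) \<noteq> 0"
      unfolding z using z0 frame_neq0[OF g, of j] by simp
    then show ?thesis by auto
  qed
  have IX: "I - Z m' = Z m" "I - Z m = Z m'" using un disj by auto
  have blk: "\<exists>F F'. cross2 F F' \<noteq> 0 \<and> orth_ann C F F' \<and>
        (\<forall>j. cnj (V i j) = bra l (a j) * bra k (b j) * bra F (g j)) \<and>
        (\<forall>j. cnj (V i' j) = bra l (a j) * bra k (b j) * bra F' (g j))"
    if k: "k \<in> {m, m'}" and W: "W = I - Z k" "card W = 2" "i \<in> W" "i' \<in> W" "i \<noteq> i'" for k W i i'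
  proof -
    have "W = {i, i'}" using W(2-5) by (metis card_2_iff insert_iff singletonD insert_commute)
    then have rest: "cvec V a b g l k s = (\<lambda>_. 0)" if "s \<in> I" "s \<noteq> i" "s \<noteq> i'" for s
      using that W(1) by (auto simp: Z_def)
    have nzz: "cvec V a b g l k i \<noteq> (\<lambda>_. 0)" "cvec V a b g l k i' \<noteq> (\<lambda>_. 0)" "i \<in> I" "i' \<in> I"
      using W by (auto simp: Z_def)
    show ?thesis
      by (rule block_functionals[OF V nzz(3,4) W(5) C rest nzz(1,2)])
         (use orth[OF k nzz(4,3)] W(5) in auto)
  qed
  have "split_blocks V I a b g rg l m m' C (Z m')"
    unfolding split_blocks_def
  proof (intro conjI)
    show "\<forall>j. bra l (a j) \<noteq> 0 \<and> bra m (b j) \<noteq> 0 \<and> bra m' (b j) \<noteq> 0" using nz by blast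
    show "\<forall>i\<in>Z m'. \<forall>i'\<in>Z m'. i \<noteq> i' \<longrightarrow> (\<exists>F F'. cross2 F F' \<noteq> 0 \<and> orth_ann C F F' \<and>
        (\<forall>j. cnj (V i j) = bra l (a j) * bra m (b j) * bra F (g j)) \<and>
        (\<forall>j. cnj (V i' j) = bra l (a j) * bra m (b j) * bra F' (g j)))"
      using blk[of m "Z m'"] cz IX by auto
    show "\<forall>i\<in>I - Z m'. \<forall>i'\<in>I - Z m'. i \<noteq> i' \<longrightarrow> (\<exists>F F'. cross2 F F' \<noteq> 0 \<and> orth_ann C F F' \<and>
        (\<forall>j. cnj (V i j) = bra l (a j) * bra m' (b j) * bra F (g j)) \<and>
        (\<forall>j. cnj (V i' j) = bra l (a j) * bra m' (b j) * bra F' (g j)))"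
      using blk[of m' "I - Z m'"] cz IX by auto
  qed (use mm C cz ZI z z0 in auto)
  then show thesis by (rule that)
qed

lemma split_blocksD:
  assumes "split_blocks V I a b g rg l m m' C X"
  shows "cross2 m m' \<noteq> 0" "det2 C \<noteq> 0" "X \<subseteq> I" "card X = 2"
    "bra l (a j) \<noteq> 0" "bra m (b j) \<noteq> 0" "bra m' (b j) \<noteq> 0"
    "\<exists>z. z \<noteq> 0 \<and> (\<forall>j. bra l (a j) * cnj (bra l (a j)) * bra m (b j) * cnj (bra m' (b j)) = z * of_real (rg j))"
    "i \<in> X \<Longrightarrow> i' \<in> X \<Longrightarrow> i \<noteq> i' \<Longrightarrow> \<exists>F F'. cross2 F F' \<noteq> 0 \<and> orth_ann C F F' \<and>
        (\<forall>j. cnj (V i j) = bra l (a j) * bra m (b j) * bra F (g j)) \<and>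
        (\<forall>j. cnj (V i' j) = bra l (a j) * bra m (b j) * bra F' (g j))"
    "i \<in> I - X \<Longrightarrow> i' \<in> I - X \<Longrightarrow> i \<noteq> i' \<Longrightarrow> \<exists>F F'. cross2 F F' \<noteq> 0 \<and> orth_ann C F F' \<and>
        (\<forall>j. cnj (V i j) = bra l (a j) * bra m' (b j) * bra F (g j)) \<and>
        (\<forall>j. cnj (V i' j) = bra l (a j) * bra m' (b j) * bra F' (g j))"
proof -
  note A = assms[unfolded split_blocks_def]
  show "cross2 m m' \<noteq> 0" by (rule A[THEN conjunct1])
  show "det2 C \<noteq> 0" by (rule A[THEN conjunct2, THEN conjunct1])
  show "X \<subseteq> I" by (rule A[THEN conjunct2, THEN conjunct2, THEN conjunct1])
  show "card X = 2" by (rule A[THEN conjunct2, THEN conjunct2, THEN conjunct2, THEN conjunct1])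
  show "bra l (a j) \<noteq> 0" "bra m (b j) \<noteq> 0" "bra m' (b j) \<noteq> 0"
    using A[THEN conjunct2, THEN conjunct2, THEN conjunct2, THEN conjunct2, THEN conjunct1] by blast+
  show "\<exists>z. z \<noteq> 0 \<and> (\<forall>j. bra l (a j) * cnj (bra l (a j)) * bra m (b j) * cnj (bra m' (b j)) = z * of_real (rg j))"
    by (rule A[THEN conjunct2, THEN conjunct2, THEN conjunct2, THEN conjunct2, THEN conjunct2, THEN conjunct1])
  show "\<exists>F F'. cross2 F F' \<noteq> 0 \<and> orth_ann C F F' \<and>
        (\<forall>j. cnj (V i j) = bra l (a j) * bra m (b j) * bra F (g j)) \<and>
        (\<forall>j. cnj (V i' j) = bra l (a j) * bra m (b j) * bra F' (g j))" if "i \<in> X" "i' \<in> X" "i \<noteq> i'"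
    by (rule A[THEN conjunct2, THEN conjunct2, THEN conjunct2, THEN conjunct2, THEN conjunct2, THEN conjunct2, THEN conjunct1, THEN bspec, OF that(1), THEN bspec, OF that(2), THEN mp, OF that(3)])
  show "\<exists>F F'. cross2 F F' \<noteq> 0 \<and> orth_ann C F F' \<and>
        (\<forall>j. cnj (V i j) = bra l (a j) * bra m' (b j) * bra F (g j)) \<and>
        (\<forall>j. cnj (V i' j) = bra l (a j) * bra m' (b j) * bra F' (g j))" if "i \<in> I - X" "i' \<in> I - X" "i \<noteq> i'"
    by (rule A[THEN conjunct2, THEN conjunct2, THEN conjunct2, THEN conjunct2, THEN conjunct2, THEN conjunct2, THEN conjunct2, THEN bspec, OF that(1), THEN bspec, OF that(2), THEN mp, OF that(3)])
qed

lemma split_blocks_swap: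
  assumes s: "split_blocks V I a b g rg l m m' C X" and I: "finite I" "card I = 4"
  shows "split_blocks V I a b g rg l m' m C (I - X)"
proof -
  note D = split_blocksD[OF s]
  obtain z where z: "z \<noteq> 0" "\<And>j. bra l (a j) * cnj (bra l (a j)) * bra m (b j) * cnj (bra m' (b j)) = z * of_real (rg j)"
    using D(8) by blast
  have z': "bra l (a j) * cnj (bra l (a j)) * bra m' (b j) * cnj (bra m (b j)) = cnj z * of_real (rg j)" for j
    using arg_cong[OF z(2)[of j], of cnj] by (simp add: mult_ac)
  have fX: "finite X" using D(3) I by (auto intro: finite_subset)
  have c: "card (I - X) = 2" using card_Diff_subset[OF fX D(3)] D(4) I by simp
  have II: "I - (I - X) = X" using D(3) by blast
  have mm: "cross2 m' m \<noteq> 0" using D(1) cross2_swap[of m m'] by simp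
  show ?thesis unfolding split_blocks_def II
  proof (intro conjI)
    show "\<exists>z. z \<noteq> 0 \<and> (\<forall>j. bra l (a j) * cnj (bra l (a j)) * bra m' (b j) * cnj (bra m (b j)) = z * of_real (rg j))"
      by (rule exI[of _ "cnj z"]) (use z(1) z' in simp)
    show "\<forall>i\<in>I - X. \<forall>i'\<in>I - X. i \<noteq> i' \<longrightarrow> (\<exists>F F'. cross2 F F' \<noteq> 0 \<and> orth_ann C F F' \<and>
        (\<forall>j. cnj (V i j) = bra l (a j) * bra m' (b j) * bra F (g j)) \<and>
        (\<forall>j. cnj (V i' j) = bra l (a j) * bra m' (b j) * bra F' (g j)))"
      by (intro ballI impI) (rule D(10))
    show "\<forall>i\<in>X. \<forall>i'\<in>X. i \<noteq> i' \<longrightarrow> (\<exists>F F'. cross2 F F' \<noteq> 0 \<and> orth_ann C F F' \<and>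
        (\<forall>j. cnj (V i j) = bra l (a j) * bra m (b j) * bra F (g j)) \<and>
        (\<forall>j. cnj (V i' j) = bra l (a j) * bra m (b j) * bra F' (g j)))"
      by (intro ballI impI) (rule D(9))
    show "\<forall>j. bra l (a j) \<noteq> 0 \<and> bra m' (b j) \<noteq> 0 \<and> bra m (b j) \<noteq> 0"
      using D(5,6,7) by simp
  qed (use c mm D(2) in auto)
qed

lemma two_blocks_cases:
  assumes I: "finite I" "card I = 4" and X: "X \<subseteq> I" "card X = 2" and Y: "Y \<subseteq> I" "card Y = 2"
  obtains "X = Y" | "X = I - Y"
  | i1 i2 i3 i4 where "i1 \<in> X" "i2 \<in> X" "i3 \<in> I - X" "i4 \<in> I - X"
      "i1 \<in> Y" "i3 \<in> Y" "i2 \<in> I - Y" "i4 \<in> I - Y" "distinct [i1, i2, i3, i4]"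
proof -
  have fX: "finite X" "finite Y" using I X Y by (auto intro: finite_subset)
  have cIX: "card (I - X) = 2" "card (I - Y) = 2" using I X Y fX by (simp_all add: card_Diff_subset)
  consider "X \<inter> Y = {}" | "Y \<subseteq> X" | i1 i3 where "i1 \<in> X" "i1 \<in> Y" "i3 \<in> Y" "i3 \<notin> X" by blast
  then show thesis
  proof cases
    case 1
    then have "X \<subseteq> I - Y" using X by blast
    then have "X = I - Y" using cIX X I by (intro card_subset_eq) auto
    then show thesis by (rule that(2))
  next
    case 2
    then have "Y = X" using X Y fX by (intro card_subset_eq) auto
    then show thesis using that(1) by blast
  next
    case 3
    have "i1 \<noteq> i3" using 3 by auto
    then have "Y = {i1, i3}" using 3 Y(2) fX by (intro card_subset_eq[symmetric]) auto
    have pair: "\<exists>t. W = {s, t} \<and> t \<noteq> s" if W: "card W = 2" "s \<in> W" for W :: "'a set" and s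
    proof -
      obtain p q where "W = {p, q}" "p \<noteq> q" using W(1) by (auto simp: card_2_iff)
      then show ?thesis using W(2) by auto
    qed
    obtain i2 where i2: "X = {i1, i2}" "i2 \<noteq> i1" using pair[OF X(2) 3(1)] by blast
    have "i3 \<in> I - X" using 3 Y(1) by blast
    then obtain i4 where i4: "I - X = {i3, i4}" "i4 \<noteq> i3" using pair[OF cIX(1)] by blast
    show thesis
      by (rule that(3)[of i1 i2 i3 i4]) (use 3 i2 i4 X Y \<open>Y = {i1, i3}\<close> in auto)
  qed
qed

lemma split_same_kind_contradiction:
  assumes V: "unitary_coeffs V I" and a: "frame ra a" and b: "frame rb b" and g: "frame rg g"
    and ne: "ra \<noteq> rb" "ra \<noteq> (\<lambda>j. - rb j)" "ra \<noteq> rg" "ra \<noteq> (\<lambda>j. - rg j)"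
    and ll: "cross2 l l' \<noteq> 0"
    and s: "split_blocks V I a b g rg l m m' C X" and t: "split_blocks V I a b g rg l' k k' D Y"
  shows False
proof -
  have I: "finite I" "card I = 4" using unitary_coeffsD(1)[OF V] card_unitary_coeffs[OF V] by auto
  note S = split_blocksD[OF s]
  have same: False if t: "split_blocks V I a b g rg l' k k' D Y" and XY: "X = Y" for k k' Y
  proof -
    note T = split_blocksD[OF t]
    obtain i i' where i: "i \<in> X" "i' \<in> X" "i \<noteq> i'" using S(4) by (auto simp: card_2_iff)
    obtain f1 f2 where f: "cross2 f1 f2 \<noteq> 0" "\<And>j. cnj (V i j) = bra l (a j) * bra m (b j) * bra f1 (g j)"
        "\<And>j. cnj (V i' j) = bra l (a j) * bra m (b j) * bra f2 (g j)"
      using S(9)[OF i] by blast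
    obtain h1 h2 where h: "\<And>j. cnj (V i j) = bra l' (a j) * bra k (b j) * bra h1 (g j)"
        "\<And>j. cnj (V i' j) = bra l' (a j) * bra k (b j) * bra h2 (g j)"
      using T(9)[OF i[unfolded XY]] by blast
    have e: "bra l (a j) * bra m (b j) * bra f1 (g j) = bra l' (a j) * bra k (b j) * bra h1 (g j)"
       "bra l (a j) * bra m (b j) * bra f2 (g j) = bra l' (a j) * bra k (b j) * bra h2 (g j)" for j
      using f(2,3)[of j] h[of j] by auto
    show False
      by (rule same_kind_same_block[OF a b g ne(1,2) S(5) S(6) T(5) T(6) e ll f(1)])
  qed
  note T = split_blocksD[OF t]
  from I S(3,4) T(3,4) show False
  proof (cases rule: two_blocks_cases)
    case 1
    then show False using same[OF t] by blast
  next
    case 2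
    \<comment> \<open>Complementary blocks become equal when \<open>k\<close> and \<open>k'\<close>
      exchange roles.\<close>
    then show False using same[OF split_blocks_swap[OF t I]] by blast
  next
    case (3 i1 i2 i3 i4)
    have d: "i1 \<noteq> i2" "i3 \<noteq> i4" "i1 \<noteq> i3" "i2 \<noteq> i4" using 3 by auto
    obtain f1 f2 where f: "cross2 f1 f2 \<noteq> 0" "orth_ann C f1 f2" "\<And>j. cnj (V i1 j) = bra l (a j) * bra m (b j) * bra f1 (g j)"
        "\<And>j. cnj (V i2 j) = bra l (a j) * bra m (b j) * bra f2 (g j)"
      using S(9)[OF 3(1,2) d(1)] by blast
    obtain f3 f4 where f': "cross2 f3 f4 \<noteq> 0" "orth_ann C f3 f4" "\<And>j. cnj (V i3 j) = bra l (a j) * bra m' (b j) * bra f3 (g j)"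
        "\<And>j. cnj (V i4 j) = bra l (a j) * bra m' (b j) * bra f4 (g j)"
      using S(10)[OF 3(3,4) d(2)] by blast
    obtain h1 h3 where h: "cross2 h1 h3 \<noteq> 0" "orth_ann D h1 h3" "\<And>j. cnj (V i1 j) = bra l' (a j) * bra k (b j) * bra h1 (g j)"
        "\<And>j. cnj (V i3 j) = bra l' (a j) * bra k (b j) * bra h3 (g j)"
      using T(9)[OF 3(5,6) d(3)] by blast
    obtain h2 h4 where h': "cross2 h2 h4 \<noteq> 0" "orth_ann D h2 h4" "\<And>j. cnj (V i2 j) = bra l' (a j) * bra k' (b j) * bra h2 (g j)"
        "\<And>j. cnj (V i4 j) = bra l' (a j) * bra k' (b j) * bra h4 (g j)"
      using T(10)[OF 3(7,8) d(4)] by blast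
    obtain z where z: "z \<noteq> 0" "\<And>j. bra l (a j) * cnj (bra l (a j)) * bra m (b j) * cnj (bra m' (b j)) = z * of_real (rg j)"
      using S(8) by blast
    obtain z' where z': "z' \<noteq> 0" "\<And>j. bra l' (a j) * cnj (bra l' (a j)) * bra k (b j) * cnj (bra k' (b j)) = z' * of_real (rg j)"
      using T(8) by blast
    have e: "bra l (a j) * bra m (b j) * bra f1 (g j) = bra l' (a j) * bra k (b j) * bra h1 (g j)"
       "bra l (a j) * bra m (b j) * bra f2 (g j) = bra l' (a j) * bra k' (b j) * bra h2 (g j)"
       "bra l (a j) * bra m' (b j) * bra f3 (g j) = bra l' (a j) * bra k (b j) * bra h3 (g j)"
       "bra l (a j) * bra m' (b j) * bra f4 (g j) = bra l' (a j) * bra k' (b j) * bra h4 (g j)" for j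
      using f(3,4)[of j] f'(3,4)[of j] h(3,4)[of j] h'(3,4)[of j] by auto
    show False
      by (rule same_kind_crossing_blocks[OF a b g ne(3,4) S(5) S(6) T(5) T(6) T(7) e z(2,1) z'(2,1) ll S(1)
            S(2) f(1,2) f'(1,2) T(2) h(1,2) h'(1,2)])
  qed
qed

lemma split_different_kind_contradiction:
  assumes V: "unitary_coeffs V I" and a: "frame ra a" and b: "frame rb b" and g: "frame rg g"
    and ne: "rg \<noteq> rb" "rg \<noteq> (\<lambda>j. - rb j)"
    and ll: "cross2 l l' \<noteq> 0"
    and s: "split_blocks V I a b g rg l m m' C X" and t: "split_blocks V I a g b rb l' n n' D Y"
  shows False
proof -
  have I: "finite I" "card I = 4" using unitary_coeffsD(1)[OF V] card_unitary_coeffs[OF V] by auto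
  note S = split_blocksD[OF s]
  have same: False if t: "split_blocks V I a g b rb l' n n' D Y" and XY: "X = Y" for n n' Y
  proof -
    note T = split_blocksD[OF t]
    obtain i i' where i: "i \<in> X" "i' \<in> X" "i \<noteq> i'" using S(4) by (auto simp: card_2_iff)
    obtain f1 f2 where f: "cross2 f1 f2 \<noteq> 0" "\<And>j. cnj (V i j) = bra l (a j) * bra m (b j) * bra f1 (g j)"
        "\<And>j. cnj (V i' j) = bra l (a j) * bra m (b j) * bra f2 (g j)"
      using S(9)[OF i] by blast
    obtain h1 h2 where h: "\<And>j. cnj (V i j) = bra l' (a j) * bra n (g j) * bra h1 (b j)"
        "\<And>j. cnj (V i' j) = bra l' (a j) * bra n (g j) * bra h2 (b j)"
      using T(9)[OF i[unfolded XY]] by blast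
    have e: "bra l (a j) * bra m (b j) * bra f1 (g j) = bra l' (a j) * bra n (g j) * bra h1 (b j)"
       "bra l (a j) * bra m (b j) * bra f2 (g j) = bra l' (a j) * bra n (g j) * bra h2 (b j)" for j
      using f(2,3)[of j] h[of j] by auto
    show False
      by (rule different_kind_same_block[OF a b g ne S(5) S(6) T(5) T(6) e f(1)])
  qed
  note T = split_blocksD[OF t]
  from I S(3,4) T(3,4) show False
  proof (cases rule: two_blocks_cases)
    case 1
    then show False using same[OF t] by blast
  next
    case 2
    then show False using same[OF split_blocks_swap[OF t I]] by blast
  next
    case (3 i1 i2 i3 i4)
    have d: "i1 \<noteq> i2" "i3 \<noteq> i4" "i1 \<noteq> i3" "i2 \<noteq> i4" using 3 by auto
    obtain f1 f2 where f: "cross2 f1 f2 \<noteq> 0" "\<And>j. cnj (V i1 j) = bra l (a j) * bra m (b j) * bra f1 (g j)"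
        "\<And>j. cnj (V i2 j) = bra l (a j) * bra m (b j) * bra f2 (g j)"
      using S(9)[OF 3(1,2) d(1)] by blast
    obtain h1 where h: "\<And>j. cnj (V i1 j) = bra l' (a j) * bra n (g j) * bra h1 (b j)"
      using T(9)[OF 3(5,6) d(3)] by blast
    obtain h2 where h': "\<And>j. cnj (V i2 j) = bra l' (a j) * bra n' (g j) * bra h2 (b j)"
      using T(10)[OF 3(7,8) d(4)] by blast
    obtain z where z: "z \<noteq> 0" "\<And>j. bra l (a j) * cnj (bra l (a j)) * bra m (b j) * cnj (bra m' (b j)) = z * of_real (rg j)"
      using S(8) by blast
    obtain z' where z': "z' \<noteq> 0" "\<And>j. bra l' (a j) * cnj (bra l' (a j)) * bra n (g j) * cnj (bra n' (g j)) = z' * of_real (rb j)"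
      using T(8) by blast
    have e: "bra l (a j) * bra m (b j) * bra f1 (g j) = bra l' (a j) * bra n (g j) * bra h1 (b j)"
       "bra l (a j) * bra m (b j) * bra f2 (g j) = bra l' (a j) * bra n' (g j) * bra h2 (b j)" for j
      using f(2,3)[of j] h[of j] h'[of j] by auto
    show False
      by (rule different_kind_crossing_blocks[OF a b g S(5) S(6) T(5) T(6) T(7) e z(2,1) z'(2,1) ll S(1)
            T(1) f(1)])
  qed
qed

section \<open>Functionals that annihilate a state\<close>

text \<open>A nonzero \<open>l\<close> vanishes at one \<open>a j\<close> at most, and the
  coefficients of a state that it annihilates are supported there.\<close>

lemma zero_row_monomial:
  assumes V: "unitary_coeffs V I" and a: "frame ra a" and l: "l x \<noteq> 0" and i: "i \<in> I"
    and 0: "\<And>j. V i j * bra l (a j) = 0"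
  obtains j0 where "bra l (a j0) = 0" "V i j0 \<noteq> 0" "\<And>j. j \<noteq> j0 \<Longrightarrow> V i j = 0" "\<And>j. j \<noteq> j0 \<Longrightarrow> bra l (a j) \<noteq> 0"
proof -
  obtain j0 where j0: "V i j0 \<noteq> 0" using unitary_row_nonzero[OF V i] by blast
  then have l0: "bra l (a j0) = 0" using 0[of j0] by simp
  have n: "bra l (a j) \<noteq> 0" if "j \<noteq> j0" for j
    using frame_bra_eq_0[OF a _ l0 that] l by blast
  then have "V i j = 0" if "j \<noteq> j0" for j using 0[of j] that by auto
  then show thesis using that l0 j0 n by blast
qed

text \<open>In a splitting the coefficients of a state are nonzero multiples of the values of a
  nonzero functional at the \<open>g j\<close>, so at most one of them is zero.\<close>

lemma split_not_monomial:
  assumes V: "unitary_coeffs V I" and g: "frame rg g"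
    and s: "split_blocks V I a b g rg l m m' C X" and i: "i \<in> I"
    and mono: "\<And>j. j \<noteq> j0 \<Longrightarrow> V i j = 0"
  shows False
proof -
  note S = split_blocksD[OF s]
  have I: "finite I" "card I = 4" using unitary_coeffsD(1)[OF V] card_unitary_coeffs[OF V] by auto
  have F0: "F x = 0" if F: "\<And>j. cnj (V i j) = bra l (a j) * bra k (b j) * bra F (g j)"
    and nz: "\<And>j. bra k (b j) \<noteq> 0" for F k x
  proof -
    obtain p where "p \<noteq> j0" using ix_exists_other by blast
    then obtain q t where d: "distinct [j0, p, q, t]" by (metis ix_complete2)
    have "bra F (g j) = 0" if "j \<noteq> j0" for j
      using F[of j] mono[OF that] S(5)[of j] nz[of j] by simp
    then show ?thesis using d frame_bra_eq_0[OF g, of F p q] by auto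
  qed
  have other: "\<exists>i'. i' \<in> W \<and> i' \<noteq> i" if "card W = 2" for W
    using that by (auto simp: card_2_iff)
  have fX: "finite X" using S(3) I by (auto intro: finite_subset)
  have cX: "card (I - X) = 2" using card_Diff_subset[OF fX S(3)] S(4) I by simp
  show False
  proof (cases "i \<in> X")
    case True
    obtain i' where "i' \<in> X" "i' \<noteq> i" using other[OF S(4)] by blast
    then obtain F F' where F: "cross2 F F' \<noteq> 0" "\<And>j. cnj (V i j) = bra l (a j) * bra m (b j) * bra F (g j)"
      using S(9)[OF True] by blast
    have "F x = 0" for x by (rule F0[OF F(2) S(6)])
    then show False using F(1) by (simp add: cross2_def)
  next
    case False
    then have iX: "i \<in> I - X" using i by blast
    obtain i' where "i' \<in> I - X" "i' \<noteq> i" using other[OF cX] by blast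
    then obtain F F' where F: "cross2 F F' \<noteq> 0" "\<And>j. cnj (V i j) = bra l (a j) * bra m' (b j) * bra F (g j)"
      using S(10)[OF iX] by blast
    have "F x = 0" for x by (rule F0[OF F(2) S(7)])
    then show False using F(1) by (simp add: cross2_def)
  qed
qed

text \<open>Both annihilated states are product vectors up to scalars, with different indices, so
  the other two states lie in the span of the remaining two product vectors. The collapse after
  \<open>l\<close> removes a coefficient of one of them; by orthogonality both are then product
  vectors, as \<open>monomial_rows_contradiction\<close> forbids.\<close>

lemma two_zero_rows_contradiction:
  assumes V: "unitary_coeffs V I" and a: "frame ra a" and b: "frame rb b" and g: "frame rg g"
    and ne: "rb \<noteq> rg" "rb \<noteq> (\<lambda>j. - rg j)"
    and ll: "cross2 l l' \<noteq> 0" and col: "collapses V I a b g l"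
    and i: "i0 \<in> I" "\<And>j. V i0 j * bra l (a j) = 0"
    and i': "i0' \<in> I" "\<And>j. V i0' j * bra l' (a j) = 0"
  shows False
proof -
  have I: "finite I" "card I = 4" using unitary_coeffsD(1)[OF V] card_unitary_coeffs[OF V] by auto
  obtain x x' where lx: "l x \<noteq> 0" "l' x' \<noteq> 0" using cross2_nonzero[OF ll] by blast
  obtain j0 where j0: "bra l (a j0) = 0" "V i0 j0 \<noteq> 0" "\<And>j. j \<noteq> j0 \<Longrightarrow> V i0 j = 0" "\<And>j. j \<noteq> j0 \<Longrightarrow> bra l (a j) \<noteq> 0"
    using zero_row_monomial[of V I ra a l x i0] V a lx(1) i by metis
  obtain j0' where j0': "bra l' (a j0') = 0" "V i0' j0' \<noteq> 0" "\<And>j. j \<noteq> j0' \<Longrightarrow> V i0' j = 0"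
    using zero_row_monomial[of V I ra a l' x' i0'] V a lx(2) i' by metis
  have jj: "j0 \<noteq> j0'"
  proof
    assume e: "j0 = j0'"
    obtain k where k: "k \<noteq> j0" using ix_exists_other by blast
    have "cross2 l l' * cross2 (a j0) (a k) = 0"
      using bra_cross2[of l "a j0" l' "a k"] j0(1) j0'(1) e by simp
    then show False using ll frameD(4)[OF a, of j0 k] k by auto
  qed
  have ii: "i0 \<noteq> i0'" using j0(2) j0'(3)[OF jj] by auto
  have "card (I - {i0, i0'}) = 2" using I i i' ii by (simp add: card_Diff_subset)
  then obtain p q where pq: "I - {i0, i0'} = {p, q}" "p \<noteq> q" by (metis card_2_iff)
  have d: "p \<in> I" "q \<in> I" "p \<noteq> i0" "p \<noteq> i0'" "q \<noteq> i0" "q \<noteq> i0'" using pq by auto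
  obtain k k' where kk: "distinct [j0, j0', k, k']" using ix_complete2[OF jj] by blast
  have p0: "V t j0 = 0" "V t j0' = 0" if "t \<in> {p, q}" for t
    using that d unitary_row_orth[OF V _ i(1) _ j0(2,3), of t] unitary_row_orth[OF V _ i'(1) _ j0'(2,3), of t] by auto
  have i0'0: "V i0' j0 = 0" using j0'(3) jj by auto
  obtain m m' C where mm: "cross2 m m' \<noteq> 0" and C: "det2 C \<noteq> 0"
    and orth: "\<And>k i i'. k \<in> {m, m'} \<Longrightarrow> i \<in> I \<Longrightarrow> i' \<in> I \<Longrightarrow> i \<noteq> i' \<Longrightarrow>
        cinner (mat_apply C (cvec V a b g l k i)) (mat_apply C (cvec V a b g l k i')) = 0"
    using col unfolding collapses_def by blast
  \<comment> \<open>State \<open>i0\<close> is already lost to \<open>l\<close>; the other three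
    leave pairwise orthogonal vectors in one qubit, so each of \<open>m\<close>, \<open>m'\<close>
    annihilates one of them.\<close>
  have zero: "\<exists>t\<in>{p, q, i0'}. cvec V a b g l \<mu> t = (\<lambda>_. 0)" if "\<mu> \<in> {m, m'}" for \<mu>
  proof -
    have "cvec V a b g l \<mu> p = (\<lambda>_. 0) \<or> cvec V a b g l \<mu> q = (\<lambda>_. 0) \<or> cvec V a b g l \<mu> i0' = (\<lambda>_. 0)"
      using orth[OF that] pq(2) d i'(1) by (intro three_orthogonal[OF C]) auto
    then show ?thesis by blast
  qed
  have nboth: "\<not> (cvec V a b g l m t = (\<lambda>_. 0) \<and> cvec V a b g l m' t = (\<lambda>_. 0))" if "t \<in> {p, q, i0'}" for t
  proof
    assume "cvec V a b g l m t = (\<lambda>_. 0) \<and> cvec V a b g l m' t = (\<lambda>_. 0)"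
    then have "V t j * bra l (a j) = 0" for j using cvec_both_zero[OF b g ne mm, of V a l t] by blast
    then have "V t j = 0" if "j \<noteq> j0" for j using j0(4)[OF that] by (metis mult_eq_0_iff)
    moreover have "V t j0 = 0" using that p0 i0'0 by auto
    ultimately have "V t j = 0" for j by metis
    moreover have "t \<in> I" using that d i' by auto
    ultimately show False using unitary_row_nonzero[OF V] by metis
  qed
  obtain t1 t2 where t: "t1 \<in> {p, q, i0'}" "cvec V a b g l m t1 = (\<lambda>_. 0)" "t2 \<in> {p, q, i0'}" "cvec V a b g l m' t2 = (\<lambda>_. 0)"
    using zero[of m] zero[of m'] by blast
  \<comment> \<open>The two annihilated states differ, so at least one of them is not
    \<open>i0'\<close>.\<close>
  have "t1 \<noteq> t2" using nboth t by blast
  then obtain t \<mu> where t\<mu>: "t \<in> {p, q}" "\<mu> \<in> {m, m'}" "cvec V a b g l \<mu> t = (\<lambda>_. 0)"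
    using t by blast
  obtain s where s: "s \<in> {p, q}" "s \<noteq> t" "{p, q} = {s, t}" using t\<mu>(1) pq(2) by blast
  obtain y1 y2 where "m y1 \<noteq> 0" "m' y2 \<noteq> 0" using cross2_nonzero[OF mm] by blast
  then obtain y where y: "\<mu> y \<noteq> 0" using t\<mu>(2) by blast
  have two: "V t k * bra l (a k) * bra \<mu> (b k) = 0" "V t k' * bra l (a k') * bra \<mu> (b k') = 0"
    using cvec_two_terms[OF kk p0[OF t\<mu>(1)] g t\<mu>(3)] by auto
  have "bra l (a k) \<noteq> 0" "bra l (a k') \<noteq> 0" using j0(4) kk by auto
  then have "V t k = 0 \<or> V t k' = 0"
    using two frame_bra_eq_0[OF b, of \<mu> k k' y] y kk by auto
  then obtain \<kappa> \<kappa>' where \<kappa>: "distinct [j0, j0', \<kappa>, \<kappa>']" "V t \<kappa>' = 0"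
  proof
    assume "V t k = 0"
    then show thesis using that[of k' k] kk by auto
  next
    assume "V t k' = 0"
    then show thesis using that[of k k'] kk by auto
  qed
  have all: "j \<in> {j0, j0', \<kappa>, \<kappa>'}" for j using distinct_ix_UNIV[OF \<kappa>(1)] by blast
  have tI: "t \<in> I" "s \<in> I" "t \<noteq> i0'" "s \<noteq> i0'" using t\<mu>(1) s d by auto
  have tm: "V t j = 0" if "j \<noteq> \<kappa>" for j using all[of j] that p0[OF t\<mu>(1)] \<kappa>(2) by auto
  then have tn: "V t \<kappa> \<noteq> 0" using unitary_row_nonzero[OF V tI(1)] by metis
  have "V s \<kappa> = 0" by (rule unitary_row_orth[OF V tI(2,1) s(2) tn tm])
  then have sm: "V s j = 0" if "j \<noteq> \<kappa>'" for j using all[of j] that p0[OF s(1)] by auto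
  then have sn: "V s \<kappa>' \<noteq> 0" using unitary_row_nonzero[OF V tI(2)] by metis
  show False
  proof (rule monomial_rows_contradiction[OF b g col, of i0' t s j0' \<kappa> \<kappa>'])
    show "distinct [i0', t, s]" "distinct [j0', \<kappa>, \<kappa>']" using tI s \<kappa> by auto
    show "bra l (a j0') \<noteq> 0" "bra l (a \<kappa>) \<noteq> 0" "bra l (a \<kappa>') \<noteq> 0" using j0(4) \<kappa>(1) by auto
  qed (use i' tI j0'(2,3) tn tm sn sm in auto)
qed

lemma no_two_collapsing_functionals:
  assumes V: "unitary_coeffs V I" and a: "frame ra a" and b: "frame rb b" and g: "frame rg g"
    and ab: "ra \<noteq> rb" "ra \<noteq> (\<lambda>j. - rb j)" and ag: "ra \<noteq> rg" "ra \<noteq> (\<lambda>j. - rg j)"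
    and bg: "rb \<noteq> rg" "rb \<noteq> (\<lambda>j. - rg j)"
    and ll: "cross2 l l' \<noteq> 0"
    and l: "collapses V I a b g l \<or> collapses V I a g b l"
    and l': "collapses V I a b g l' \<or> collapses V I a g b l'"
  shows False
proof -
  have gb: "rg \<noteq> rb" "rg \<noteq> (\<lambda>j. - rb j)" using bg by auto
  obtain x x' where lx: "l x \<noteq> 0" "l' x' \<noteq> 0" using cross2_nonzero[OF ll] by blast
  have ll': "cross2 l' l \<noteq> 0" using ll cross2_swap[of l l'] by simp
  define Z where "Z l \<longleftrightarrow> (\<exists>i\<in>I. \<forall>j. V i j * bra l (a j) = 0)" for l
  have split: "(\<exists>m m' C X. split_blocks V I a b g rg k m m' C X) \<or> (\<exists>m m' C X. split_blocks V I a g b rb k m m' C X)"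
    if "collapses V I a b g k \<or> collapses V I a g b k" "\<not> Z k" "k y \<noteq> 0" for k y
    using that(1)
  proof
    assume "collapses V I a b g k"
    then show ?thesis
      using collapses_split[OF V a b g bg, of k y] that(2,3) unfolding Z_def by metis
  next
    assume "collapses V I a g b k"
    then show ?thesis
      using collapses_split[OF V a g b gb, of k y] that(2,3) unfolding Z_def by metis
  qed
  \<comment> \<open>A functional that annihilates a state makes it a multiple of a product vector,
    and no splitting tolerates such a state; hence both functionals are of the same kind.\<close>
  have mixed: False if h: "Z k" "\<not> Z k'" "k y \<noteq> 0" "k' y' \<noteq> 0" "collapses V I a b g k' \<or> collapses V I a g b k'" for k k' y y'
  proof -
    obtain i where i: "i \<in> I" "\<And>j. V i j * bra k (a j) = 0" using h(1) unfolding Z_def by blast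
    obtain j0 where "\<And>j. j \<noteq> j0 \<Longrightarrow> V i j = 0"
      using zero_row_monomial[of V I ra a k y i] V a h(3) i by metis
    then show False
      using split[OF h(5,2,4)] split_not_monomial[OF V g _ i(1)] split_not_monomial[OF V b _ i(1)] by metis
  qed
  show False
  proof (cases "Z l")
    case True
    have "Z l'" using mixed[OF True _ lx l'] by blast
    then obtain i0' where i0': "i0' \<in> I" "\<And>j. V i0' j * bra l' (a j) = 0" unfolding Z_def by blast
    obtain i0 where i0: "i0 \<in> I" "\<And>j. V i0 j * bra l (a j) = 0" using True unfolding Z_def by blast
    show False
      using l two_zero_rows_contradiction[OF V a b g bg ll _ i0 i0'] two_zero_rows_contradiction[OF V a g b gb ll _ i0 i0']
      by blast
  next
    case False
    then have "\<not> Z l'" using mixed[of l' l x' x] lx l by blast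
    then show False
      using split[OF l False lx(1)] split[OF l' _ lx(2)]
        split_same_kind_contradiction[OF V a b g ab ag ll]
        split_same_kind_contradiction[OF V a g b ag ab ll]
        split_different_kind_contradiction[OF V a b g gb ll]
        split_different_kind_contradiction[OF V a g b bg ll]
      by metis
  qed
qed

section \<open>Protocols\<close>

definition comb3 :: "(ix \<Rightarrow> complex) \<Rightarrow> (ix \<Rightarrow> qubit) \<Rightarrow> (ix \<Rightarrow> qubit) \<Rightarrow> (ix \<Rightarrow> qubit) \<Rightarrow> qstate" where
  "comb3 w a b c = (\<lambda>(x, y, z). \<Sum>j\<in>UNIV. w j * a j x * b j y * c j z)"

definition op_mult :: "bool op \<Rightarrow> bool op \<Rightarrow> bool op" where
  "op_mult K A = (\<lambda>x y. K x False * A False y + K x True * A True y)"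

definition row_mult :: "qubit \<Rightarrow> bool op \<Rightarrow> qubit" where
  "row_mult m A = (\<lambda>y. m False * A False y + m True * A True y)"

lemma sum_qubits:
  fixes f :: "bool \<times> bool \<times> bool \<Rightarrow> 'a::comm_monoid_add"
  shows "sum f UNIV = (\<Sum>x\<in>UNIV. \<Sum>y\<in>UNIV. \<Sum>z\<in>UNIV. f (x, y, z))"
  by (simp add: sum.cartesian_product split_def)

lemma mat_apply_op_mult: "mat_apply K (mat_apply A v) = mat_apply (op_mult K A) v"
  by (auto simp: mat_apply_bool op_mult_def algebra_simps)

lemma det2_op_mult: "det2 (op_mult K A) = det2 K * det2 A"
  unfolding det2_def op_mult_def by algebra

lemma bra_row_mult: "bra m (mat_apply A v) = bra (row_mult m A) v"
  by (simp add: bra_def row_mult_def mat_apply_bool algebra_simps)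

lemma cross2_row_mult: "cross2 (row_mult m A) (row_mult m' A) = cross2 m m' * det2 A"
  unfolding det2_def row_mult_def cross2_def by algebra

lemma mat_apply_local:
  "mat_apply (local_op PartyA K) u (x, y, z) = mat_apply K (\<lambda>x. u (x, y, z)) x"
  "mat_apply (local_op PartyB K) u (x, y, z) = mat_apply K (\<lambda>y. u (x, y, z)) y"
  "mat_apply (local_op PartyC K) u (x, y, z) = mat_apply K (\<lambda>z. u (x, y, z)) z"
  unfolding mat_apply_def sum_qubits local_op_def party.case tensor3_def prod.case id_op_def UNIV_bool
  by (cases x; cases y; cases z; simp)+

lemma cinner_slices:
  "cinner u v = (\<Sum>y\<in>UNIV. \<Sum>z\<in>UNIV. cinner (\<lambda>x. u (x, y, z)) (\<lambda>x. v (x, y, z)))"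
  "cinner u v = (\<Sum>x\<in>UNIV. \<Sum>z\<in>UNIV. cinner (\<lambda>y. u (x, y, z)) (\<lambda>y. v (x, y, z)))"
  "cinner u v = (\<Sum>x\<in>UNIV. \<Sum>y\<in>UNIV. cinner (\<lambda>z. u (x, y, z)) (\<lambda>z. v (x, y, z)))"
  for u v :: qstate
  by (simp_all add: cinner_def sum_qubits UNIV_bool)

lemma mat_apply_comb3:
  "mat_apply (local_op PartyA K) (comb3 w a b c) = comb3 w (\<lambda>j. mat_apply K (a j)) b c"
  "mat_apply (local_op PartyB K) (comb3 w a b c) = comb3 w a (\<lambda>j. mat_apply K (b j)) c"
  "mat_apply (local_op PartyC K) (comb3 w a b c) = comb3 w a b (\<lambda>j. mat_apply K (c j))"
proof -
  have e: "s * (\<Sum>j\<in>UNIV. f j) + t * (\<Sum>j\<in>UNIV. h j) = (\<Sum>j\<in>UNIV. s * f j + t * h j)" for s t and f h :: "ix \<Rightarrow> complex"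
    by (simp add: sum.distrib sum_distrib_left)
  show "mat_apply (local_op PartyA K) (comb3 w a b c) = comb3 w (\<lambda>j. mat_apply K (a j)) b c"
    "mat_apply (local_op PartyB K) (comb3 w a b c) = comb3 w a (\<lambda>j. mat_apply K (b j)) c"
    "mat_apply (local_op PartyC K) (comb3 w a b c) = comb3 w a b (\<lambda>j. mat_apply K (c j))"
    unfolding fun_eq_iff split_paired_All mat_apply_local comb3_def mat_apply_bool prod.case e
    by (intro allI sum.cong refl, simp add: algebra_simps)+
qed

lemma complete_meas_cinner:
  assumes "complete_meas Outs K"
  shows "(\<Sum>k\<in>Outs. cinner (mat_apply (K k) u) (mat_apply (K k) v)) = cinner u (v :: qubit)"
proof -
  define M where "M y z = (\<Sum>k\<in>Outs. \<Sum>x\<in>UNIV. cnj (K k x y) * K k x z)" for y z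
  have M: "M y z = id_op y z" for y z using assms by (simp add: complete_meas_def M_def)
  have "(\<Sum>k\<in>Outs. cinner (mat_apply (K k) u) (mat_apply (K k) v)) =
     cnj (u False) * v False * M False False + cnj (u False) * v True * M False True
     + cnj (u True) * v False * M True False + cnj (u True) * v True * M True True"
    unfolding M_def sum_distrib_left sum.distrib[symmetric]
    by (intro sum.cong refl) (simp add: cinner_bool mat_apply_bool UNIV_bool algebra_simps)
  then show ?thesis by (simp add: M id_op_def cinner_bool)
qed

lemma complete_meas_local_cinner:
  assumes "complete_meas Outs K"
  shows "(\<Sum>k\<in>Outs. cinner (mat_apply (local_op p (K k)) u) (mat_apply (local_op p (K k)) v)) = cinner u v"
proof (cases p)
  case PartyA
  show ?thesis unfolding PartyA cinner_slices(1) mat_apply_local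
    by (subst sum.swap, intro sum.cong refl, subst sum.swap, intro sum.cong refl)
       (rule complete_meas_cinner[OF assms])
next
  case PartyB
  show ?thesis unfolding PartyB cinner_slices(2) mat_apply_local
    by (subst sum.swap, intro sum.cong refl, subst sum.swap, intro sum.cong refl)
       (rule complete_meas_cinner[OF assms])
next
  case PartyC
  show ?thesis unfolding PartyC cinner_slices(3) mat_apply_local
    by (subst sum.swap, intro sum.cong refl, subst sum.swap, intro sum.cong refl)
       (rule complete_meas_cinner[OF assms])
qed

text \<open>At a leaf one of any two states is zero, and by completeness an inner product is the sum
  of those in the branches; so orthogonality climbs from the leaves to the root.\<close>

lemma locc_dist_orthogonal:
  assumes "locc_dist \<psi> I" "i \<in> I" "k \<in> I" "i \<noteq> k"
  shows "cinner (\<psi> i) (\<psi> k) = 0"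
  using assms
proof (induction rule: locc_dist.induct)
  case (leaf I \<psi>)
  then have "\<psi> i = (\<lambda>_. 0) \<or> \<psi> k = (\<lambda>_. 0)" by blast
  then show ?case by (auto simp: cinner_def)
next
  case (round Outs K p \<psi> I)
  have "cinner (\<psi> i) (\<psi> k) = (\<Sum>o'\<in>Outs. cinner (mat_apply (local_op p (K o')) (\<psi> i)) (mat_apply (local_op p (K o')) (\<psi> k)))"
    by (rule complete_meas_local_cinner[OF round.hyps(1), symmetric])
  also have "\<dots> = 0" using round by (intro sum.neutral) blast
  finally show ?case .
qed

lemma complete_meas_nonzero:
  fixes u :: qubit
  assumes "complete_meas Outs K" "u x \<noteq> 0"
  obtains k y where "k \<in> Outs" "mat_apply (K k) u y \<noteq> 0"
proof -
  have "det2 id_op \<noteq> 0" by (simp add: det2_def id_op_def)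
  moreover have "mat_apply id_op u = u" by (auto simp: mat_apply_bool id_op_def fun_eq_iff)
  ultimately have "cinner u u \<noteq> 0"
    using orthogonal_independent[of id_op u u x x] assms(2) by auto
  then have "(\<Sum>k\<in>Outs. cinner (mat_apply (K k) u) (mat_apply (K k) u)) \<noteq> 0"
    using complete_meas_cinner[OF assms(1), of u u] by simp
  then obtain k where "k \<in> Outs" "cinner (mat_apply (K k) u) (mat_apply (K k) u) \<noteq> 0"
    by (meson sum.neutral)
  moreover from this have "mat_apply (K k) u False \<noteq> 0 \<or> mat_apply (K k) u True \<noteq> 0"
    by (auto simp: cinner_bool)
  ultimately show thesis using that by blast
qed

lemma rank_one_factor:
  assumes "det2 K = 0"
  obtains w m where "K = (\<lambda>x y. w x * m y)"
proof (cases "K False False = 0 \<and> K False True = 0")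
  case True
  then have "K = (\<lambda>x y. (if x then 1 else 0) * K True y)"
    by (auto simp: fun_eq_iff) (metis (full_types))
  then show thesis by (rule that)
next
  case False
  then obtain s where s: "K False s \<noteq> 0" by blast
  have "cross2 (K False) (K True) = 0" using assms by (simp add: det2_def cross2_def)
  then obtain c where c: "\<And>y. K True y = c * K False y" using cross2_eq_0D s by blast
  have "K = (\<lambda>x y. (if x then c else 1) * K False y)"
    using c by (auto simp: fun_eq_iff)
  then show thesis by (rule that)
qed

text \<open>Completeness forbids a common kernel: one outcome does not annihilate
  \<open>ket0\<close>, and a second one does not annihilate the kernel of the functional of the
  first.\<close>

lemma rank_one_measurement:
  assumes K: "complete_meas Outs K" and d: "\<And>k. k \<in> Outs \<Longrightarrow> det2 (K k) = 0"
  obtains k k' w w' m m' x x' where "k \<in> Outs" "k' \<in> Outs" "K k = (\<lambda>x y. w x * m y)" "K k' = (\<lambda>x y. w' x * m' y)"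
    "w x \<noteq> 0" "w' x' \<noteq> 0" "cross2 m m' \<noteq> 0"
proof -
  obtain k y where k: "k \<in> Outs" "mat_apply (K k) ket0 y \<noteq> 0"
    using complete_meas_nonzero[OF K, of ket0 False] by (auto simp: ket0_def)
  obtain w m where wm: "K k = (\<lambda>x y. w x * m y)" using rank_one_factor[OF d[OF k(1)]] by blast
  have app: "mat_apply (\<lambda>x y. w x * m y) v = (\<lambda>x. w x * bra m v)" for w m v
    by (auto simp: mat_apply_bool bra_def algebra_simps)
  have 1: "w y \<noteq> 0" "bra m ket0 \<noteq> 0" using k(2) unfolding wm app by auto
  then have "rot m True \<noteq> 0" by (simp add: bra_def ket0_def rot_def)
  then obtain k' y' where k': "k' \<in> Outs" "mat_apply (K k') (rot m) y' \<noteq> 0"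
    using complete_meas_nonzero[OF K] by blast
  obtain w' m' where wm': "K k' = (\<lambda>x y. w' x * m' y)" using rank_one_factor[OF d[OF k'(1)]] by blast
  have 2: "w' y' \<noteq> 0" "cross2 m' m \<noteq> 0" using k'(2) unfolding wm' app bra_rot by auto
  then have "cross2 m m' \<noteq> 0" using cross2_swap[of m m'] by simp
  then show thesis using that k(1) k'(1) wm wm' 1 2 by blast
qed

lemma cinner_ket3:
  "cinner (ket3 a b c) (ket3 a' b' c') = cinner a a' * cinner b b' * cinner c c'"
  unfolding cinner_def sum_qubits ket3_def prod.case UNIV_bool by (simp add: algebra_simps)

lemma collapsed_orthogonal:
  assumes "locc_dist \<phi> I" and u: "u x \<noteq> 0" and w: "w y \<noteq> 0"
    and i: "i \<in> I" "k \<in> I" "i \<noteq> k"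
    and \<phi>: "\<phi> i = ket3 u w f \<and> \<phi> k = ket3 u w h \<or> \<phi> i = ket3 u f w \<and> \<phi> k = ket3 u h w"
  shows "cinner f h = 0"
proof -
  have id: "det2 id_op \<noteq> 0" by (simp add: det2_def id_op_def)
  have ap: "mat_apply id_op v = v" for v :: qubit
    by (auto simp: mat_apply_bool id_op_def fun_eq_iff)
  have nz: "cinner v v \<noteq> 0" if "v s \<noteq> 0" for v :: qubit and s
    using orthogonal_independent[of id_op v v s s] id ap that by auto
  have "cinner u u * cinner w w * cinner f h = 0"
    using locc_dist_orthogonal[OF assms(1) i] \<phi> by (auto simp: cinner_ket3)
  then show ?thesis using nz[of u x, OF u] nz[of w y, OF w] by simp
qed

text \<open>If the protocol stops before a second collapse, at most one state is alive;
  orthogonality is then trivial, and the rows of the invertible \<open>B\<close> can serve as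
  \<open>m\<close> and \<open>m'\<close>.\<close>

lemma collapses_leaf:
  assumes C: "det2 C \<noteq> 0" and B: "det2 B \<noteq> 0"
    and z: "\<And>i k. i \<in> I \<Longrightarrow> k \<in> I \<Longrightarrow> i \<noteq> k \<Longrightarrow>
       (\<forall>y z. (\<Sum>j\<in>UNIV. V i j * bra l (a j) * mat_apply B (b j) y * mat_apply C (c j) z) = 0) \<or>
       (\<forall>y z. (\<Sum>j\<in>UNIV. V k j * bra l (a j) * mat_apply B (b j) y * mat_apply C (c j) z) = 0)"
  shows "collapses V I a b c l"
proof -
  have cv: "mat_apply C (cvec V a b c l (B y) i) z = (\<Sum>j\<in>UNIV. V i j * bra l (a j) * mat_apply B (b j) y * mat_apply C (c j) z)" for y z i
    by (simp add: mat_apply_bool cvec_def sum_distrib_left bra_def flip: sum.distrib)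
       (intro sum.cong refl, simp add: algebra_simps)
  show ?thesis unfolding collapses_def
  proof (intro exI conjI ballI impI)
    show "cross2 (B False) (B True) \<noteq> 0" using B by (simp add: cross2_def det2_def)
    show "det2 C \<noteq> 0" by (rule C)
    fix k i i' assume k: "k \<in> {B False, B True}" and i: "i \<in> I" "i' \<in> I" "i \<noteq> i'"
    obtain y where y: "k = B y" using k by blast
    show "cinner (mat_apply C (cvec V a b c l k i)) (mat_apply C (cvec V a b c l k i')) = 0"
    proof -
      have "(\<forall>t. mat_apply C (cvec V a b c l (B y) i) t = 0) \<or> (\<forall>t. mat_apply C (cvec V a b c l (B y) i') t = 0)"
        unfolding cv using z[OF i] by blast
      then show ?thesis unfolding y by (auto simp: cinner_bool)
    qed
  qed
qed

lemma mat_apply_cvec: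
  "mat_apply C (cvec V a b c l m i) = (\<lambda>z. \<Sum>j\<in>UNIV. V i j * bra l (a j) * bra m (b j) * mat_apply C (c j) z)"
  by (rule ext, simp add: mat_apply_bool cvec_def sum_distrib_left flip: sum.distrib)
     (intro sum.cong refl, simp add: algebra_simps)

text \<open>Later measurements of the collapsed party act on its output \<open>u\<close> alone, and
  some outcome keeps it nonzero. For the other two parties an invertible outcome is followed where
  there is one; a measurement without any supplies \<open>m\<close> and \<open>m'\<close>.\<close>

lemma collapsed_party_collapses:
  assumes "locc_dist \<phi> I" "u x \<noteq> 0" "det2 B \<noteq> 0" "det2 C \<noteq> 0"
    and "\<And>i. i \<in> I \<Longrightarrow> \<phi> i = comb3 (V i) (\<lambda>j x. bra l (a j) * u x) (\<lambda>j. mat_apply B (b j)) (\<lambda>j. mat_apply C (c j))"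
  shows "collapses V I a b c l \<or> collapses V I a c b l"
  using assms
proof (induction arbitrary: u x B C rule: locc_dist.induct)
  case (leaf I \<psi>)
  have "collapses V I a b c l"
  proof (rule collapses_leaf[OF leaf.prems(3,2)])
    fix i k assume i: "i \<in> I" "k \<in> I" "i \<noteq> k"
    have "(\<forall>y z. (\<Sum>j\<in>UNIV. V s j * bra l (a j) * mat_apply B (b j) y * mat_apply C (c j) z) = 0)"
      if s: "s \<in> I" "\<psi> s = (\<lambda>_. 0)" for s
    proof (intro allI)
      fix y z
      have "0 = \<psi> s (x, y, z)" using s by simp
      also have "\<dots> = u x * (\<Sum>j\<in>UNIV. V s j * bra l (a j) * mat_apply B (b j) y * mat_apply C (c j) z)"
        unfolding leaf.prems(4)[OF s(1)] comb3_def by (simp add: sum_distrib_left mult_ac)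
      finally show "(\<Sum>j\<in>UNIV. V s j * bra l (a j) * mat_apply B (b j) y * mat_apply C (c j) z) = 0"
        using leaf.prems(1) by simp
    qed
    then show "(\<forall>y z. (\<Sum>j\<in>UNIV. V i j * bra l (a j) * mat_apply B (b j) y * mat_apply C (c j) z) = 0) \<or>
       (\<forall>y z. (\<Sum>j\<in>UNIV. V k j * bra l (a j) * mat_apply B (b j) y * mat_apply C (c j) z) = 0)"
      using leaf.hyps i by blast
  qed
  then show ?case ..
next
  case (round Outs K p \<psi> I)
  have IH: "collapses V I a b c l \<or> collapses V I a c b l"
    if "k \<in> Outs" "u x \<noteq> 0" "det2 B \<noteq> 0" "det2 C \<noteq> 0"
      "\<And>i. i \<in> I \<Longrightarrow> mat_apply (local_op p (K k)) (\<psi> i) = comb3 (V i) (\<lambda>j x. bra l (a j) * u x) (\<lambda>j. mat_apply B (b j)) (\<lambda>j. mat_apply C (c j))"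
    for k u x B C
    using round.IH[THEN bspec, OF that(1), THEN conjunct2] that(2-) by blast
  have child: "locc_dist (\<lambda>i. mat_apply (local_op p (K k)) (\<psi> i)) I" if "k \<in> Outs" for k
    using round.IH that by blast
  have cvB: "ket3 u w (mat_apply C (cvec V a b c l (row_mult m B) i)) =
     comb3 (V i) (\<lambda>j x. bra l (a j) * u x) (\<lambda>j. mat_apply (\<lambda>x y. w x * m y) (mat_apply B (b j))) (\<lambda>j. mat_apply C (c j))" for w m i
  proof -
    have "mat_apply (\<lambda>x y. w x * m y) v = (\<lambda>x. w x * bra m v)" for v
      by (auto simp: mat_apply_bool bra_def algebra_simps)
    then show ?thesis
      by (auto simp: fun_eq_iff ket3_def comb3_def mat_apply_cvec bra_row_mult sum_distrib_left mult_ac)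
  qed
  have cvC: "ket3 u (mat_apply B (cvec V a c b l (row_mult m C) i)) w =
     comb3 (V i) (\<lambda>j x. bra l (a j) * u x) (\<lambda>j. mat_apply B (b j)) (\<lambda>j. mat_apply (\<lambda>x y. w x * m y) (mat_apply C (c j)))" for w m i
  proof -
    have "mat_apply (\<lambda>x y. w x * m y) v = (\<lambda>x. w x * bra m v)" for v
      by (auto simp: mat_apply_bool bra_def algebra_simps)
    then show ?thesis
      by (auto simp: fun_eq_iff ket3_def comb3_def mat_apply_cvec bra_row_mult sum_distrib_left mult_ac)
  qed
  show ?case
  proof (cases p)
    case PartyA
    obtain k y where k: "k \<in> Outs" "mat_apply (K k) u y \<noteq> 0"
      using complete_meas_nonzero[OF round.hyps(1)] round.prems(1) by blast
    show ?thesis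
    proof (rule IH[of k "mat_apply (K k) u" y B C, OF k(1) k(2) round.prems(2,3)])
      fix i assume "i \<in> I"
      have "mat_apply (K k) (\<lambda>x. s * u x) = (\<lambda>x. s * mat_apply (K k) u x)" for s
        by (auto simp: mat_apply_bool algebra_simps)
      then show "mat_apply (local_op p (K k)) (\<psi> i) = comb3 (V i) (\<lambda>j x. bra l (a j) * mat_apply (K k) u x) (\<lambda>j. mat_apply B (b j)) (\<lambda>j. mat_apply C (c j))"
        unfolding PartyA round.prems(4)[OF \<open>i \<in> I\<close>] mat_apply_comb3 by simp
    qed
  next
    case PartyB
    show ?thesis
    proof (cases "\<exists>k\<in>Outs. det2 (K k) \<noteq> 0")
      case True
      then obtain k where k: "k \<in> Outs" "det2 (K k) \<noteq> 0" by blast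
      show ?thesis
      proof (rule IH[of k u x "op_mult (K k) B" C, OF k(1) round.prems(1) _ round.prems(3)])
        show "det2 (op_mult (K k) B) \<noteq> 0" using k round.prems(2) by (simp add: det2_op_mult)
        fix i assume "i \<in> I"
        then show "mat_apply (local_op p (K k)) (\<psi> i) = comb3 (V i) (\<lambda>j x. bra l (a j) * u x) (\<lambda>j. mat_apply (op_mult (K k) B) (b j)) (\<lambda>j. mat_apply C (c j))"
          by (simp add: PartyB round.prems(4) mat_apply_comb3 mat_apply_op_mult)
      qed
    next
      case False
      then have d: "\<And>k. k \<in> Outs \<Longrightarrow> det2 (K k) = 0" by blast
      obtain k k' w w' m m' s s' where kk: "k \<in> Outs" "k' \<in> Outs" "K k = (\<lambda>x y. w x * m y)" "K k' = (\<lambda>x y. w' x * m' y)"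
        "w s \<noteq> 0" "w' s' \<noteq> 0" "cross2 m m' \<noteq> 0"
        by (rule rank_one_measurement[OF round.hyps(1) d])
      have "collapses V I a b c l" unfolding collapses_def
      proof (intro exI conjI ballI impI)
        show "cross2 (row_mult m B) (row_mult m' B) \<noteq> 0" using kk round.prems(2) by (simp add: cross2_row_mult)
        show "det2 C \<noteq> 0" by (rule round.prems(3))
        fix q i i' assume q: "q \<in> {row_mult m B, row_mult m' B}" and i: "i \<in> I" "i' \<in> I" "i \<noteq> i'"
        have go: "cinner (mat_apply C (cvec V a b c l (row_mult n B) i)) (mat_apply C (cvec V a b c l (row_mult n B) i')) = 0"
          if "t \<in> Outs" "K t = (\<lambda>x y. v x * n y)" "v r \<noteq> 0" for t v n r
          by (rule collapsed_orthogonal[where u = u and x = x and w = v and y = r, OF child[OF that(1)] round.prems(1) that(3) i])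
             (use i in \<open>simp add: PartyB round.prems(4) mat_apply_comb3 cvB that(2)\<close>)
        show "cinner (mat_apply C (cvec V a b c l q i)) (mat_apply C (cvec V a b c l q i')) = 0"
          using q go[OF kk(1,3,5)] go[OF kk(2,4,6)] by blast
      qed
      then show ?thesis ..
    qed
  next
    case PartyC
    show ?thesis
    proof (cases "\<exists>k\<in>Outs. det2 (K k) \<noteq> 0")
      case True
      then obtain k where k: "k \<in> Outs" "det2 (K k) \<noteq> 0" by blast
      show ?thesis
      proof (rule IH[of k u x B "op_mult (K k) C", OF k(1) round.prems(1,2)])
        show "det2 (op_mult (K k) C) \<noteq> 0" using k round.prems(3) by (simp add: det2_op_mult)
        fix i assume "i \<in> I"
        then show "mat_apply (local_op p (K k)) (\<psi> i) = comb3 (V i) (\<lambda>j x. bra l (a j) * u x) (\<lambda>j. mat_apply B (b j)) (\<lambda>j. mat_apply (op_mult (K k) C) (c j))"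
          by (simp add: PartyC round.prems(4) mat_apply_comb3 mat_apply_op_mult)
      qed
    next
      case False
      then have d: "\<And>k. k \<in> Outs \<Longrightarrow> det2 (K k) = 0" by blast
      obtain k k' w w' m m' s s' where kk: "k \<in> Outs" "k' \<in> Outs" "K k = (\<lambda>x y. w x * m y)" "K k' = (\<lambda>x y. w' x * m' y)"
        "w s \<noteq> 0" "w' s' \<noteq> 0" "cross2 m m' \<noteq> 0"
        by (rule rank_one_measurement[OF round.hyps(1) d])
      have "collapses V I a c b l" unfolding collapses_def
      proof (intro exI conjI ballI impI)
        show "cross2 (row_mult m C) (row_mult m' C) \<noteq> 0" using kk round.prems(3) by (simp add: cross2_row_mult)
        show "det2 B \<noteq> 0" by (rule round.prems(2))
        fix q i i' assume q: "q \<in> {row_mult m C, row_mult m' C}" and i: "i \<in> I" "i' \<in> I" "i \<noteq> i'"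
        have go: "cinner (mat_apply B (cvec V a c b l (row_mult n C) i)) (mat_apply B (cvec V a c b l (row_mult n C) i')) = 0"
          if "t \<in> Outs" "K t = (\<lambda>x y. v x * n y)" "v r \<noteq> 0" for t v n r
          by (rule collapsed_orthogonal[where u = u and x = x and w = v and y = r, OF child[OF that(1)] round.prems(1) that(3) i])
             (use i in \<open>simp add: PartyC round.prems(4) mat_apply_comb3 cvC that(2)\<close>)
        show "cinner (mat_apply B (cvec V a c b l q i)) (mat_apply B (cvec V a c b l q i')) = 0"
          using q go[OF kk(1,3,5)] go[OF kk(2,4,6)] by blast
      qed
      then show ?thesis ..
    qed
  qed
qed


section \<open>Exchanging the parties and the first collapse\<close>

definition swapAB :: "qstate \<Rightarrow> qstate" where
  "swapAB \<phi> = (\<lambda>(x, y, z). \<phi> (y, x, z))"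

definition swapAC :: "qstate \<Rightarrow> qstate" where
  "swapAC \<phi> = (\<lambda>(x, y, z). \<phi> (z, y, x))"

lemma swap_comb3:
  "swapAB (comb3 w a b c) = comb3 w b a c" "swapAC (comb3 w a b c) = comb3 w c b a"
  by (auto simp: swapAB_def swapAC_def comb3_def mult_ac)

lemma swap_local_op:
  "swapAB (mat_apply (local_op PartyA K) u) = mat_apply (local_op PartyB K) (swapAB u)"
  "swapAB (mat_apply (local_op PartyB K) u) = mat_apply (local_op PartyA K) (swapAB u)"
  "swapAB (mat_apply (local_op PartyC K) u) = mat_apply (local_op PartyC K) (swapAB u)"
  "swapAC (mat_apply (local_op PartyA K) u) = mat_apply (local_op PartyC K) (swapAC u)"
  "swapAC (mat_apply (local_op PartyB K) u) = mat_apply (local_op PartyB K) (swapAC u)"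
  "swapAC (mat_apply (local_op PartyC K) u) = mat_apply (local_op PartyA K) (swapAC u)"
  unfolding fun_eq_iff split_paired_All swapAB_def swapAC_def prod.case mat_apply_local by simp_all

lemma locc_dist_swap:
  assumes "locc_dist \<phi> I"
  shows "locc_dist (\<lambda>i. swapAB (\<phi> i)) I" "locc_dist (\<lambda>i. swapAC (\<phi> i)) I"
proof -
  have z: "swapAB u = (\<lambda>_. 0) \<longleftrightarrow> u = (\<lambda>_. 0)" "swapAC u = (\<lambda>_. 0) \<longleftrightarrow> u = (\<lambda>_. 0)" for u
    by (auto simp: fun_eq_iff swapAB_def swapAC_def)
  show "locc_dist (\<lambda>i. swapAB (\<phi> i)) I" using assms
  proof (induction rule: locc_dist.induct)
    case (leaf I \<psi>)
    then show ?case by (intro locc_dist.leaf) (simp add: z)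
  next
    case (round Outs K p \<psi> I)
    define p' where "p' = (case p of PartyA \<Rightarrow> PartyB | PartyB \<Rightarrow> PartyA | PartyC \<Rightarrow> PartyC)"
    have "swapAB (mat_apply (local_op p M) u) = mat_apply (local_op p' M) (swapAB u)" for M u
      by (cases p) (simp_all add: p'_def swap_local_op)
    then show ?case using round by (intro locc_dist.round[where p = p' and K = K and Outs = Outs]) simp_all
  qed
  show "locc_dist (\<lambda>i. swapAC (\<phi> i)) I" using assms
  proof (induction rule: locc_dist.induct)
    case (leaf I \<psi>)
    then show ?case by (intro locc_dist.leaf) (simp add: z)
  next
    case (round Outs K p \<psi> I)
    define p' where "p' = (case p of PartyA \<Rightarrow> PartyC | PartyB \<Rightarrow> PartyB | PartyC \<Rightarrow> PartyA)"
    have "swapAC (mat_apply (local_op p M) u) = mat_apply (local_op p' M) (swapAC u)" for M u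
      by (cases p) (simp_all add: p'_def swap_local_op)
    then show ?case using round by (intro locc_dist.round[where p = p' and K = K and Outs = Outs]) simp_all
  qed
qed

definition collapsing_pair :: "('i \<Rightarrow> ix \<Rightarrow> complex) \<Rightarrow> 'i set \<Rightarrow> (ix \<Rightarrow> qubit) \<Rightarrow> (ix \<Rightarrow> qubit) \<Rightarrow> (ix \<Rightarrow> qubit) \<Rightarrow> bool" where
  "collapsing_pair V I a b c \<longleftrightarrow> (\<exists>l l'. cross2 l l' \<noteq> 0 \<and>
     (collapses V I a b c l \<or> collapses V I a c b l) \<and> (collapses V I a b c l' \<or> collapses V I a c b l'))"

text \<open>The children are given only as some family that agrees on \<open>I\<close> with the
  stated vectors; this admits families obtained by exchanging parties, so the collapsing party may
  be taken to be the first.\<close>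

lemma first_collapse:
  assumes K: "complete_meas Outs K" and A: "det2 A \<noteq> 0" and B: "det2 B \<noteq> 0" and C: "det2 C \<noteq> 0"
    and d: "\<And>k. k \<in> Outs \<Longrightarrow> det2 (K k) = 0"
    and \<phi>: "\<And>k. k \<in> Outs \<Longrightarrow> \<exists>\<phi>. locc_dist \<phi> I \<and>
       (\<forall>i\<in>I. \<phi> i = comb3 (V i) (\<lambda>j. mat_apply (K k) (mat_apply A (a j))) (\<lambda>j. mat_apply B (b j)) (\<lambda>j. mat_apply C (c j)))"
  shows "collapsing_pair V I a b c"
proof -
  obtain k k' w w' m m' s s' where kk: "k \<in> Outs" "k' \<in> Outs" "K k = (\<lambda>x y. w x * m y)" "K k' = (\<lambda>x y. w' x * m' y)"
    "w s \<noteq> 0" "w' s' \<noteq> 0" "cross2 m m' \<noteq> 0"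
    by (rule rank_one_measurement[OF K d])
  have go: "collapses V I a b c (row_mult n A) \<or> collapses V I a c b (row_mult n A)"
    if t: "t \<in> Outs" "K t = (\<lambda>x y. v x * n y)" "v r \<noteq> 0" for t v n r
  proof -
    obtain \<phi>' where \<phi>': "locc_dist \<phi>' I" "\<And>i. i \<in> I \<Longrightarrow> \<phi>' i = comb3 (V i) (\<lambda>j. mat_apply (K t) (mat_apply A (a j))) (\<lambda>j. mat_apply B (b j)) (\<lambda>j. mat_apply C (c j))"
      using \<phi>[OF t(1)] by blast
    have "mat_apply (\<lambda>x y. v x * n y) q = (\<lambda>x. bra n q * v x)" for q
      by (auto simp: mat_apply_bool bra_def algebra_simps)
    then have e: "mat_apply (K t) (mat_apply A q) = (\<lambda>x. bra (row_mult n A) q * v x)" for q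
      unfolding t(2) bra_row_mult[symmetric] by simp
    show ?thesis
      by (rule collapsed_party_collapses[where u = v and x = r, OF \<phi>'(1) t(3) B C]) (simp add: \<phi>'(2) e)
  qed
  have "cross2 (row_mult m A) (row_mult m' A) \<noteq> 0" using kk A by (simp add: cross2_row_mult)
  then show ?thesis unfolding collapsing_pair_def using go[OF kk(1,3,5)] go[OF kk(2,4,6)] by blast
qed

lemma locc_dist_collapsing_pair:
  assumes "locc_dist \<phi> I" "det2 A \<noteq> 0" "det2 B \<noteq> 0" "det2 C \<noteq> 0"
    and "\<And>i. i \<in> I \<Longrightarrow> \<phi> i = comb3 (V i) (\<lambda>j. mat_apply A (a j)) (\<lambda>j. mat_apply B (b j)) (\<lambda>j. mat_apply C (c j))"
  shows "collapsing_pair V I a b c \<or> collapsing_pair V I b a c \<or> collapsing_pair V I c b a"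
  using assms
proof (induction arbitrary: A B C rule: locc_dist.induct)
  case (leaf I \<psi>)
  \<comment> \<open>A protocol may stop before anyone collapses; the two rows of the invertible
    \<open>A\<close> then play the part of \<open>l\<close> and \<open>l'\<close>.\<close>
  have "collapses V I a b c (A x)" for x
  proof (rule collapses_leaf[OF leaf.prems(3,2)])
    fix i k assume i: "i \<in> I" "k \<in> I" "i \<noteq> k"
    have "(\<forall>y z. (\<Sum>j\<in>UNIV. V s j * bra (A x) (a j) * mat_apply B (b j) y * mat_apply C (c j) z) = 0)"
      if s: "s \<in> I" "\<psi> s = (\<lambda>_. 0)" for s
    proof (intro allI)
      fix y z
      have "0 = \<psi> s (x, y, z)" using s by simp
      also have "\<dots> = (\<Sum>j\<in>UNIV. V s j * bra (A x) (a j) * mat_apply B (b j) y * mat_apply C (c j) z)"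
        unfolding leaf.prems(4)[OF s(1)] comb3_def by (simp add: mat_apply_bool[of A] bra_def)
      finally show "(\<Sum>j\<in>UNIV. V s j * bra (A x) (a j) * mat_apply B (b j) y * mat_apply C (c j) z) = 0" ..
    qed
    then show "(\<forall>y z. (\<Sum>j\<in>UNIV. V i j * bra (A x) (a j) * mat_apply B (b j) y * mat_apply C (c j) z) = 0) \<or>
       (\<forall>y z. (\<Sum>j\<in>UNIV. V k j * bra (A x) (a j) * mat_apply B (b j) y * mat_apply C (c j) z) = 0)"
      using leaf.hyps i by blast
  qed
  moreover have "cross2 (A False) (A True) \<noteq> 0" using leaf.prems(1) by (simp add: cross2_def det2_def)
  ultimately show ?case unfolding collapsing_pair_def by blast
next
  case (round Outs K p \<psi> I)
  have IH: "collapsing_pair V I a b c \<or> collapsing_pair V I b a c \<or> collapsing_pair V I c b a"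
    if "k \<in> Outs" "det2 A \<noteq> 0" "det2 B \<noteq> 0" "det2 C \<noteq> 0"
      "\<And>i. i \<in> I \<Longrightarrow> mat_apply (local_op p (K k)) (\<psi> i) = comb3 (V i) (\<lambda>j. mat_apply A (a j)) (\<lambda>j. mat_apply B (b j)) (\<lambda>j. mat_apply C (c j))"
    for k A B C
    using round.IH[THEN bspec, OF that(1), THEN conjunct2] that(2-) by blast
  have child: "locc_dist (\<lambda>i. mat_apply (local_op p (K k)) (\<psi> i)) I" if "k \<in> Outs" for k
    using round.IH that by blast
  show ?case
  proof (cases "\<exists>k\<in>Outs. det2 (K k) \<noteq> 0")
    case True
    then obtain k where k: "k \<in> Outs" "det2 (K k) \<noteq> 0" by blast
    show ?thesis
    proof (cases p)
      case PartyA
      show ?thesis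
        by (rule IH[OF k(1) _ round.prems(2,3), of "op_mult (K k) A"])
           (use k round.prems(1) in \<open>simp_all add: PartyA round.prems(4) det2_op_mult mat_apply_comb3 mat_apply_op_mult\<close>)
    next
      case PartyB
      show ?thesis
        by (rule IH[OF k(1) round.prems(1) _ round.prems(3), of "op_mult (K k) B"])
           (use k round.prems(2) in \<open>simp_all add: PartyB round.prems(4) det2_op_mult mat_apply_comb3 mat_apply_op_mult\<close>)
    next
      case PartyC
      show ?thesis
        by (rule IH[OF k(1) round.prems(1,2), of "op_mult (K k) C"])
           (use k round.prems(3) in \<open>simp_all add: PartyC round.prems(4) det2_op_mult mat_apply_comb3 mat_apply_op_mult\<close>)
    qed
  next
    case False
    then have d: "\<And>k. k \<in> Outs \<Longrightarrow> det2 (K k) = 0" by blast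
    show ?thesis
    proof (cases p)
      case PartyA
      have "collapsing_pair V I a b c"
      proof (rule first_collapse[OF round.hyps(1) round.prems(1,2,3) d])
        fix k assume k: "k \<in> Outs"
        show "\<exists>\<phi>. locc_dist \<phi> I \<and> (\<forall>i\<in>I. \<phi> i = comb3 (V i) (\<lambda>j. mat_apply (K k) (mat_apply A (a j))) (\<lambda>j. mat_apply B (b j)) (\<lambda>j. mat_apply C (c j)))"
          by (rule exI, rule conjI, rule child[OF k]) (simp add: PartyA round.prems(4) mat_apply_comb3)
      qed
      then show ?thesis by blast
    next
      case PartyB
      have "collapsing_pair V I b a c"
      proof (rule first_collapse[OF round.hyps(1) round.prems(2,1,3) d])
        fix k assume k: "k \<in> Outs"
        show "\<exists>\<phi>. locc_dist \<phi> I \<and> (\<forall>i\<in>I. \<phi> i = comb3 (V i) (\<lambda>j. mat_apply (K k) (mat_apply B (b j))) (\<lambda>j. mat_apply A (a j)) (\<lambda>j. mat_apply C (c j)))"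
          by (rule exI, rule conjI, rule locc_dist_swap(1)[OF child[OF k]]) (simp add: PartyB round.prems(4) mat_apply_comb3 swap_comb3)
      qed
      then show ?thesis by blast
    next
      case PartyC
      have "collapsing_pair V I c b a"
      proof (rule first_collapse[OF round.hyps(1) round.prems(3,2,1) d])
        fix k assume k: "k \<in> Outs"
        show "\<exists>\<phi>. locc_dist \<phi> I \<and> (\<forall>i\<in>I. \<phi> i = comb3 (V i) (\<lambda>j. mat_apply (K k) (mat_apply C (c j))) (\<lambda>j. mat_apply B (b j)) (\<lambda>j. mat_apply A (a j)))"
          by (rule exI, rule conjI, rule locc_dist_swap(2)[OF child[OF k]]) (simp add: PartyC round.prems(4) mat_apply_comb3 swap_comb3)
      qed
      then show ?thesis by blast
    qed
  qed
qed

lemma not_locc_dist_frames: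
  assumes V: "unitary_coeffs V I" and a: "frame ra a" and b: "frame rb b" and g: "frame rg g"
    and ab: "ra \<noteq> rb" "ra \<noteq> (\<lambda>j. - rb j)" and ag: "ra \<noteq> rg" "ra \<noteq> (\<lambda>j. - rg j)"
    and bg: "rb \<noteq> rg" "rb \<noteq> (\<lambda>j. - rg j)"
    and \<phi>: "\<And>i. i \<in> I \<Longrightarrow> \<phi> i = comb3 (V i) a b g"
  shows "\<not> locc_dist \<phi> I"
proof
  assume locc: "locc_dist \<phi> I"
  have id: "det2 id_op \<noteq> 0" by (simp add: det2_def id_op_def)
  have ap: "mat_apply id_op v = v" for v :: qubit
    by (auto simp: mat_apply_bool id_op_def fun_eq_iff)
  have ba: "rb \<noteq> ra" "rb \<noteq> (\<lambda>j. - ra j)" and ga: "rg \<noteq> ra" "rg \<noteq> (\<lambda>j. - ra j)"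
    and gb: "rg \<noteq> rb" "rg \<noteq> (\<lambda>j. - rb j)" using ab ag bg by auto
  have "collapsing_pair V I a b g \<or> collapsing_pair V I b a g \<or> collapsing_pair V I g b a"
    by (rule locc_dist_collapsing_pair[OF locc id id id]) (simp add: ap \<phi>)
  then show False
    unfolding collapsing_pair_def
    using no_two_collapsing_functionals[OF V a b g ab ag bg] no_two_collapsing_functionals[OF V b a g ba bg ag]
      no_two_collapsing_functionals[OF V g b a gb ga ba] by blast
qed

section \<open>The unextendible product basis\<close>

definition perp :: "real \<Rightarrow> qubit" where
  "perp \<theta> = (\<lambda>b. if b then complex_of_real (cos \<theta>) else - complex_of_real (sin \<theta>))"

fun vecA :: "real \<Rightarrow> ix \<Rightarrow> qubit" where
  "vecA \<theta> J1 = ket0" | "vecA \<theta> J2 = ket1" | "vecA \<theta> J3 = qb \<theta>" | "vecA \<theta> J4 = perp \<theta>"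

fun vecB :: "real \<Rightarrow> ix \<Rightarrow> qubit" where
  "vecB \<theta> J1 = ket0" | "vecB \<theta> J2 = qb \<theta>" | "vecB \<theta> J3 = ket1" | "vecB \<theta> J4 = perp \<theta>"

fun vecC :: "real \<Rightarrow> ix \<Rightarrow> qubit" where
  "vecC \<theta> J1 = ket0" | "vecC \<theta> J2 = qb \<theta>" | "vecC \<theta> J3 = perp \<theta>" | "vecC \<theta> J4 = ket1"

text \<open>The computational basis gets 1 and the rotated basis -1. The three parties pair the four
  product vectors into bases differently, and their patterns are the three ways to divide four
  indices into two pairs.\<close>

fun signA :: "ix \<Rightarrow> real" where
  "signA J1 = 1" | "signA J2 = 1" | "signA J3 = -1" | "signA J4 = -1"

fun signB :: "ix \<Rightarrow> real" where
  "signB J1 = 1" | "signB J2 = -1" | "signB J3 = 1" | "signB J4 = -1"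

fun signC :: "ix \<Rightarrow> real" where
  "signC J1 = 1" | "signC J2 = -1" | "signC J3 = -1" | "signC J4 = 1"

lemma all_ix: "(\<forall>j. P j) \<longleftrightarrow> P J1 \<and> P J2 \<and> P J3 \<and> P J4"
  by (metis ix.exhaust)

lemma sum_J: "sum f UNIV = f J1 + f J2 + f J3 + f J4" for f :: "ix \<Rightarrow> 'a::comm_monoid_add"
  by (rule sum_ix) simp

lemma prod_J: "prod f UNIV = f J1 * f J2 * f J3 * f J4" for f :: "ix \<Rightarrow> 'a::comm_monoid_mult"
  by (rule prod_ix) simp

lemma cos_sin_square: "complex_of_real (cos \<theta>) * complex_of_real (cos \<theta>) = 1 - complex_of_real (sin \<theta>) * complex_of_real (sin \<theta>)"
proof -
  have "cos \<theta> * cos \<theta> = 1 - sin \<theta> * sin \<theta>"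
    using sin_cos_squared_add3[of \<theta>] by linarith
  then have "complex_of_real (cos \<theta> * cos \<theta>) = complex_of_real (1 - sin \<theta> * sin \<theta>)" by simp
  then show ?thesis by simp
qed

lemmas vec_defs = ket0_def ket1_def qb_def perp_def

lemma sin_cos_nonzero:
  assumes "0 < \<theta>" "\<theta> < pi / 2"
  shows "sin \<theta> \<noteq> 0" "cos \<theta> \<noteq> 0"
  using assms sin_gt_zero2[of \<theta>] cos_gt_zero[of \<theta>] by auto

lemma frame_vecA:
  assumes "0 < \<theta>" "\<theta> < pi / 2"
  shows "frame signA (vecA \<theta>)"
  unfolding frame_def all_ix sum_J prod_J
  using sin_cos_nonzero[OF assms] by (auto simp: all_bool_eq vec_defs cross2_def cos_sin_square)

lemma frame_vecB:
  assumes "0 < \<theta>" "\<theta> < pi / 2"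
  shows "frame signB (vecB \<theta>)"
  unfolding frame_def all_ix sum_J prod_J
  using sin_cos_nonzero[OF assms] by (auto simp: all_bool_eq vec_defs cross2_def cos_sin_square)

lemma frame_vecC:
  assumes "0 < \<theta>" "\<theta> < pi / 2"
  shows "frame signC (vecC \<theta>)"
  unfolding frame_def all_ix sum_J prod_J
  using sin_cos_nonzero[OF assms] by (auto simp: all_bool_eq vec_defs cross2_def cos_sin_square)

lemma sign_distinct:
  "signA \<noteq> signB" "signA \<noteq> (\<lambda>j. - signB j)" "signA \<noteq> signC" "signA \<noteq> (\<lambda>j. - signC j)"
  "signB \<noteq> signC" "signB \<noteq> (\<lambda>j. - signC j)"
  by (simp_all add: fun_eq_iff all_ix)

lemma cinner_vec:
  "cinner ket0 ket0 = 1" "cinner ket1 ket1 = 1" "cinner ket0 ket1 = 0" "cinner ket1 ket0 = 0"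
  "cinner (qb \<theta>) (qb \<theta>) = 1" "cinner (perp \<theta>) (perp \<theta>) = 1" "cinner (qb \<theta>) (perp \<theta>) = 0" "cinner (perp \<theta>) (qb \<theta>) = 0"
  by (simp_all add: cinner_bool vec_defs cos_sin_square)

text \<open>The orthogonal complement is a line, so the given perpendicular vectors are the real
  ones up to phases, which do not affect the span.\<close>

lemma orthogonal_to_qb:
  assumes "cinner p p = 1" "cinner (qb \<theta>) p = 0"
  obtains \<omega> where "cnj \<omega> * \<omega> = 1" "p = (\<lambda>x. \<omega> * perp \<theta> x)"
proof
  let ?c = "complex_of_real (cos \<theta>)" and ?s = "complex_of_real (sin \<theta>)"
  \<comment> \<open>The phase is the inner product of \<open>perp \<theta>\<close> with
    \<open>p\<close>.\<close>
  let ?w = "?c * p True - ?s * p False"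
  have o: "?c * p False + ?s * p True = 0" using assms(2) by (simp add: cinner_bool qb_def)
  have cs: "?c * ?c + ?s * ?s = 1" by (simp add: cos_sin_square)
  have "?w * (- ?s) = (?c * ?c + ?s * ?s) * p False - ?c * (?c * p False + ?s * p True)"
    "?w * ?c = (?c * ?c + ?s * ?s) * p True - ?s * (?c * p False + ?s * p True)"
    by (simp_all add: algebra_simps)
  then have "p False = ?w * (- ?s)" "p True = ?w * ?c" unfolding o cs by simp_all
  then show p: "p = (\<lambda>x. ?w * perp \<theta> x)"
    unfolding fun_eq_iff all_bool_eq perp_def by simp
  have "cinner (\<lambda>x. w * perp \<theta> x) (\<lambda>x. w * perp \<theta> x) = cnj w * w * cinner (perp \<theta>) (perp \<theta>)" for w
    by (simp add: cinner_bool algebra_simps)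
  from this[of ?w] show "cnj ?w * ?w = 1"
    unfolding p[symmetric] assms(1) cinner_vec(6) by simp
qed

definition upb :: "real \<Rightarrow> real \<Rightarrow> real \<Rightarrow> ix \<Rightarrow> qstate" where
  "upb \<theta>1 \<theta>2 \<theta>3 j = ket3 (vecA \<theta>1 j) (vecB \<theta>2 j) (vecC \<theta>3 j)"

lemma cinner_upb: "cinner (upb \<theta>1 \<theta>2 \<theta>3 j) (upb \<theta>1 \<theta>2 \<theta>3 k) = (if j = k then 1 else 0)"
  by (cases j; cases k; simp add: upb_def cinner_ket3 cinner_vec)

lemma cinner_sum_right:
  "cinner u (\<lambda>x. \<Sum>k\<in>A. c k * f k x) = (\<Sum>k\<in>A. c k * cinner u (f k))"
proof -
  have "cinner u (\<lambda>x. \<Sum>k\<in>A. c k * f k x) = (\<Sum>x\<in>UNIV. \<Sum>k\<in>A. c k * (cnj (u x) * f k x))"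
    unfolding cinner_def sum_distrib_left by (intro sum.cong refl) (simp add: mult_ac)
  also have "\<dots> = (\<Sum>k\<in>A. c k * cinner u (f k))"
    unfolding cinner_def sum_distrib_left by (rule sum.swap)
  finally show ?thesis .
qed

lemma cinner_cnj: "cnj (cinner u v) = cinner v u"
  by (simp add: cinner_def mult.commute)

lemma cspan_scaled_member:
  assumes "finite X" "v \<in> X"
  shows "(\<lambda>x. t * v x) \<in> cspan X"
proof -
  have "(\<lambda>x. t * v x) = (\<lambda>x. \<Sum>u\<in>X. (if u = v then t else 0) * u x)"
  proof
    fix x
    have "(\<Sum>u\<in>X. (if u = v then t else 0) * u x) = (\<Sum>u\<in>X. if u = v then t * v x else 0)"
      by (intro sum.cong) auto
    then show "t * v x = (\<Sum>u\<in>X. (if u = v then t else 0) * u x)" using assms by simp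
  qed
  then show ?thesis unfolding cspan_def mem_Collect_eq by (intro exI[of _ "\<lambda>u. if u = v then t else 0"]) simp
qed

lemma cspan_subset_combinations:
  fixes T :: "ix \<Rightarrow> qstate"
  assumes "\<And>v. v \<in> X \<Longrightarrow> \<exists>d. v = (\<lambda>x. \<Sum>j\<in>UNIV. d j * T j x)" and "f \<in> cspan X"
  obtains d where "f = (\<lambda>x. \<Sum>j\<in>UNIV. d j * T j x)"
proof -
  obtain c where c: "f = (\<lambda>x. \<Sum>v\<in>X. c v * v x)" using assms(2) by (auto simp: cspan_def)
  obtain D where D: "\<And>v. v \<in> X \<Longrightarrow> v = (\<lambda>x. \<Sum>j\<in>UNIV. D v j * T j x)" using assms(1) by metis
  have "f = (\<lambda>x. \<Sum>j\<in>UNIV. (\<Sum>v\<in>X. c v * D v j) * T j x)"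
  proof
    fix x
    have "f x = (\<Sum>v\<in>X. c v * (\<Sum>j\<in>UNIV. D v j * T j x))"
      unfolding c
    proof (intro sum.cong refl)
      fix v assume "v \<in> X"
      then have "v x = (\<Sum>j\<in>UNIV. D v j * T j x)" using fun_cong[OF D, of v x] by simp
      then show "c v * v x = c v * (\<Sum>j\<in>UNIV. D v j * T j x)" by simp
    qed
    also have "\<dots> = (\<Sum>v\<in>X. \<Sum>j\<in>UNIV. c v * D v j * T j x)"
      by (simp add: sum_distrib_left mult.assoc)
    also have "\<dots> = (\<Sum>j\<in>UNIV. \<Sum>v\<in>X. c v * D v j * T j x)" by (rule sum.swap)
    also have "\<dots> = (\<Sum>j\<in>UNIV. (\<Sum>v\<in>X. c v * D v j) * T j x)"
      by (simp add: sum_distrib_right)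
    finally show "f x = (\<Sum>j\<in>UNIV. (\<Sum>v\<in>X. c v * D v j) * T j x)" .
  qed
  then show thesis by (rule that)
qed

text \<open>Rows are orthonormal because the states are and each is a combination of the
  \<open>T j\<close>; columns because the \<open>T j\<close> are orthonormal and, by
  \<open>TS\<close>, each is a combination of the states.\<close>

lemma onb_unitary_coeffs:
  fixes T :: "ix \<Rightarrow> qstate"
  assumes T: "\<And>j k. cinner (T j) (T k) = (if j = k then 1 else 0)" and B: "is_onb_of S B"
    and TS: "\<And>j. T j \<in> S" and ST: "\<And>f. f \<in> S \<Longrightarrow> \<exists>d. f = (\<lambda>x. \<Sum>j\<in>UNIV. d j * T j x)"
  defines "V \<equiv> \<lambda>i j. cinner (T j) i"
  shows "unitary_coeffs V B" and "\<And>i. i \<in> B \<Longrightarrow> i = (\<lambda>x. \<Sum>j\<in>UNIV. V i j * T j x)"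
proof -
  have fin: "finite B" and sp: "cspan B = S" and on: "\<And>i k. i \<in> B \<Longrightarrow> k \<in> B \<Longrightarrow> cinner i k = (if i = k then 1 else 0)"
    using B unfolding is_onb_of_def by auto
  show ex: "i = (\<lambda>x. \<Sum>j\<in>UNIV. V i j * T j x)" if "i \<in> B" for i
  proof -
    have "i \<in> S" using cspan_scaled_member[OF fin that, of 1] sp by simp
    then obtain d where d: "i = (\<lambda>x. \<Sum>j\<in>UNIV. d j * T j x)" using ST by blast
    have "V i j = d j" for j
    proof -
      have "V i j = (\<Sum>k\<in>UNIV. d k * cinner (T j) (T k))"
        unfolding V_def by (subst d) (rule cinner_sum_right)
      also have "\<dots> = d j" by (simp add: T if_distrib cong: if_cong)
      finally show ?thesis .
    qed
    then show ?thesis using d by simp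
  qed
  have "(\<Sum>j\<in>UNIV. V i j * cnj (V k j)) = (if i = k then 1 else 0)" if ik: "i \<in> B" "k \<in> B" for i k
  proof -
    have "(\<Sum>j\<in>UNIV. V i j * cnj (V k j)) = (\<Sum>j\<in>UNIV. V i j * cinner k (T j))"
      by (simp add: V_def cinner_cnj)
    also have "\<dots> = cinner k (\<lambda>x. \<Sum>j\<in>UNIV. V i j * T j x)" by (rule cinner_sum_right[symmetric])
    also have "\<dots> = cinner k i" using ex[OF ik(1)] by simp
    finally show ?thesis using on[OF ik(2,1)] by auto
  qed
  moreover have "(\<Sum>i\<in>B. V i j * cnj (V i k)) = (if j = k then 1 else 0)" for j k
  proof -
    obtain e where e: "T k = (\<lambda>x. \<Sum>i\<in>B. e i * i x)" using TS[of k] sp unfolding cspan_def by auto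
    have ei: "cinner i (T k) = e i" if "i \<in> B" for i
    proof -
      have "cinner i (T k) = (\<Sum>u\<in>B. e u * cinner i u)"
        by (subst e) (rule cinner_sum_right[where f = "\<lambda>u. u"])
      also have "\<dots> = (\<Sum>u\<in>B. if u = i then e i else 0)"
        by (intro sum.cong refl) (use on that in auto)
      also have "\<dots> = e i" using that fin by simp
      finally show ?thesis .
    qed
    have "(\<Sum>i\<in>B. V i j * cnj (V i k)) = (\<Sum>i\<in>B. e i * cinner (T j) i)"
      by (intro sum.cong refl) (simp add: V_def cinner_cnj ei mult.commute)
    also have "\<dots> = cinner (T j) (T k)"
      by (subst e) (rule cinner_sum_right[where f = "\<lambda>u. u", symmetric])
    finally show ?thesis using T by simp
  qed
  ultimately show "unitary_coeffs V B" unfolding unitary_coeffs_def using fin by blast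
qed

lemma ket3_scale:
  "ket3 (\<lambda>x. s * a x) b c = (\<lambda>x. s * ket3 a b c x)"
  "ket3 a (\<lambda>x. s * b x) c = (\<lambda>x. s * ket3 a b c x)"
  "ket3 a b (\<lambda>x. s * c x) = (\<lambda>x. s * ket3 a b c x)"
  by (auto simp: ket3_def mult_ac)

lemma upb_span_not_locc:
  assumes \<theta>: "0 < \<theta>1" "\<theta>1 < pi / 2" "0 < \<theta>2" "\<theta>2 < pi / 2" "0 < \<theta>3" "\<theta>3 < pi / 2"
    and B: "is_onb_of (cspan X) B" and X: "finite X" 
    and XT: "\<And>v. v \<in> X \<Longrightarrow> \<exists>j s. v = (\<lambda>x. s * upb \<theta>1 \<theta>2 \<theta>3 j x)"
    and TX: "\<And>j. \<exists>v\<in>X. \<exists>s. upb \<theta>1 \<theta>2 \<theta>3 j = (\<lambda>x. s * v x)"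
  shows "\<not> locc_dist id B"
proof -
  let ?T = "upb \<theta>1 \<theta>2 \<theta>3"
  define V where "V i j = cinner (?T j) i" for i j
  have TS: "?T j \<in> cspan X" for j using TX[of j] cspan_scaled_member[OF X] by metis
  have ST: "\<exists>d. f = (\<lambda>x. \<Sum>j\<in>UNIV. d j * ?T j x)" if f: "f \<in> cspan X" for f
  proof -
    have X': "\<exists>d. v = (\<lambda>x. \<Sum>j\<in>UNIV. d j * ?T j x)" if "v \<in> X" for v
    proof -
      obtain j s where v: "v = (\<lambda>x. s * ?T j x)" using XT[OF \<open>v \<in> X\<close>] by blast
      have "s * ?T j x = (\<Sum>k\<in>UNIV. (if k = j then s else 0) * ?T k x)" for x
      proof -
        have "(\<Sum>k\<in>UNIV. (if k = j then s else 0) * ?T k x) = (\<Sum>k\<in>UNIV. if k = j then s * ?T j x else 0)"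
          by (intro sum.cong) auto
        then show ?thesis by simp
      qed
      then show ?thesis unfolding v by (intro exI[of _ "\<lambda>k. if k = j then s else 0"]) simp
    qed
    obtain d where "f = (\<lambda>x. \<Sum>j\<in>UNIV. d j * ?T j x)"
      by (rule cspan_subset_combinations[OF X' f])
    then show ?thesis by (intro exI[of _ d])
  qed
  have U: "unitary_coeffs V B" and ex: "\<And>i. i \<in> B \<Longrightarrow> i = (\<lambda>x. \<Sum>j\<in>UNIV. V i j * ?T j x)"
    unfolding V_def using onb_unitary_coeffs[OF cinner_upb B TS ST] by blast+
  have "(\<lambda>x. \<Sum>j\<in>UNIV. V i j * ?T j x) = comb3 (V i) (vecA \<theta>1) (vecB \<theta>2) (vecC \<theta>3)" for i
    by (auto simp: fun_eq_iff comb3_def upb_def ket3_def mult.assoc)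
  then have \<phi>: "id i = comb3 (V i) (vecA \<theta>1) (vecB \<theta>2) (vecC \<theta>3)" if "i \<in> B" for i
    using ex[OF that] by simp
  show ?thesis
    by (rule not_locc_dist_frames[OF U frame_vecA[OF \<theta>(1,2)] frame_vecB[OF \<theta>(3,4)] frame_vecC[OF \<theta>(5,6)] sign_distinct \<phi>])
qed


section \<open>The separable measurement\<close>

lemma resolution_qb:
  assumes p: "cinner p p = 1" "cinner (qb \<theta>) p = 0"
  shows "qb \<theta> y * cnj (qb \<theta> z) + p y * cnj (p z) = id_op y z"
proof -
  obtain w where w: "cnj w * w = 1" "p = (\<lambda>x. w * perp \<theta> x)" using orthogonal_to_qb[OF p] by blast
  have "p y * cnj (p z) = (cnj w * w) * (perp \<theta> y * cnj (perp \<theta> z))" unfolding w(2) by (simp add: mult_ac)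
  then have "p y * cnj (p z) = perp \<theta> y * cnj (perp \<theta> z)" unfolding w(1) by simp
  then show ?thesis by (cases y; cases z) (simp_all add: vec_defs id_op_def cos_sin_square)
qed

lemma resolution_ket: "ket0 y * cnj (ket0 z) + ket1 y * cnj (ket1 z) = id_op y z"
  by (cases y; cases z) (simp_all add: vec_defs id_op_def)

text \<open>Measurement operators are square matrices here, so the functional is given the fixed
  output vector \<open>ket0\<close>.\<close>

definition bra_op :: "qubit \<Rightarrow> bool op" where
  "bra_op a = (\<lambda>x y. if x then 0 else cnj (a y))"

lemma tensor3_bra_op_ket3_zero:
  assumes "cinner a a' = 0 \<or> cinner b b' = 0 \<or> cinner c c' = 0"
  shows "mat_apply (tensor3 (bra_op a) (bra_op b) (bra_op c)) (ket3 a' b' c') = (\<lambda>_. 0)"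
proof -
  have "mat_apply (tensor3 (bra_op a) (bra_op b) (bra_op c)) (ket3 a' b' c') (x, y, z) =
     (if x \<or> y \<or> z then 0 else cinner a a' * cinner b b' * cinner c c')" for x y z
    unfolding mat_apply_def sum_qubits tensor3_def ket3_def prod.case bra_op_def UNIV_bool cinner_bool
    by (simp add: algebra_simps)
  then show ?thesis using assms by (auto simp: fun_eq_iff)
qed

lemma tensor3_bra_op_gram:
  "(\<Sum>x\<in>UNIV. cnj (tensor3 (bra_op a) (bra_op b) (bra_op c) x (y1, y2, y3)) * tensor3 (bra_op a) (bra_op b) (bra_op c) x (z1, z2, z3))
    = (a y1 * cnj (a z1)) * (b y2 * cnj (b z2)) * (c y3 * cnj (c z3))"
  unfolding sum_qubits tensor3_def prod.case bra_op_def UNIV_bool by simp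

text \<open>Among the eight products of primed and unprimed vectors there are three disjoint pairs
  differing in one factor: \<open>a b c\<close> and \<open>a' b c\<close>, \<open>a b c'\<close> and
  \<open>a b' c'\<close>, \<open>a' b' c\<close> and \<open>a' b' c'\<close>. In each pair this
  factor is replaced by \<open>ket0\<close> and \<open>ket1\<close>, which keeps the span;
  \<open>a b' c\<close> and \<open>a' b c'\<close> stay.\<close>

lemma product_basis_complete:
  assumes A: "\<And>y z. a y * cnj (a z) + a' y * cnj (a' z) = id_op y z"
    and B: "\<And>y z. b y * cnj (b z) + b' y * cnj (b' z) = id_op y z"
    and C: "\<And>y z. c y * cnj (c z) + c' y * cnj (c' z) = id_op y z"
  defines "L \<equiv> [(ket0, b, c), (a, b', c), (a, ket0, c'), (a', b', ket0), (a', b, c'),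
      (ket1, b, c), (a, ket1, c'), (a', b', ket1)]"
  shows "complete_meas {..<8} (\<lambda>m. tensor3 (bra_op (fst (L ! m))) (bra_op (fst (snd (L ! m)))) (bra_op (snd (snd (L ! m)))))"
proof -
  have "(\<Sum>k<8. \<Sum>x\<in>UNIV. cnj (tensor3 (bra_op (fst (L ! k))) (bra_op (fst (snd (L ! k)))) (bra_op (snd (snd (L ! k)))) x (y1, y2, y3)) *
       tensor3 (bra_op (fst (L ! k))) (bra_op (fst (snd (L ! k)))) (bra_op (snd (snd (L ! k)))) x (z1, z2, z3)) =
       id_op (y1, y2, y3) (z1, z2, z3)" for y1 y2 y3 z1 z2 z3
  proof -
    define p where "p v y z = v y * cnj (v z)" for v :: qubit and y z
    have K: "p ket1 y z = id_op y z - p ket0 y z" for y z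
      using resolution_ket[of y z] by (simp add: p_def algebra_simps)
    have a': "p a' y z = id_op y z - p a y z" and b': "p b' y z = id_op y z - p b y z"
      and c': "p c' y z = id_op y z - p c y z" for y z
      using A[of y z] B[of y z] C[of y z] by (simp_all add: p_def algebra_simps)
    have "(\<Sum>k<8. \<Sum>x\<in>UNIV. cnj (tensor3 (bra_op (fst (L ! k))) (bra_op (fst (snd (L ! k)))) (bra_op (snd (snd (L ! k)))) x (y1, y2, y3)) *
       tensor3 (bra_op (fst (L ! k))) (bra_op (fst (snd (L ! k)))) (bra_op (snd (snd (L ! k)))) x (z1, z2, z3)) =
       (\<Sum>k<8. p (fst (L ! k)) y1 z1 * p (fst (snd (L ! k))) y2 z2 * p (snd (snd (L ! k))) y3 z3)"
      unfolding tensor3_bra_op_gram p_def ..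
    also have "\<dots> = id_op y1 z1 * id_op y2 z2 * id_op y3 z3"
      unfolding L_def by (simp add: eval_nat_numeral K a' b' c' algebra_simps)
    also have "\<dots> = id_op (y1, y2, y3) (z1, z2, z3)" by (simp add: id_op_def)
    finally show ?thesis .
  qed
  then show ?thesis unfolding complete_meas_def by auto
qed

theorem theorem5:
  fixes \<theta>1 \<theta>2 \<theta>3 :: real and Aperp Bperp Cperp :: qubit
  assumes "0 < \<theta>1" "\<theta>1 < pi / 2" "0 < \<theta>2" "\<theta>2 < pi / 2" "0 < \<theta>3" "\<theta>3 < pi / 2"
    and "cinner Aperp Aperp = 1" "cinner (qb \<theta>1) Aperp = 0"
    and "cinner Bperp Bperp = 1" "cinner (qb \<theta>2) Bperp = 0"
    and "cinner Cperp Cperp = 1" "cinner (qb \<theta>3) Cperp = 0"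
  defines "S \<equiv> cspan {ket3 ket0 ket0 ket0, ket3 ket1 (qb \<theta>2) (qb \<theta>3),
                       ket3 (qb \<theta>1) ket1 Cperp, ket3 Aperp Bperp ket1}"
  shows "(\<forall>B. is_onb_of S B \<longrightarrow> \<not> locc_dist id B) \<and> (\<exists>B. is_onb_of S B \<and> sep_dist id B)"
proof (intro conjI allI impI)
  let ?S1 = "ket3 ket0 ket0 ket0" and ?S2 = "ket3 ket1 (qb \<theta>2) (qb \<theta>3)"
  let ?S3 = "ket3 (qb \<theta>1) ket1 Cperp" and ?S4 = "ket3 Aperp Bperp ket1"
  let ?X = "{?S1, ?S2, ?S3, ?S4}"
  fix B assume B: "is_onb_of S B"
  obtain wa where wa: "cnj wa * wa = 1" "Aperp = (\<lambda>x. wa * perp \<theta>1 x)" using orthogonal_to_qb[OF assms(7,8)] by blast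
  obtain wb where wb: "cnj wb * wb = 1" "Bperp = (\<lambda>x. wb * perp \<theta>2 x)" using orthogonal_to_qb[OF assms(9,10)] by blast
  obtain wc where wc: "cnj wc * wc = 1" "Cperp = (\<lambda>x. wc * perp \<theta>3 x)" using orthogonal_to_qb[OF assms(11,12)] by blast
  let ?T = "upb \<theta>1 \<theta>2 \<theta>3"
  have S: "?S1 = (\<lambda>x. 1 * ?T J1 x)" "?S2 = (\<lambda>x. 1 * ?T J2 x)" "?S3 = (\<lambda>x. wc * ?T J3 x)" "?S4 = (\<lambda>x. (wa * wb) * ?T J4 x)"
    unfolding wa(2) wb(2) wc(2) ket3_scale upb_def by (simp_all add: mult_ac)
  show "\<not> locc_dist id B"
  proof (rule upb_span_not_locc[OF assms(1-6) B[unfolded S_def]])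
    show "\<exists>j s. v = (\<lambda>x. s * ?T j x)" if "v \<in> ?X" for v using that S by blast
    show "\<exists>v\<in>?X. \<exists>s. ?T j = (\<lambda>x. s * v x)" for j
    proof (cases j)
      case J1
      have "?T j = (\<lambda>x. 1 * ?S1 x)" unfolding J1 S(1) by simp
      then show ?thesis by blast
    next
      case J2
      have "?T j = (\<lambda>x. 1 * ?S2 x)" unfolding J2 S(2) by simp
      then show ?thesis by blast
    next
      case J3
      have "?T j = (\<lambda>x. cnj wc * ?S3 x)" unfolding J3 S(3) mult.assoc[symmetric] wc(1) by simp
      then show ?thesis by blast
    next
      case J4
      have "cnj (wa * wb) * (wa * wb) = (cnj wa * wa) * (cnj wb * wb)" by (simp add: mult_ac)
      then have "cnj (wa * wb) * (wa * wb) = 1" unfolding wa(1) wb(1) by simp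
      then have "?T j = (\<lambda>x. cnj (wa * wb) * ?S4 x)" unfolding J4 S(4) mult.assoc[of "cnj (wa * wb)", symmetric] by simp
      then show ?thesis by blast
    qed
  qed simp
next
  let ?S1 = "ket3 ket0 ket0 ket0" and ?S2 = "ket3 ket1 (qb \<theta>2) (qb \<theta>3)"
  let ?S3 = "ket3 (qb \<theta>1) ket1 Cperp" and ?S4 = "ket3 Aperp Bperp ket1"
  let ?X = "{?S1, ?S2, ?S3, ?S4}"
  have perp: "cinner Aperp (qb \<theta>1) = 0" "cinner Bperp (qb \<theta>2) = 0" "cinner Cperp (qb \<theta>3) = 0"
    using assms(8,10,12) cinner_cnj by (metis complex_cnj_zero)+
  note ips = cinner_ket3 cinner_vec perp assms(7-12)
  have orth: "cinner ?S1 ?S2 = 0" "cinner ?S1 ?S3 = 0" "cinner ?S1 ?S4 = 0" "cinner ?S2 ?S3 = 0" "cinner ?S2 ?S4 = 0" "cinner ?S3 ?S4 = 0"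
    "cinner ?S2 ?S1 = 0" "cinner ?S3 ?S1 = 0" "cinner ?S4 ?S1 = 0" "cinner ?S3 ?S2 = 0" "cinner ?S4 ?S2 = 0" "cinner ?S4 ?S3 = 0"
    by (simp_all add: ips)
  have norm: "cinner ?S1 ?S1 = 1" "cinner ?S2 ?S2 = 1" "cinner ?S3 ?S3 = 1" "cinner ?S4 ?S4 = 1"
    by (simp_all add: ips)
  have onb: "is_onb_of S ?X"
    unfolding is_onb_of_def S_def using orth norm by blast
  define L where "L = [(ket0, qb \<theta>2, qb \<theta>3), (qb \<theta>1, Bperp, qb \<theta>3), (qb \<theta>1, ket0, Cperp), (Aperp, Bperp, ket0),
      (Aperp, qb \<theta>2, Cperp), (ket1, qb \<theta>2, qb \<theta>3), (qb \<theta>1, ket1, Cperp), (Aperp, Bperp, ket1)]"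
  define f where "f m = [?S1, ?S1, ?S1, ?S1, ?S1, ?S2, ?S3, ?S4] ! m" for m
  have comp: "complete_meas {..<8} (\<lambda>m. tensor3 (bra_op (fst (L ! m))) (bra_op (fst (snd (L ! m)))) (bra_op (snd (snd (L ! m)))))"
    unfolding L_def
    by (rule product_basis_complete[OF resolution_qb[OF assms(7,8)] resolution_qb[OF assms(9,10)] resolution_qb[OF assms(11,12)]])
  have zero: "mat_apply (tensor3 (bra_op (fst (L ! m))) (bra_op (fst (snd (L ! m)))) (bra_op (snd (snd (L ! m))))) i = (\<lambda>_. 0)"
    if "i \<in> ?X" "m < 8" "f m \<noteq> i" for i m
  proof -
    have "m \<in> {0, 1, 2, 3, 4, 5, 6, 7}" using that(2) by auto
    then show ?thesis
      using that(1,3) unfolding L_def f_def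
      by (auto simp: tensor3_bra_op_ket3_zero ips)
  qed
  have "sep_dist id ?X"
    unfolding sep_dist_def
    by (rule exI[of _ "{..<8}"], rule exI[of _ "\<lambda>m. bra_op (fst (L ! m))"], rule exI[of _ "\<lambda>m. bra_op (fst (snd (L ! m)))"],
        rule exI[of _ "\<lambda>m. bra_op (snd (snd (L ! m)))"], rule exI[of _ f]) (use comp zero in auto)
  then show "\<exists>B. is_onb_of S B \<and> sep_dist id B" using onb by blast
qed

end
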